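(* Let $p\in(1,\infty)$ and $q\in[1,\infty]$. There is a constant $C=C(N,\alpha,\beta,p)$ such that, if $u$ is a nontrivial nonnegative $L^q$-solution to the problem $$\partial_t^\alpha u+(-\Delta)^\beta u=|u|^{p-1}u,\qquad u(\cdot,0)=u_0,$$ with initial datum $u_0\in L^q(\mathbb{R}^N)$ satisfying $$R^{\frac{\alpha}{p-1}-\frac{N\alpha}{2\beta}}\int_{|y|<R^{\frac\alpha{2\beta}}} u_0(y)\,dy >C\quad\text{for some }R>0,$$ then $\limsup_{t\nearrow T}\|u(\cdot,t)\|_{L^q(\mathbb{R}^N)}=\infty$ for some $T\in(0,\infty)$.
   Context: Throughout, $\alpha\in(0,1)$, $\beta\in(0,1]$, and $N>4\beta$, where $N$ is the space dimension. $\partial_t^\alpha$ is the Caputo derivative, defined for smooth functions by $\partial_t^\alpha u(x,t)=\frac1{\Gamma(1-\alpha)}\,\partial_t\int_0^t\frac{u(x,s)-u(x,0)}{(t-s)^\alpha}\,ds$, and $(-\Delta)^\beta$ is the usual $\beta$ power of the Laplacian, i.e. the operator with Fourier symbol $|\xi|^{2\beta}$. $Z$ is the fundamental solution of the linear equation $\partial_t^\alpha u+(-\Delta)^\beta u=0$ (with initial datum a Dirac mass at the origin), and $Y={}^{R}\partial_t^{1-\alpha}Z$, where ${}^{R}\partial_t^{1-\alpha}$ is the Riemann-Liouville derivative of order $1-\alpha$, that is, $Y(x,t)=\frac{1}{\Gamma(\alpha)}\,\partial_t\int_0^t\frac{Z(x,s)}{(t-s)^{1-\alpha}}\,ds$.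 For $q\in[1,\infty]$ and $u_0\in L^q(\mathbb{R}^N)$, an $L^q$-solution of the problem with initial datum $u_0$ and existence time $T_*\in(0,\infty]$ is a function $u\in L^\infty_{\rm loc}([0,T_* );L^q(\mathbb{R}^N))$ satisfying $$u(x,t)=\int_{\mathbb{R}^N} u_0(y)Z(x-y,t)\,dy+\int_0^t\int_{\mathbb{R}^N}|u(y,s)|^{p-1}u(y,s)Y(x-y,t-s)\,dy\,ds$$ in $L^q(\mathbb{R}^N)$ for almost all $t\in(0,T_* )$, and such that $\operatorname{ess\,lim}_{t\to0^+}\|u(\cdot,t)-u_0\|_{L^q(\mathbb{R}^N)}=0$. Nontrivial means not identically zero (almost everywhere).
   Formalization: The solution is also assumed to be followed as long as its L^q norm stays bounded (if T_* is finite, u is not bounded in L^q on (0,T_* )); without this the claim fails for restrictions of a solution to shorter time intervals. The condition is void for T_* = ∞. *)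

theory Defs
  imports "HOL-Probability.Essential_Supremum"
begin

text \<open>Fractional calculus on the half-line. The Riemann--Liouville derivative of order \<open>\<gamma>\<close> in
  \<open>(0,1)\<close> is the derivative of the fractional integral of order \<open>1 - \<gamma>\<close>; the Caputo derivative
  of \<open>f\<close> is the Riemann--Liouville derivative of \<open>f - f 0\<close>. The Caputo derivative is given as a
  relation, so that the existence of the outer time derivative is part of it.\<close>

definition frac_integral ::
    "real \<Rightarrow> (real \<Rightarrow> 'b::{banach,second_countable_topology}) \<Rightarrow> real \<Rightarrow> 'b" where
  "frac_integral \<gamma> f t =
     (1 / Gamma \<gamma>) *\<^sub>R (LBINT s:{0<..<t}. ((t - s) powr (\<gamma> - 1)) *\<^sub>R f s)"

definition has_caputo_derivative ::
    "real \<Rightarrow> (real \<Rightarrow> 'b::{banach,second_countable_topology}) \<Rightarrow> 'b \<Rightarrow> real \<Rightarrow> bool" where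
  "has_caputo_derivative \<alpha> f D t \<longleftrightarrow>
     (frac_integral (1 - \<alpha>) (\<lambda>s. f s - f 0) has_vector_derivative D) (at t)"

definition riemann_liouville_derivative :: "real \<Rightarrow> (real \<Rightarrow> real) \<Rightarrow> real \<Rightarrow> real" where
  "riemann_liouville_derivative \<gamma> f t = deriv (frac_integral (1 - \<gamma>) f) t"

definition fourier_transform :: "(real ^ 'n \<Rightarrow> real) \<Rightarrow> real ^ 'n \<Rightarrow> complex" where
  "fourier_transform f \<xi> = (LBINT x. complex_of_real (f x) * cis (- (\<xi> \<bullet> x)))"

text \<open>The fundamental solution: \<open>Z(\<cdot>,t)\<close> is integrable for \<open>t > 0\<close> and the equation
  holds in the Fourier variable, where \<open>(-\<Delta>)\<^sup>\<beta>\<close> is multiplication by \<open>|\<xi>|\<^sup>2\<^sup>\<beta>\<close> and the Dirac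
  mass at the origin becomes the constant 1. Note that \<open>Z\<close> itself carries no value at \<open>t = 0\<close>, whence
  the case distinction. Requiring continuity away from \<open>x = 0\<close> (where \<open>Z\<close> is singular) selects
  the pointwise representative, which is needed because \<open>Y\<close> is obtained from \<open>Z\<close> by
  differentiating in time at fixed \<open>x\<close>. Both conditions together determine \<open>Z x t\<close> for all
  \<open>x \<noteq> 0\<close> and \<open>t > 0\<close>.\<close>

definition fundamental_solution :: "real \<Rightarrow> real \<Rightarrow> (real ^ 'n \<Rightarrow> real \<Rightarrow> real) \<Rightarrow> bool" where
  "fundamental_solution \<alpha> \<beta> Z \<longleftrightarrow>
     continuous_on ((- {0}) \<times> {0<..}) (\<lambda>(x, t). Z x t) \<and>
     (\<forall>t>0. integrable lborel (\<lambda>x. Z x t)) \<and>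
     (\<forall>\<xi>. let w = (\<lambda>t. if t = 0 then 1 else fourier_transform (\<lambda>x. Z x t) \<xi>) in
        continuous_on {0..} w \<and>
        (\<forall>t>0. has_caputo_derivative \<alpha> w (- ((norm \<xi> powr (2 * \<beta>)) *\<^sub>R w t)) t))"

definition Y_kernel :: "real \<Rightarrow> (real ^ 'n \<Rightarrow> real \<Rightarrow> real) \<Rightarrow> real ^ 'n \<Rightarrow> real \<Rightarrow> real" where
  "Y_kernel \<alpha> Z x t = riemann_liouville_derivative (1 - \<alpha>) (Z x) t"

definition Lq_norm :: "ereal \<Rightarrow> (real ^ 'n \<Rightarrow> real) \<Rightarrow> ennreal" where
  "Lq_norm q f =
     (if q = \<infinity> then esssup lborel (\<lambda>x. ennreal \<bar>f x\<bar>)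
      else let I = (\<integral>\<^sup>+ x. ennreal (\<bar>f x\<bar> powr real_of_ereal q) \<partial>lborel)
           in if I = \<infinity> then \<infinity> else ennreal (enn2real I powr (1 / real_of_ereal q)))"

definition in_Lq :: "ereal \<Rightarrow> (real ^ 'n \<Rightarrow> real) \<Rightarrow> bool" where
  "in_Lq q f \<longleftrightarrow> f \<in> borel_measurable lborel \<and> Lq_norm q f < \<infinity>"

text \<open>One-sided filters modulo null sets: limits and upper limits along them are the essential
  ones, as is appropriate for functions of \<open>t\<close> that are defined only almost everywhere.\<close>

definition ess_at_right :: "real \<Rightarrow> real filter" where
  "ess_at_right a = inf (at_right a) (ae_filter lborel)"

definition ess_at_left :: "real \<Rightarrow> real filter" where
  "ess_at_left a = inf (at_left a) (ae_filter lborel)"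

definition bounded_in_Lq :: "ereal \<Rightarrow> (real ^ 'n \<Rightarrow> real \<Rightarrow> real) \<Rightarrow> real \<Rightarrow> bool" where
  "bounded_in_Lq q u \<tau> \<longleftrightarrow>
     (\<exists>M::real. AE t in lborel. 0 < t \<and> t < \<tau> \<longrightarrow> Lq_norm q (\<lambda>x. u x t) \<le> ennreal M)"

text \<open>\<open>L\<^sup>q\<close>-solutions with existence time \<open>Tstar\<close>. The double integral is understood as absolutely
  convergent; this has to be said because the Bochner integral of a non-integrable function is 0.
  The convolution of the initial datum with \<open>Z\<close> converges absolutely almost everywhere anyway.\<close>

definition Lq_solution ::
    "real \<Rightarrow> real \<Rightarrow> ereal \<Rightarrow> (real ^ 'n \<Rightarrow> real \<Rightarrow> real) \<Rightarrow> (real ^ 'n \<Rightarrow> real)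
      \<Rightarrow> (real ^ 'n \<Rightarrow> real \<Rightarrow> real) \<Rightarrow> ereal \<Rightarrow> bool" where
  "Lq_solution \<alpha> p q Z u0 u Tstar \<longleftrightarrow>
     0 < Tstar \<and> in_Lq q u0 \<and>
     set_borel_measurable borel (UNIV \<times> {t. 0 < t \<and> ereal t < Tstar}) (\<lambda>(x, t). u x t) \<and>
     (\<forall>\<tau>>0. ereal \<tau> < Tstar \<longrightarrow> bounded_in_Lq q u \<tau>) \<and>
     (AE t in lborel. 0 < t \<and> ereal t < Tstar \<longrightarrow>
        (AE x in lborel.
           set_integrable (lborel \<Otimes>\<^sub>M lborel) (UNIV \<times> {0<..<t})
             (\<lambda>(y, s). \<bar>u y s\<bar> powr (p - 1) * u y s * Y_kernel \<alpha> Z (x - y) (t - s)) \<and>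
           u x t = (LBINT y. u0 y * Z (x - y) t) +
             (LBINT s:{0<..<t}. LBINT y. \<bar>u y s\<bar> powr (p - 1) * u y s * Y_kernel \<alpha> Z (x - y) (t - s)))) \<and>
     ((\<lambda>t. Lq_norm q (\<lambda>x. u x t - u0 x)) \<longlongrightarrow> 0) (ess_at_right 0)"

text \<open>The restriction of a solution to a shorter time interval is again a solution, so a statement
  about blow-up concerns solutions followed for as long as they remain bounded in \<open>L\<^sup>q\<close>.
  The condition is void for global solutions.\<close>

definition maximal_in_Lq :: "ereal \<Rightarrow> (real ^ 'n \<Rightarrow> real \<Rightarrow> real) \<Rightarrow> ereal \<Rightarrow> bool" where
  "maximal_in_Lq q u Tstar \<longleftrightarrow> (\<forall>T>0. ereal T \<le> Tstar \<and> bounded_in_Lq q u T \<longrightarrow> ereal T < Tstar)"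

definition nonneg_on_time :: "(real ^ 'n \<Rightarrow> real \<Rightarrow> real) \<Rightarrow> ereal \<Rightarrow> bool" where
  "nonneg_on_time u Tstar \<longleftrightarrow>
     (AE t in lborel. 0 < t \<and> ereal t < Tstar \<longrightarrow> (AE x in lborel. 0 \<le> u x t))"

definition trivial_on_time :: "(real ^ 'n \<Rightarrow> real \<Rightarrow> real) \<Rightarrow> ereal \<Rightarrow> bool" where
  "trivial_on_time u Tstar \<longleftrightarrow>
     (AE t in lborel. 0 < t \<and> ereal t < Tstar \<longrightarrow> (AE x in lborel. u x t = 0))"

end

theory Submission
  imports Defs "HOL-Real_Asymp.Real_Asymp" "HOL-Probability.Probability"
    "HOL-Complex_Analysis.Cauchy_Integral_Formula"
begin

text \<open>
  A solution whose maximal time \<open>T\<close> is finite blows up at \<open>T\<close>: it is bounded on every shorter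
  interval, so a finite upper limit at \<open>T\<close> would make it bounded on \<open>(0, T)\<close>, against maximality.
  The substance is that no nonnegative solution with a large initial mass is global.

  For this, let \<open>F t\<close> be the mass of \<open>u\<close> at time \<open>t\<close> in the ball \<open>B\<close> of radius
  \<open>R\<^sup>\<alpha>\<^sup>/\<^sup>2\<^sup>\<beta>\<close>. If both kernels are nonnegative and are bounded below, by their self-similar size, in
  the parabolic region \<open>|x| \<le> K t\<^sup>\<alpha>\<^sup>/\<^sup>2\<^sup>\<beta>\<close>, then integrating the equation over \<open>B\<close> and using Jensen's
  inequality gives, for almost all \<open>t < R\<close>,

    \<open>F t \<ge> A\<close> if \<open>t > R/4\<close>, and \<open>F t \<ge> \<kappa> \<integral>\<^sub>0\<^sup>t F s\<^sup>p ds\<close>,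

  where \<open>A\<close> is a multiple of the initial mass in \<open>B\<close>. The lag kernel \<open>(t - s)\<^sup>\<alpha>\<^sup>-\<^sup>1\<close> is bounded below
  by \<open>R\<^sup>\<alpha>\<^sup>-\<^sup>1\<close> for lags below \<open>R\<close>, so an inequality of the type \<open>F' \<ge> \<kappa> F\<^sup>p\<close> remains. It forces
  \<open>F = \<infinity>\<close> on \<open>(R/2, R)\<close> as soon as \<open>\<kappa> R A\<^sup>p\<^sup>-\<^sup>1\<close> exceeds a constant, and this is the size condition
  on \<open>u\<^sub>0\<close> (\<open>blowup_iteration\<close>, \<open>no_global_solution\<close>).

  The lower bounds for the kernels (\<open>fundamental_solution_lower_bounds\<close>) come from subordination.
  Let \<open>S\<^sub>\<alpha>\<close> and \<open>S\<^sub>\<beta>\<close> be independent positive stable variables, \<open>E exp (- z S\<^sub>\<gamma>) = exp (- z\<^sup>\<gamma>)\<close>, and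
  put \<open>V = S\<^sub>\<beta> S\<^sub>\<alpha>\<^sup>-\<^sup>\<alpha>\<^sup>/\<^sup>\<beta>\<close>, \<open>\<Theta> = \<alpha> S\<^sub>\<alpha>\<^sup>-\<^sup>\<alpha>\<close>. With the Gaussian heat kernel \<open>G\<^sub>r\<close>,

    \<open>Z x t = E (G\<^bsub>V t^(\<alpha>/\<beta>)\<^esub> x)\<close> and \<open>Y x t = t\<^sup>\<alpha>\<^sup>-\<^sup>1 E (\<Theta> G\<^bsub>V t^(\<alpha>/\<beta>)\<^esub> x)\<close>,

  and in this form positivity and the lower bounds are evident. The formula for \<open>Z\<close> holds because
  both sides have the same Fourier transform. That of the given \<open>Z\<close> is pinned down by uniqueness for
  the fractional relaxation equation (\<open>caputo_relaxation_unique\<close>); that of the mixture is a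
  Mittag-Leffler function, because the negative moments of \<open>S\<^sub>\<alpha>\<close> are the coefficients of one
  (\<open>mittag_leffler_subordination\<close>). The formula for \<open>Y\<close> follows by the same comparison, applied to
  the fractional integral of \<open>Z\<close> in time and the primitive of the claimed \<open>Y\<close>.
\<close>

section \<open>Mittag-Leffler functions and fractional integrals\<close>

definition mittag_leffler :: "real \<Rightarrow> real \<Rightarrow> real \<Rightarrow> real" where
  "mittag_leffler \<alpha> \<mu> x = (\<Sum>k. x ^ k / Gamma (\<alpha> * real k + \<mu>))"

text \<open>For \<open>\<mu> = 1\<close> this is the solution of the Caputo relaxation equation with rate \<open>a\<close> and initial
  value 1, for \<open>\<mu> = \<alpha>\<close> the corresponding impulse response. The family in \<open>\<mu>\<close> is used because fractional
  integration of order \<open>\<nu>\<close> acts on it by \<open>\<mu> \<mapsto> \<mu> + \<nu>\<close>.\<close>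

definition ml_kernel :: "real \<Rightarrow> real \<Rightarrow> real \<Rightarrow> real \<Rightarrow> real" where
  "ml_kernel \<alpha> \<mu> a t = t powr (\<mu> - 1) * mittag_leffler \<alpha> \<mu> (- a * t powr \<alpha>)"

text \<open>Log-convexity of the Gamma function at \<open>y = \<alpha> (y - 1 + \<alpha>) + (1 - \<alpha>) (y + \<alpha>)\<close>, combined with the
  functional equation that links the two end points.\<close>

lemma Gamma_ratio_bound:
  fixes y \<alpha> :: real
  assumes "1 < y" "0 < \<alpha>" "\<alpha> \<le> 1"
  shows "Gamma y \<le> Gamma (y + \<alpha>) * (y - 1 + \<alpha>) powr - \<alpha>"
proof -
  define p where "p = y - 1 + \<alpha>"
  have p: "0 < p" using assms by (simp add: p_def)
  have G: "Gamma (y + \<alpha>) = p * Gamma p"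
    using Gamma_plus1[of p] p by (simp add: p_def add.commute nonpos_Ints_def)
  have "(ln \<circ> Gamma) ((1 - \<alpha>) *\<^sub>R (y + \<alpha>) + \<alpha> *\<^sub>R p) \<le> (1 - \<alpha>) * (ln \<circ> Gamma) (y + \<alpha>) + \<alpha> * (ln \<circ> Gamma) p"
    using assms p by (intro convex_onD[OF log_convex_Gamma_real]) auto
  moreover have y: "(1 - \<alpha>) *\<^sub>R (y + \<alpha>) + \<alpha> *\<^sub>R p = y"
    by (simp add: p_def algebra_simps)
  moreover have "ln (Gamma (y + \<alpha>)) = ln p + ln (Gamma p)"
    using p by (simp add: G ln_mult Gamma_real_pos less_imp_neq[symmetric])
  ultimately have "ln (Gamma y) \<le> ln (Gamma (y + \<alpha>)) - \<alpha> * ln p"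
    unfolding y by (simp add: algebra_simps)
  then have "exp (ln (Gamma y)) \<le> exp (ln (Gamma (y + \<alpha>)) + - \<alpha> * ln p)" by simp
  then show ?thesis
    using assms p unfolding exp_add p_def[symmetric] by (simp add: powr_def)
qed

text \<open>The quotient of consecutive terms is at most \<open>|x| y\<^sup>-\<^sup>\<alpha>\<close> with \<open>y = \<alpha> k + \<mu> - 1 + \<alpha>\<close>, hence tends
  to 0.\<close>

lemma summable_mittag_leffler:
  fixes \<alpha> \<mu> x :: real
  assumes "0 < \<alpha>" "\<alpha> \<le> 1" "0 < \<mu>"
  shows "summable (\<lambda>k. x ^ k / Gamma (\<alpha> * real k + \<mu>))"
proof -
  have "((\<lambda>k. \<bar>x\<bar> * (\<alpha> * real k + \<mu> - 1 + \<alpha>) powr - \<alpha>) \<longlongrightarrow> 0) sequentially"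
    using assms by real_asymp
  then have "eventually (\<lambda>k. \<bar>x\<bar> * (\<alpha> * real k + \<mu> - 1 + \<alpha>) powr - \<alpha> < 1/2) sequentially"
    by (rule order_tendstoD) simp
  moreover have "eventually (\<lambda>k. 1 < \<alpha> * real k + \<mu>) sequentially"
    using assms by real_asymp
  ultimately have "eventually (\<lambda>k. \<bar>x\<bar> * (\<alpha> * real k + \<mu> - 1 + \<alpha>) powr - \<alpha> < 1/2 \<and> 1 < \<alpha> * real k + \<mu>) sequentially"
    by (rule eventually_conj)
  then obtain N where N: "\<And>k. N \<le> k \<Longrightarrow> \<bar>x\<bar> * (\<alpha> * real k + \<mu> - 1 + \<alpha>) powr - \<alpha> < 1/2"
    "\<And>k. N \<le> k \<Longrightarrow> 1 < \<alpha> * real k + \<mu>"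
    unfolding eventually_sequentially by blast
  show ?thesis
  proof (rule summable_ratio_test[of "1/2" N])
    fix k assume k: "N \<le> k"
    define y where "y = \<alpha> * real k + \<mu>"
    have y: "1 < y" "\<bar>x\<bar> * (y - 1 + \<alpha>) powr - \<alpha> < 1/2" using N[OF k] by (auto simp: y_def)
    have y': "\<alpha> * real (Suc k) + \<mu> = y + \<alpha>" by (simp add: y_def algebra_simps)
    have G: "0 < Gamma y" "0 < Gamma (y + \<alpha>)" using y assms by auto
    have "\<bar>x\<bar> * Gamma y \<le> \<bar>x\<bar> * (Gamma (y + \<alpha>) * (y - 1 + \<alpha>) powr - \<alpha>)"
      using Gamma_ratio_bound[of y \<alpha>] y assms by (intro mult_left_mono) auto
    also have "\<dots> = Gamma (y + \<alpha>) * (\<bar>x\<bar> * (y - 1 + \<alpha>) powr - \<alpha>)" by simp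
    also have "\<dots> \<le> Gamma (y + \<alpha>) * (1/2)"
      using y G by (intro mult_left_mono) auto
    finally have "\<bar>x\<bar> / Gamma (y + \<alpha>) \<le> 1/2 * (1 / Gamma y)"
      using G by (simp add: field_simps)
    then have "\<bar>x\<bar> ^ k * (\<bar>x\<bar> / Gamma (y + \<alpha>)) \<le> \<bar>x\<bar> ^ k * (1/2 * (1 / Gamma y))"
      by (intro mult_left_mono) auto
    then show "norm (x ^ Suc k / Gamma (\<alpha> * real (Suc k) + \<mu>)) \<le> 1/2 * norm (x ^ k / Gamma (\<alpha> * real k + \<mu>))"
      unfolding y' y_def[symmetric] using G by (simp add: abs_mult power_abs mult_ac)
  qed simp
qed

lemma isCont_mittag_leffler:
  assumes "0 < \<alpha>" "\<alpha> \<le> 1" "0 < \<mu>"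
  shows "isCont (mittag_leffler \<alpha> \<mu>) x"
proof -
  have "isCont (\<lambda>x. \<Sum>k. inverse (Gamma (\<alpha> * real k + \<mu>)) * x ^ k) x"
    by (rule isCont_powser_converges_everywhere)
      (use summable_mittag_leffler[OF assms] in \<open>simp add: field_simps\<close>)
  then show ?thesis by (simp add: mittag_leffler_def[abs_def] field_simps)
qed

lemma ml_kernel_sums:
  assumes "0 < \<alpha>" "\<alpha> \<le> 1" "0 < \<mu>" "0 < t"
  shows "(\<lambda>k. (- a) ^ k * t powr (\<alpha> * real k + \<mu> - 1) / Gamma (\<alpha> * real k + \<mu>)) sums ml_kernel \<alpha> \<mu> a t"
    and "summable (\<lambda>k. \<bar>a\<bar> ^ k * t powr (\<alpha> * real k + \<mu> - 1) / Gamma (\<alpha> * real k + \<mu>))"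
proof -
  have eq: "b ^ k * t powr (\<alpha> * real k + \<mu> - 1) / Gamma (\<alpha> * real k + \<mu>) =
    t powr (\<mu> - 1) * ((b * t powr \<alpha>) ^ k / Gamma (\<alpha> * real k + \<mu>))" for b k
  proof -
    have "t powr (\<alpha> * real k + \<mu> - 1) = t powr (\<mu> - 1) * t powr (\<alpha> * real k)"
      by (subst powr_add[symmetric]) (simp add: algebra_simps)
    also have "t powr (\<alpha> * real k) = (t powr \<alpha>) ^ k"
      using assms by (simp add: powr_powr[symmetric] powr_realpow)
    finally show ?thesis by (simp add: power_mult_distrib)
  qed
  show "(\<lambda>k. (- a) ^ k * t powr (\<alpha> * real k + \<mu> - 1) / Gamma (\<alpha> * real k + \<mu>)) sums ml_kernel \<alpha> \<mu> a t"
    unfolding eq ml_kernel_def mittag_leffler_def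
    using summable_mittag_leffler[OF assms(1-3)] by (intro sums_mult summable_sums) simp
  show "summable (\<lambda>k. \<bar>a\<bar> ^ k * t powr (\<alpha> * real k + \<mu> - 1) / Gamma (\<alpha> * real k + \<mu>))"
    unfolding eq using summable_mittag_leffler[OF assms(1-3)] by (intro summable_mult) simp
qed

text \<open>Splitting off the first term of the series. By \<open>frac_integral_ml_kernel\<close> below, the last summand
  is a fractional integral of the left-hand side, so this is its Volterra equation.\<close>

lemma ml_kernel_rec:
  assumes "0 < \<alpha>" "\<alpha> \<le> 1" "0 < \<mu>" "0 < t"
  shows "ml_kernel \<alpha> \<mu> a t = t powr (\<mu> - 1) / Gamma \<mu> - a * ml_kernel \<alpha> (\<mu> + \<alpha>) a t"
proof -
  let ?f = "\<lambda>k. (- a) ^ k * t powr (\<alpha> * real k + \<mu> - 1) / Gamma (\<alpha> * real k + \<mu>)"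
  have 1: "?f sums ml_kernel \<alpha> \<mu> a t" by (rule ml_kernel_sums) fact+
  have "(\<lambda>k. (- a) * ((- a) ^ k * t powr (\<alpha> * real k + (\<mu> + \<alpha>) - 1) / Gamma (\<alpha> * real k + (\<mu> + \<alpha>))))
     sums ((- a) * ml_kernel \<alpha> (\<mu> + \<alpha>) a t)"
    by (intro sums_mult ml_kernel_sums) (use assms in auto)
  moreover have "(- a) * ((- a) ^ k * t powr (\<alpha> * real k + (\<mu> + \<alpha>) - 1) / Gamma (\<alpha> * real k + (\<mu> + \<alpha>))) = ?f (Suc k)" for k
  proof -
    have "\<alpha> * real (Suc k) + \<mu> = \<alpha> * real k + (\<mu> + \<alpha>)" by (simp add: algebra_simps)
    then show ?thesis by (simp only: power_Suc mult.assoc times_divide_eq_right)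
  qed
  ultimately have "(\<lambda>k. ?f (Suc k)) sums ((- a) * ml_kernel \<alpha> (\<mu> + \<alpha>) a t)" by (simp only:)
  then have "?f sums ((- a) * ml_kernel \<alpha> (\<mu> + \<alpha>) a t + ?f 0)" by (subst (asm) sums_Suc_iff) simp
  from sums_unique2[OF 1 this] show ?thesis by simp
qed

text \<open>Euler's Beta integral, moved from the unit interval to \<open>(\<tau>, t)\<close>.\<close>

lemma has_bochner_integral_beta:
  fixes \<mu> \<nu> \<tau> t :: real
  assumes "0 < \<mu>" "0 < \<nu>" "\<tau> < t"
  shows "has_bochner_integral lborel (\<lambda>s. indicator {\<tau><..<t} s * ((t - s) powr (\<nu> - 1) * (s - \<tau>) powr (\<mu> - 1)))
     (Beta \<mu> \<nu> * (t - \<tau>) powr (\<mu> + \<nu> - 1))"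
proof -
  let ?h = "\<lambda>s. indicator {\<tau><..<t} s * ((t - s) powr (\<nu> - 1) * (s - \<tau>) powr (\<mu> - 1))"
  let ?g = "\<lambda>x::real. x powr (\<mu> - 1) * (1 - x) powr (\<nu> - 1)"
  define c where "c = t - \<tau>"
  have c: "0 < c" using assms by (simp add: c_def)
  have i: "set_integrable lborel {0..1} ?g" by (rule integrable_Beta) fact+
  have "(LBINT x:{0..1}. ?g x) = integral {0..1} ?g"
    by (rule set_borel_integral_eq_integral[OF i])
  also have "\<dots> = Beta \<mu> \<nu>" using has_integral_Beta_real[OF assms(1,2)] by (rule integral_unique)
  finally have 1: "has_bochner_integral lborel (\<lambda>x. indicator {0..1} x * ?g x) (Beta \<mu> \<nu>)"
    using i by (simp add: has_bochner_integral_iff set_integrable_def set_lebesgue_integral_def)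
  have "has_bochner_integral lborel (\<lambda>x. (c powr (\<mu> + \<nu> - 2)) * (indicator {0..1} x * ?g x)) (c powr (\<mu> + \<nu> - 2) * Beta \<mu> \<nu>)"
    by (rule has_bochner_integral_mult_right) (use 1 in auto)
  then have "has_bochner_integral lborel (\<lambda>x. (c powr (\<mu> + \<nu> - 2)) * (indicator {0<..<1} x * ?g x)) (c powr (\<mu> + \<nu> - 2) * Beta \<mu> \<nu>)"
  proof (rule has_bochner_integral_discrete_difference[where X = "{0,1}", THEN iffD1, rotated -1])
  qed (auto simp: indicator_def)
  moreover have "(c powr (\<mu> + \<nu> - 2)) * (indicator {0<..<1} x * ?g x) =
    indicator {\<tau><..<t} (\<tau> + c * x) * ((t - (\<tau> + c * x)) powr (\<nu> - 1) * (\<tau> + c * x - \<tau>) powr (\<mu> - 1))" for x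
  proof (cases "0 < x \<and> x < 1")
    case True
    have "t - (\<tau> + c * x) = c * (1 - x)" by (simp add: c_def algebra_simps)
    then have "(t - (\<tau> + c * x)) powr (\<nu> - 1) * (\<tau> + c * x - \<tau>) powr (\<mu> - 1) =
      (c powr (\<nu> - 1) * c powr (\<mu> - 1)) * ?g x"
      using True c by (simp add: powr_mult)
    also have "c powr (\<nu> - 1) * c powr (\<mu> - 1) = c powr (\<mu> + \<nu> - 2)"
      by (subst powr_add[symmetric]) (simp add: algebra_simps)
    finally have "(t - (\<tau> + c * x)) powr (\<nu> - 1) * (\<tau> + c * x - \<tau>) powr (\<mu> - 1) = c powr (\<mu> + \<nu> - 2) * ?g x" .
    moreover have "\<tau> + c * x \<in> {\<tau><..<t}"
    proof -
      have "c * x < c * 1" using True c by (intro mult_strict_left_mono) auto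
      moreover have "\<tau> + c = t" by (simp add: c_def)
      moreover have "0 < c * x" using True c by simp
      ultimately show ?thesis unfolding greaterThanLessThan_iff by linarith
    qed
    ultimately show ?thesis using True by simp
  next
    case False
    then have "\<not> (\<tau> < \<tau> + c * x \<and> \<tau> + c * x < t)"
    proof -
      have "\<tau> + c = t" by (simp add: c_def)
      moreover have "c * x \<le> 0 \<or> c \<le> c * x"
        using False c mult_left_mono[of 1 x c] by (auto simp: mult_le_0_iff not_less)
      ultimately show ?thesis by linarith
    qed
    then show ?thesis using False by (auto simp: indicator_def)
  qed
  ultimately have 2: "has_bochner_integral lborel (\<lambda>x. indicator {\<tau><..<t} (\<tau> + c * x) * ((t - (\<tau> + c * x)) powr (\<nu> - 1) * (\<tau> + c * x - \<tau>) powr (\<mu> - 1))) (c powr (\<mu> + \<nu> - 2) * Beta \<mu> \<nu>)"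
    by simp
  have "c * (c powr (\<mu> + \<nu> - 2) * Beta \<mu> \<nu>) = Beta \<mu> \<nu> * c powr (\<mu> + \<nu> - 1)"
    using c powr_add[of c 1 "\<mu> + \<nu> - 2"] by (simp add: algebra_simps)
  moreover have "has_bochner_integral lborel (?h) (\<bar>c\<bar> *\<^sub>R (c powr (\<mu> + \<nu> - 2) * Beta \<mu> \<nu>))"
    using 2 c lborel_has_bochner_integral_real_affine_iff[of c "?h" "\<bar>c\<bar> *\<^sub>R (c powr (\<mu> + \<nu> - 2) * Beta \<mu> \<nu>)" \<tau>]
    by (simp add: field_simps)
  ultimately have "has_bochner_integral lborel (?h) (Beta \<mu> \<nu> * c powr (\<mu> + \<nu> - 1))"
    using c by (simp only: abs_of_pos real_scaleR_def)
  then show ?thesis by (simp only: c_def)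
qed

text \<open>Each power is integrated by the Beta integral, and the series may be integrated term by term since
  the same computation with \<open>|a|\<close> in place of \<open>- a\<close> gives a convergent series of norms. The first part
  is the integrability that this entails.\<close>

lemma frac_integral_ml_kernel:
  assumes "0 < \<alpha>" "\<alpha> \<le> 1" "0 < \<mu>" "0 < \<nu>" "0 < t"
  shows "set_integrable lborel {0<..<t} (\<lambda>s. (t - s) powr (\<nu> - 1) *\<^sub>R ml_kernel \<alpha> \<mu> a s)"
    and "frac_integral \<nu> (ml_kernel \<alpha> \<mu> a) t = ml_kernel \<alpha> (\<mu> + \<nu>) a t"
proof -
  let ?b = "\<lambda>k s. indicator {0<..<t} s * ((t - s) powr (\<nu> - 1) * (s - 0) powr (\<alpha> * real k + \<mu> - 1))"
  let ?c = "\<lambda>k. (- a) ^ k * t powr (\<alpha> * real k + (\<mu> + \<nu>) - 1) / Gamma (\<alpha> * real k + (\<mu> + \<nu>))"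
  define h where "h k s = (- a) ^ k / Gamma (\<alpha> * real k + \<mu>) *
      (?b k s)" for k s
  define c where "c k = Beta (\<alpha> * real k + \<mu>) \<nu> * t powr (\<alpha> * real k + \<mu> + \<nu> - 1)" for k
  have pos: "0 < \<alpha> * real k + \<mu>" for k using assms by (simp add: add_nonneg_pos)
  have hb: "has_bochner_integral lborel (\<lambda>s. ?b k s) (c k)" for k
    using has_bochner_integral_beta[OF pos assms(4,5), of k] by (simp add: c_def)
  have h: "has_bochner_integral lborel (h k) ((- a) ^ k / Gamma (\<alpha> * real k + \<mu>) * c k)" for k
    unfolding h_def by (rule has_bochner_integral_mult_right) (use hb in auto)
  have nh: "norm (h k s) = \<bar>a\<bar> ^ k / Gamma (\<alpha> * real k + \<mu>) *
      (?b k s)" for k s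
    using Gamma_real_pos[OF pos[of k]] by (simp add: h_def abs_mult power_abs)
  have "has_bochner_integral lborel (\<lambda>s. norm (h k s)) (\<bar>a\<bar> ^ k / Gamma (\<alpha> * real k + \<mu>) * c k)" for k
    unfolding nh by (rule has_bochner_integral_mult_right) (use hb in auto)
  then have nhi: "(LBINT s. norm (h k s)) = \<bar>a\<bar> ^ k / Gamma (\<alpha> * real k + \<mu>) * c k" for k
    by (simp add: has_bochner_integral_iff)
  have ceq: "b ^ k / Gamma (\<alpha> * real k + \<mu>) * c k =
     Gamma \<nu> * (b ^ k * t powr (\<alpha> * real k + (\<mu> + \<nu>) - 1) / Gamma (\<alpha> * real k + (\<mu> + \<nu>)))" for b k
    using Gamma_real_pos[OF pos[of k]] by (simp add: c_def Beta_def add.assoc)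
  have sumb: "summable (\<lambda>k. LBINT s. norm (h k s))"
    unfolding nhi ceq using assms by (intro summable_mult ml_kernel_sums(2)) auto
  have hs: "(\<lambda>k. h k s) sums (indicator {0<..<t} s * ((t - s) powr (\<nu> - 1) * ml_kernel \<alpha> \<mu> a s))"
    and hn: "summable (\<lambda>k. norm (h k s))" for s
  proof -
    show "(\<lambda>k. h k s) sums (indicator {0<..<t} s * ((t - s) powr (\<nu> - 1) * ml_kernel \<alpha> \<mu> a s))"
    proof (cases "s \<in> {0<..<t}")
      case True
      have "(\<lambda>k. (t - s) powr (\<nu> - 1) * ((- a) ^ k * s powr (\<alpha> * real k + \<mu> - 1) / Gamma (\<alpha> * real k + \<mu>)))
         sums ((t - s) powr (\<nu> - 1) * ml_kernel \<alpha> \<mu> a s)"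
        by (intro sums_mult ml_kernel_sums) (use assms True in auto)
      then show ?thesis using True by (simp add: h_def mult_ac)
    qed (simp add: h_def)
    show "summable (\<lambda>k. norm (h k s))"
    proof (cases "s \<in> {0<..<t}")
      case True
      have "summable (\<lambda>k. (t - s) powr (\<nu> - 1) * (\<bar>a\<bar> ^ k * s powr (\<alpha> * real k + \<mu> - 1) / Gamma (\<alpha> * real k + \<mu>)))"
        by (intro summable_mult ml_kernel_sums) (use assms True in auto)
      then show ?thesis using True unfolding nh by (simp add: mult_ac)
    qed (simp add: h_def)
  qed
  have int: "integrable lborel (h k)" for k using h by (simp add: has_bochner_integral_iff)
  have I: "integrable lborel (\<lambda>s. \<Sum>k. h k s)" and S: "(\<lambda>k. LBINT s. h k s) sums (LBINT s. \<Sum>k. h k s)"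
    by (rule integrable_suminf[OF int AE_I2[OF hn] sumb], rule sums_integral[OF int AE_I2[OF hn] sumb])
  have eq: "(\<Sum>k. h k s) = indicator {0<..<t} s *\<^sub>R ((t - s) powr (\<nu> - 1) *\<^sub>R ml_kernel \<alpha> \<mu> a s)" for s
    using hs[of s] by (simp add: sums_iff)
  show "set_integrable lborel {0<..<t} (\<lambda>s. (t - s) powr (\<nu> - 1) *\<^sub>R ml_kernel \<alpha> \<mu> a s)"
    using I unfolding eq set_integrable_def .
  have "(LBINT s. h k s) = Gamma \<nu> * (?c k)" for k
    using h[of k] unfolding has_bochner_integral_iff ceq by blast
  moreover have "(\<lambda>k. Gamma \<nu> * (?c k))
     sums (Gamma \<nu> * ml_kernel \<alpha> (\<mu> + \<nu>) a t)"
    by (intro sums_mult ml_kernel_sums) (use assms in auto)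
  ultimately have "(LBINT s. \<Sum>k. h k s) = Gamma \<nu> * ml_kernel \<alpha> (\<mu> + \<nu>) a t"
    using S by (metis (no_types, lifting) sums_unique2 sums_cong)
  then show "frac_integral \<nu> (ml_kernel \<alpha> \<mu> a) t = ml_kernel \<alpha> (\<mu> + \<nu>) a t"
    using Gamma_real_pos[OF assms(4)] unfolding eq frac_integral_def set_lebesgue_integral_def by simp
qed

lemma frac_integral_cong:
  assumes "\<And>s. 0 < s \<Longrightarrow> s < t \<Longrightarrow> f s = g s"
  shows "frac_integral \<nu> f t = frac_integral \<nu> g t"
  unfolding frac_integral_def set_lebesgue_integral_def
  by (rule arg_cong[where f = "\<lambda>x. _ *\<^sub>R x"], rule Bochner_Integration.integral_cong)
    (auto simp: indicator_def assms)

lemma continuous_on_Icc_bounded: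
  fixes f :: "real \<Rightarrow> 'b::real_normed_vector"
  assumes "continuous_on {0..T} f"
  shows "\<exists>M. \<forall>s. 0 \<le> s \<longrightarrow> s \<le> T \<longrightarrow> norm (f s) \<le> M"
proof -
  have "bounded (f ` {0..T})"
    using assms by (intro compact_imp_bounded compact_continuous_image) auto
  then obtain M where "\<forall>x\<in>f ` {0..T}. norm x \<le> M" unfolding bounded_iff by blast
  then show ?thesis by (intro exI[of _ M]) auto
qed

lemma frac_integral_scaleR: "frac_integral \<nu> (\<lambda>s. c *\<^sub>R f s) t = c *\<^sub>R frac_integral \<nu> f t"
proof -
  have "frac_integral \<nu> (\<lambda>s. c *\<^sub>R f s) t = (1 / Gamma \<nu>) *\<^sub>R (LBINT s:{0<..<t}. c *\<^sub>R ((t - s) powr (\<nu> - 1) *\<^sub>R f s))"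
    by (simp add: frac_integral_def mult.commute)
  also have "\<dots> = c *\<^sub>R frac_integral \<nu> f t"
    unfolding set_integral_scaleR_right by (simp add: frac_integral_def mult.commute)
  finally show ?thesis .
qed

lemma frac_integral_1: "frac_integral 1 f t = (LBINT s:{0<..<t}. f s)"
  unfolding frac_integral_def set_lebesgue_integral_def
  by (auto intro!: Bochner_Integration.integral_cong simp: indicator_def)

text \<open>The semigroup law of fractional integration: Fubini on the triangle \<open>\<tau> < s < t\<close>, where the inner
  integral is a Beta integral.\<close>

lemma frac_integral_add:
  fixes v :: "real \<Rightarrow> 'b::{banach,second_countable_topology}"
  assumes ab: "0 < a" "0 < b" and t: "0 < t"
    and meas[measurable]: "(\<lambda>s. indicator {0<..<t} s *\<^sub>R v s) \<in> borel_measurable borel"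
    and bd: "\<And>s. 0 < s \<Longrightarrow> s < t \<Longrightarrow> norm (v s) \<le> M"
  shows "frac_integral a (frac_integral b v) t = frac_integral (a + b) v t"
proof -
  let ?p = "\<lambda>\<tau>. indicator {0<..<t} \<tau> * ((t - \<tau>) powr (a + b - 1) * (\<tau> - 0) powr (1 - 1))"
  let ?h = "\<lambda>\<tau> s. (t - s) powr (a - 1) * (s - \<tau>) powr (b - 1)"
  define v' where "v' s = indicator {0<..<t} s *\<^sub>R v s" for s
  have [measurable]: "v' \<in> borel_measurable borel" unfolding v'_def by simp
  define k where "k \<tau> s = indicator {\<tau><..<t} s * ?h \<tau> s" for \<tau> s
  define f where "f \<tau> s = k \<tau> s *\<^sub>R v' \<tau>" for \<tau> s
  have kb: "has_bochner_integral lborel (k \<tau>) (Beta b a * (t - \<tau>) powr (a + b - 1))" if "\<tau> < t" for \<tau>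
    using has_bochner_integral_beta[OF ab(2,1) that] by (simp add: k_def[abs_def] add.commute)
  have k0: "0 \<le> k \<tau> s" for \<tau> s by (simp add: k_def)
  have kn: "(LBINT s. k \<tau> s) = Beta b a * (t - \<tau>) powr (a + b - 1)" "integrable lborel (k \<tau>)" if "\<tau> < t" for \<tau>
    using kb[OF that] by (auto simp: has_bochner_integral_iff)
  have fi: "integrable lborel (f \<tau>)" for \<tau>
    unfolding f_def using kn(2)[of \<tau>] by (cases "\<tau> < t") (auto simp: v'_def)
  have B: "0 \<le> Beta b a" using ab by (simp add: Beta_def)
  have km[measurable]: "(\<lambda>(\<tau>, s). k \<tau> s) \<in> borel_measurable (lborel \<Otimes>\<^sub>M lborel)"
  proof -
    have "(\<lambda>(\<tau>, s). indicator {z. fst z < snd z \<and> snd z < t} (\<tau>, s) * ?h \<tau> s) \<in> borel_measurable (lborel \<Otimes>\<^sub>M lborel)"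
      by measurable
    moreover have "(\<lambda>(\<tau>, s). indicator {z. fst z < snd z \<and> snd z < t} (\<tau>, s) * ?h \<tau> s) = (\<lambda>(\<tau>, s). k \<tau> s)"
      by (auto simp: k_def indicator_def fun_eq_iff)
    ultimately show ?thesis by simp
  qed
  have int: "integrable (lborel \<Otimes>\<^sub>M lborel) (\<lambda>(\<tau>, s). f \<tau> s)"
  proof (rule lborel_pair.Fubini_integrable)
    show "(\<lambda>(\<tau>, s). f \<tau> s) \<in> borel_measurable (lborel \<Otimes>\<^sub>M lborel)"
      using km unfolding f_def by measurable
    have "(LBINT s. norm (f \<tau> s)) = indicator {0<..<t} \<tau> * (Beta b a * ((t - \<tau>) powr (a + b - 1) * norm (v \<tau>)))" for \<tau>
    proof (cases "\<tau> \<in> {0<..<t}")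
      case True
      then have "(LBINT s. norm (f \<tau> s)) = (LBINT s. k \<tau> s * norm (v \<tau>))"
        using k0 by (simp add: f_def v'_def)
      then show ?thesis using True kn(1)[of \<tau>] by simp
    qed (simp add: f_def v'_def)
    note eq = this
    show "integrable lborel (\<lambda>\<tau>. LBINT s. norm ((\<lambda>(\<tau>, s). f \<tau> s) (\<tau>, s)))"
      unfolding prod.case
    proof (rule Bochner_Integration.integrable_bound)
      have "integrable lborel (\<lambda>\<tau>. ?p \<tau>)"
        using has_bochner_integral_beta[of 1 "a + b" 0 t] ab t by (simp add: has_bochner_integral_iff)
      then show "integrable lborel (\<lambda>\<tau>. Beta b a * M * (?p \<tau>))"
        by simp
      have "(\<lambda>(\<tau>, s). f \<tau> s) \<in> borel_measurable (lborel \<Otimes>\<^sub>M lborel)"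
        using km unfolding f_def by measurable
      then show "(\<lambda>\<tau>. LBINT s. norm (f \<tau> s)) \<in> borel_measurable lborel"
        by measurable
      show "AE \<tau> in lborel. norm (LBINT s. norm (f \<tau> s)) \<le>
        norm (Beta b a * M * (?p \<tau>))"
      proof (rule AE_I2)
        fix \<tau>
        show "norm (LBINT s. norm (f \<tau> s)) \<le>
          norm (Beta b a * M * (?p \<tau>))"
        proof (cases "\<tau> \<in> {0<..<t}")
          case True
          then have m: "norm (v \<tau>) \<le> M" using bd by auto
          then have M: "0 \<le> M" using norm_ge_zero order_trans by blast
          have "Beta b a * ((t - \<tau>) powr (a + b - 1) * norm (v \<tau>)) \<le> Beta b a * ((t - \<tau>) powr (a + b - 1) * M)"
            using m B by (intro mult_left_mono) auto
          then show ?thesis unfolding eq using True B M by (simp add: abs_mult mult_ac)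
        qed (simp add: eq)
      qed
    qed
    show "AE x in lborel. integrable lborel (\<lambda>y. (\<lambda>(\<tau>, s). f \<tau> s) (x, y))" using fi by simp
  qed
  have "frac_integral a (frac_integral b v) t =
      (1 / (Gamma a * Gamma b)) *\<^sub>R (LBINT s. LBINT \<tau>. f \<tau> s)"
  proof -
    have "indicator {0<..<t} s *\<^sub>R (t - s) powr (a - 1) *\<^sub>R frac_integral b v s = (1 / Gamma b) *\<^sub>R (LBINT \<tau>. f \<tau> s)" for s
    proof (cases "s \<in> {0<..<t}")
      case True
      have "f \<tau> s = (t - s) powr (a - 1) *\<^sub>R (indicator {0<..<s} \<tau> *\<^sub>R ((s - \<tau>) powr (b - 1) *\<^sub>R v \<tau>))" for \<tau>
        using True by (auto simp: f_def k_def v'_def indicator_def)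
      then have "(LBINT \<tau>. f \<tau> s) = (t - s) powr (a - 1) *\<^sub>R (LBINT \<tau>. indicator {0<..<s} \<tau> *\<^sub>R ((s - \<tau>) powr (b - 1) *\<^sub>R v \<tau>))"
        by (simp only: integral_scaleR_right)
      then show ?thesis using True by (simp add: frac_integral_def set_lebesgue_integral_def mult.commute)
    next
      case False
      then have "f \<tau> s = 0" for \<tau> by (auto simp: f_def k_def v'_def indicator_def)
      then show ?thesis using False by simp
    qed
    then show ?thesis by (simp add: frac_integral_def[of a] set_lebesgue_integral_def)
  qed
  also have "(LBINT s. LBINT \<tau>. f \<tau> s) = (LBINT \<tau>. LBINT s. f \<tau> s)"
    by (rule lborel_pair.Fubini_integral) (use int in simp)
  also have "(1 / (Gamma a * Gamma b)) *\<^sub>R \<dots> = frac_integral (a + b) v t"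
  proof -
    have "(LBINT s. f \<tau> s) = (Beta b a) *\<^sub>R (indicator {0<..<t} \<tau> *\<^sub>R ((t - \<tau>) powr (a + b - 1) *\<^sub>R v \<tau>))" for \<tau>
    proof (cases "\<tau> \<in> {0<..<t}")
      case True
      then show ?thesis using kn[of \<tau>] by (simp add: f_def v'_def)
    qed (simp add: f_def v'_def)
    moreover have "Beta b a / (Gamma a * Gamma b) = 1 / Gamma (a + b)"
      using Gamma_real_pos[OF ab(1)] Gamma_real_pos[OF ab(2)] by (simp add: Beta_def add.commute)
    ultimately show ?thesis
      by (simp only: integral_scaleR_right frac_integral_def set_lebesgue_integral_def)
        (simp add: add.commute)
  qed
  finally show ?thesis .
qed

lemma norm_frac_integral_le:
  fixes v :: "real \<Rightarrow> 'b::{banach,second_countable_topology}"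
  assumes "0 < \<nu>" "0 < \<mu>" "0 < t" "0 \<le> M"
    and bd: "\<And>s. 0 < s \<Longrightarrow> s < t \<Longrightarrow> norm (v s) \<le> M * s powr (\<mu> - 1) / Gamma \<mu>"
  shows "norm (frac_integral \<nu> v t) \<le> M * t powr (\<mu> + \<nu> - 1) / Gamma (\<mu> + \<nu>)"
proof -
  let ?g = "\<lambda>s. indicator {0<..<t} s * ((t - s) powr (\<nu> - 1) * (s - 0) powr (\<mu> - 1))"
  have hb: "has_bochner_integral lborel ?g (Beta \<mu> \<nu> * (t - 0) powr (\<mu> + \<nu> - 1))"
    by (rule has_bochner_integral_beta) fact+
  have G: "0 < Gamma \<mu>" "0 < Gamma \<nu>" using assms by auto
  have "norm (LBINT s:{0<..<t}. ((t - s) powr (\<nu> - 1)) *\<^sub>R v s)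
     \<le> (LBINT s. norm (indicator {0<..<t} s *\<^sub>R ((t - s) powr (\<nu> - 1)) *\<^sub>R v s))"
    unfolding set_lebesgue_integral_def by (rule integral_norm_bound)
  also have "\<dots> \<le> (LBINT s. M / Gamma \<mu> * ?g s)"
  proof (rule integral_mono')
    show "integrable lborel (\<lambda>s. M / Gamma \<mu> * ?g s)"
      using hb by (intro Bochner_Integration.integrable_mult_right) (auto simp: has_bochner_integral_iff)
    fix s
    show "0 \<le> M / Gamma \<mu> * ?g s" using G assms by simp
    show "norm (indicator {0<..<t} s *\<^sub>R ((t - s) powr (\<nu> - 1)) *\<^sub>R v s) \<le> M / Gamma \<mu> * ?g s"
    proof (cases "s \<in> {0<..<t}")
      case True
      then have "(t - s) powr (\<nu> - 1) * norm (v s) \<le> (t - s) powr (\<nu> - 1) * (M * s powr (\<mu> - 1) / Gamma \<mu>)"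
        using bd by (intro mult_left_mono) auto
      then show ?thesis using True by (simp add: mult_ac)
    qed simp
  qed
  also have "\<dots> = M / Gamma \<mu> * (Beta \<mu> \<nu> * t powr (\<mu> + \<nu> - 1))"
    using hb by (simp add: has_bochner_integral_iff)
  finally have "norm (LBINT s:{0<..<t}. ((t - s) powr (\<nu> - 1)) *\<^sub>R v s) \<le> M / Gamma \<mu> * (Beta \<mu> \<nu> * t powr (\<mu> + \<nu> - 1))" .
  then have "norm (frac_integral \<nu> v t) \<le> (1 / Gamma \<nu>) * (M / Gamma \<mu> * (Beta \<mu> \<nu> * t powr (\<mu> + \<nu> - 1)))"
    unfolding frac_integral_def norm_scaleR using G by (intro mult_mono) auto
  also have "\<dots> = M * t powr (\<mu> + \<nu> - 1) / Gamma (\<mu> + \<nu>)"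
    using G by (simp add: Beta_def field_simps)
  finally show ?thesis .
qed

lemma set_integrable_frac_kernel:
  fixes f :: "real \<Rightarrow> 'b::{banach,second_countable_topology}"
  assumes "0 < \<nu>" "0 < \<mu>" "0 < t" and cont: "continuous_on {0<..<t} f"
    and bd: "\<And>s. 0 < s \<Longrightarrow> s < t \<Longrightarrow> norm (f s) \<le> M * s powr (\<mu> - 1)"
  shows "set_integrable lborel {0<..<t} (\<lambda>s. (t - s) powr (\<nu> - 1) *\<^sub>R f s)"
  unfolding set_integrable_def
proof (rule Bochner_Integration.integrable_bound)
  let ?k = "\<lambda>s. indicator {0<..<t} s * ((t - s) powr (\<nu> - 1) * (s - 0) powr (\<mu> - 1))"
  show "integrable lborel (\<lambda>s. M * ?k s)"
    using has_bochner_integral_beta[OF assms(2,1,3)] by (simp add: has_bochner_integral_iff)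
  have [measurable]: "(\<lambda>s. indicator {0<..<t} s *\<^sub>R f s) \<in> borel_measurable borel"
    by (rule borel_measurable_continuous_on_indicator) (auto intro: cont)
  have "(\<lambda>s. (t - s) powr (\<nu> - 1) *\<^sub>R (indicator {0<..<t} s *\<^sub>R f s)) \<in> borel_measurable lborel"
    by measurable
  then show "(\<lambda>s. indicator {0<..<t} s *\<^sub>R (t - s) powr (\<nu> - 1) *\<^sub>R f s) \<in> borel_measurable lborel"
    by (simp add: mult.commute)
  show "AE s in lborel. norm (indicator {0<..<t} s *\<^sub>R (t - s) powr (\<nu> - 1) *\<^sub>R f s) \<le> norm (M * ?k s)"
  proof (rule AE_I2)
    fix s
    show "norm (indicator {0<..<t} s *\<^sub>R (t - s) powr (\<nu> - 1) *\<^sub>R f s) \<le> norm (M * ?k s)"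
    proof (cases "s \<in> {0<..<t}")
      case True
      then have "norm (f s) \<le> \<bar>M * s powr (\<mu> - 1)\<bar>" using bd[of s] by simp
      then have "(t - s) powr (\<nu> - 1) * norm (f s) \<le> (t - s) powr (\<nu> - 1) * \<bar>M * s powr (\<mu> - 1)\<bar>"
        by (rule mult_left_mono) simp
      then show ?thesis using True by (simp add: abs_mult mult_ac)
    qed simp
  qed
qed

text \<open>Iterating the equation \<open>n\<close> times bounds \<open>D\<close> by a multiple of the \<open>n\<close>-th term of a convergent
  Mittag-Leffler series, and these terms tend to 0.\<close>

lemma volterra_unique:
  fixes D :: "real \<Rightarrow> 'b::{banach,second_countable_topology}"
  assumes \<alpha>: "0 < \<alpha>" "\<alpha> \<le> 1"
    and cont: "continuous_on {0..T} D"
    and eq: "\<And>t. 0 < t \<Longrightarrow> t \<le> T \<Longrightarrow> D t = (- a) *\<^sub>R frac_integral \<alpha> D t"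
    and t: "0 < t" "t \<le> T"
  shows "D t = 0"
proof -
  obtain M where M: "\<And>s. 0 \<le> s \<Longrightarrow> s \<le> T \<Longrightarrow> norm (D s) \<le> M"
    using continuous_on_Icc_bounded[OF cont] by blast
  have M0: "0 \<le> M" using M[of t] t norm_ge_zero order_trans by (metis less_imp_le)
  have b: "norm (D s) \<le> M * \<bar>a\<bar> ^ n * s powr (\<alpha> * real n + 1 - 1) / Gamma (\<alpha> * real n + 1)"
    if "0 < s" "s \<le> T" for s n
    using that
  proof (induction n arbitrary: s)
    case 0
    then show ?case using M[of s] by simp
  next
    case (Suc n)
    have "norm (D s) = \<bar>a\<bar> * norm (frac_integral \<alpha> D s)"
      by (subst eq[OF Suc.prems]) simp
    also have "\<dots> \<le> \<bar>a\<bar> * (M * \<bar>a\<bar> ^ n * s powr (\<alpha> * real n + 1 + \<alpha> - 1) / Gamma (\<alpha> * real n + 1 + \<alpha>))"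
    proof (intro mult_left_mono norm_frac_integral_le)
      show "0 < \<alpha> * real n + 1" using \<alpha> by (simp add: add_nonneg_pos)
    qed (use \<alpha> Suc M0 in auto)
    also have "\<alpha> * real n + 1 + \<alpha> = \<alpha> * real (Suc n) + 1" by (simp add: algebra_simps)
    finally show ?case by (simp add: mult_ac)
  qed
  have "(\<lambda>n. M * (\<bar>a\<bar> ^ n * t powr (\<alpha> * real n + 1 - 1) / Gamma (\<alpha> * real n + 1))) \<longlonglongrightarrow> M * 0"
    by (intro tendsto_intros summable_LIMSEQ_zero ml_kernel_sums(2)) (use \<alpha> t in auto)
  then have "norm (D t) \<le> M * 0"
    by (rule LIMSEQ_le_const) (use b[OF t] in \<open>auto simp: mult.assoc\<close>)
  then show ?thesis by simp
qed

lemma continuous_on_ml_kernel: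
  assumes "0 < \<alpha>" "\<alpha> \<le> 1" "1 < \<mu>"
  shows "continuous_on {0..} (ml_kernel \<alpha> \<mu> a)"
proof -
  have "continuous_on UNIV (mittag_leffler \<alpha> \<mu>)"
    using assms by (intro continuous_at_imp_continuous_on ballI isCont_mittag_leffler) auto
  then have "continuous_on {0..} (\<lambda>t. mittag_leffler \<alpha> \<mu> (- a * t powr \<alpha>))"
    by (rule continuous_on_compose2) (use assms in \<open>auto intro!: continuous_intros continuous_on_powr'\<close>)
  then show ?thesis unfolding ml_kernel_def[abs_def]
    using assms by (intro continuous_on_mult continuous_on_powr') (auto intro!: continuous_intros)
qed

text \<open>Integrated once, the equation reads \<open>I\<^sup>1\<^sup>-\<^sup>\<alpha> (w - 1) = - a W\<close>, where \<open>W\<close> is the primitive of \<open>w\<close>.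
  Applying \<open>I\<^sup>\<alpha>\<close> gives the Volterra equation \<open>W t - t = - a I\<^sup>\<alpha> W t\<close>, which is also satisfied by
  \<open>E = ml_kernel \<alpha> 2 a\<close>, the primitive of the claimed solution. The equation is used for the primitives
  because their continuity up to 0 is at hand and differentiation recovers \<open>w\<close> at the end.\<close>

lemma caputo_relaxation_unique:
  fixes w :: "real \<Rightarrow> complex"
  assumes \<alpha>: "0 < \<alpha>" "\<alpha> < 1" and cont: "continuous_on {0..} w" and w0: "w 0 = 1"
    and cap: "\<And>t. 0 < t \<Longrightarrow> has_caputo_derivative \<alpha> w (- (a *\<^sub>R w t)) t"
    and t: "0 < t"
  shows "w t = of_real (ml_kernel \<alpha> 1 a t)"
proof -
  define v where "v s = w s - 1" for s
  define W where "W s = integral {0..s} w" for s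
  define J where "J = frac_integral (1 - \<alpha>) v"
  have contv: "continuous_on {0..} v" unfolding v_def using cont by (intro continuous_intros)
  have cont': "continuous_on {0..T} w" "continuous_on {0..T} v" for T
    using cont contv by (auto elim: continuous_on_subset)
  have W_li: "W s = (LBINT r:{0<..<s}. w r)" "set_integrable lborel {0<..<s} w" for s
  proof -
    have i: "set_integrable lborel {0..s} w" by (rule borel_integrable_atLeastAtMost') (rule cont')
    then show "set_integrable lborel {0<..<s} w" by (rule set_integrable_subset) auto
    have "W s = (LBINT r:{0..s}. w r)"
      unfolding W_def using set_borel_integral_eq_integral(2)[OF i] by simp
    also have "\<dots> = (LBINT r:{0<..<s}. w r)"
      unfolding set_lebesgue_integral_def
      by (rule integral_discrete_difference[where X = "{0, s}"]) (auto simp: indicator_def)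
    finally show "W s = (LBINT r:{0<..<s}. w r)" .
  qed
  have dW: "(W has_vector_derivative w s) (at s within {0..T})" if "s \<in> {0..T}" for s T
    unfolding W_def by (rule integral_has_vector_derivative) (use cont' that in auto)
  have dW': "(W has_vector_derivative w s) (at s)" if "0 < s" for s
    using dW[of s "s + 1"] that at_within_Icc_at[of 0 s "s + 1"] by simp
  have contW: "continuous_on {0..T} W" for T
    unfolding W_def using cont' by (intro indefinite_integral_continuous_1 integrable_continuous_interval)
  have dJ: "(J has_vector_derivative (- (a *\<^sub>R w s))) (at s)" if "0 < s" for s
    using cap[OF that] unfolding has_caputo_derivative_def J_def v_def w0 .
  have dJW: "((\<lambda>s. J s + a *\<^sub>R W s) has_vector_derivative 0) (at s within {0<..})" if "s \<in> {0<..}" for s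
  proof -
    have "((\<lambda>s. J s + a *\<^sub>R W s) has_vector_derivative (- (a *\<^sub>R w s) + a *\<^sub>R w s)) (at s)"
      using dJ[of s] dW'[of s] that by (auto intro!: derivative_eq_intros)
    then show ?thesis by (simp add: has_vector_derivative_at_within)
  qed
  obtain c where c: "\<And>s. s \<in> {0<..} \<Longrightarrow> J s + a *\<^sub>R W s = c"
    using has_vector_derivative_zero_constant[OF convex_real_interval(3) dJW] by blast
  obtain M where M: "\<And>s. 0 \<le> s \<Longrightarrow> s \<le> 1 \<Longrightarrow> norm (v s) \<le> M"
    using continuous_on_Icc_bounded[OF cont'(2)] by blast
  have M0: "0 \<le> M" using M[of 0] norm_ge_zero order_trans by (metis zero_le_one order_refl)
  have Jb: "norm (J s) \<le> M * s powr (1 - \<alpha>) / Gamma (2 - \<alpha>)" if "0 < s" "s < 1" for s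
    unfolding J_def using norm_frac_integral_le[of "1 - \<alpha>" 1 s M v] \<alpha> that M M0 by simp
  have J0: "(J \<longlongrightarrow> 0) (at_right 0)"
  proof (rule Lim_null_comparison)
    show "eventually (\<lambda>s. norm (J s) \<le> M * s powr (1 - \<alpha>) / Gamma (2 - \<alpha>)) (at_right 0)"
      unfolding eventually_at_right_field using Jb by (intro exI[of _ 1]) auto
    show "((\<lambda>s. M * s powr (1 - \<alpha>) / Gamma (2 - \<alpha>)) \<longlongrightarrow> 0) (at_right 0)"
    proof -
      have "((\<lambda>s. s powr (1 - \<alpha>)) \<longlongrightarrow> 0) (at_right 0)"
        by (rule tendsto_zero_powrI[where b = "1 - \<alpha>"]) (use \<alpha> in \<open>auto intro!: eventually_at_rightI[of 0 1]\<close>)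
      from tendsto_mult_right_zero[OF this, of "M / Gamma (2 - \<alpha>)"] show ?thesis by simp
    qed
  qed
  have W0: "(W \<longlongrightarrow> 0) (at_right 0)"
  proof -
    have "(W \<longlongrightarrow> W 0) (at 0 within {0..1})"
      using contW[of 1] by (auto simp: continuous_on_def)
    then have "(W \<longlongrightarrow> W 0) (at_right 0)"
      by (simp add: at_within_Icc_at_right)
    then show ?thesis by (simp add: W_def)
  qed
  have "((\<lambda>s. J s + a *\<^sub>R W s) \<longlongrightarrow> 0 + a *\<^sub>R 0) (at_right 0)"
    by (intro tendsto_intros J0 W0)
  moreover have "((\<lambda>s. J s + a *\<^sub>R W s) \<longlongrightarrow> c) (at_right 0)"
    by (rule tendsto_eventually) (auto simp: c intro: eventually_mono[OF eventually_at_right_less])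
  ultimately have "c = 0" using tendsto_unique[OF trivial_limit_at_right_real] by fastforce
  then have JW: "J s = (- a) *\<^sub>R W s" if "0 < s" for s
    using c[of s] that by (simp add: eq_neg_iff_add_eq_0)
  have Weq: "W s - of_real s = (- a) *\<^sub>R frac_integral \<alpha> W s" if s: "0 < s" for s
  proof -
    obtain M where M: "\<And>r. 0 \<le> r \<Longrightarrow> r \<le> s \<Longrightarrow> norm (v r) \<le> M"
    using continuous_on_Icc_bounded[OF cont'(2)] by blast
    have m: "(\<lambda>r. indicator {0<..<s} r *\<^sub>R v r) \<in> borel_measurable borel"
      by (rule borel_measurable_continuous_on_indicator) (auto intro: continuous_on_subset[OF contv])
    have "frac_integral \<alpha> J s = frac_integral (\<alpha> + (1 - \<alpha>)) v s"
      unfolding J_def by (rule frac_integral_add[OF _ _ s m, of _ _ M]) (use \<alpha> M in auto)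
    also have "\<dots> = (LBINT r:{0<..<s}. v r)" by (simp add: frac_integral_1)
    also have "\<dots> = W s - (LBINT r:{0<..<s}. 1)"
      unfolding v_def W_li(1) by (rule set_integral_diff(2)[OF W_li(2)])
        (use s in \<open>auto simp: set_integrable_def intro!: integrable_scaleR_left integrable_real_indicator\<close>)
    also have "(LBINT r:{0<..<s}. (1::complex)) = of_real s"
      using s by (simp add: set_lebesgue_integral_def scaleR_conv_of_real)
    finally have "W s - of_real s = frac_integral \<alpha> J s" by simp
    also have "\<dots> = frac_integral \<alpha> (\<lambda>r. (- a) *\<^sub>R W r) s"
      by (rule frac_integral_cong) (use JW in auto)
    finally show ?thesis by (simp only: frac_integral_scaleR)
  qed
  define E where "E s = complex_of_real (ml_kernel \<alpha> 2 a s)" for s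
  have contE: "continuous_on {0..T} E" for T
    unfolding E_def using continuous_on_ml_kernel[of \<alpha> 2 a] \<alpha>
    by (intro continuous_intros) (auto elim: continuous_on_subset)
  have Eeq: "E s - of_real s = (- a) *\<^sub>R frac_integral \<alpha> E s" if s: "0 < s" for s
  proof -
    have "frac_integral \<alpha> E s = of_real (frac_integral \<alpha> (ml_kernel \<alpha> 2 a) s)"
      unfolding frac_integral_def E_def set_lebesgue_integral_def
      by (simp add: scaleR_conv_of_real flip: integral_complex_of_real)
    also have "\<dots> = of_real (ml_kernel \<alpha> (2 + \<alpha>) a s)"
      using frac_integral_ml_kernel(2)[of \<alpha> 2 \<alpha> s a] \<alpha> s by simp
    finally have "frac_integral \<alpha> E s = of_real (ml_kernel \<alpha> (2 + \<alpha>) a s)" .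
    moreover have "Gamma 2 = (1::real)" using Gamma_fact[of 1, where 'a=real] by (simp add: numeral_2_eq_2)
    ultimately show ?thesis
      unfolding E_def using ml_kernel_rec[of \<alpha> 2 s a] \<alpha> s by (simp add: scaleR_conv_of_real)
  qed
  have WE: "W s = E s" if s: "0 < s" for s
  proof -
    have diff: "frac_integral \<alpha> (\<lambda>r. W r - E r) r = frac_integral \<alpha> W r - frac_integral \<alpha> E r" if "0 < r" for r
    proof -
      have si: "set_integrable lborel {0<..<r} (\<lambda>s. (r - s) powr (\<alpha> - 1) *\<^sub>R f s)"
        if f: "continuous_on {0..r} f" for f :: "real \<Rightarrow> complex"
      proof -
        obtain M where M: "\<forall>s. 0 \<le> s \<longrightarrow> s \<le> r \<longrightarrow> norm (f s) \<le> M"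
          using continuous_on_Icc_bounded[OF f] by blast
        show ?thesis
          by (rule set_integrable_frac_kernel[of _ 1 _ _ M])
            (use \<alpha> \<open>0 < r\<close> M in \<open>auto intro: continuous_on_subset[OF f]\<close>)
      qed
      show ?thesis
        unfolding frac_integral_def scaleR_diff_right
        by (subst set_integral_diff(2)[OF si[OF contW] si[OF contE]]) (simp add: scaleR_diff_right)
    qed
    have "W s - E s = 0"
    proof (rule volterra_unique[of \<alpha> s "\<lambda>r. W r - E r" a s])
      show "continuous_on {0..s} (\<lambda>r. W r - E r)" by (intro continuous_intros contW contE)
      fix r :: real assume r: "0 < r"
      show "W r - E r = (- a) *\<^sub>R frac_integral \<alpha> (\<lambda>r. W r - E r) r"
        unfolding diff[OF r] scaleR_diff_right Weq[OF r, symmetric] Eeq[OF r, symmetric] by simp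
    qed (use \<alpha> s in auto)
    then show ?thesis by simp
  qed
  \<comment> \<open>\<open>ml_kernel \<alpha> 1 a\<close> has the wrong value 0 at \<open>s = 0\<close>, because \<open>0 powr 0 = 0\<close>; \<open>e\<close> is its
    continuous version.\<close>
  define e where "e s = mittag_leffler \<alpha> 1 (- a * s powr \<alpha>)" for s
  have "continuous_on UNIV (mittag_leffler \<alpha> 1)"
    using \<alpha> by (intro continuous_at_imp_continuous_on ballI isCont_mittag_leffler) auto
  then have conte: "continuous_on {0..} e" unfolding e_def
    by (rule continuous_on_compose2) (use \<alpha> in \<open>auto intro!: continuous_intros continuous_on_powr'\<close>)
  have e_ml: "e s = ml_kernel \<alpha> 1 a s" if "0 < s" for s using that by (simp add: e_def ml_kernel_def)
  have Eint: "ml_kernel \<alpha> 2 a s = integral {0..s} e" if s: "0 < s" for s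
  proof -
    have "ml_kernel \<alpha> 2 a s = frac_integral 1 (ml_kernel \<alpha> 1 a) s"
      using frac_integral_ml_kernel(2)[of \<alpha> 1 1 s a] \<alpha> s by simp
    also have "\<dots> = frac_integral 1 e s"
      by (rule frac_integral_cong) (use e_ml in auto)
    also have "\<dots> = (LBINT r:{0<..<s}. e r)" by (rule frac_integral_1)
    also have "\<dots> = (LBINT r:{0..s}. e r)"
      unfolding set_lebesgue_integral_def
      by (rule integral_discrete_difference[where X = "{0, s}"]) (auto simp: indicator_def)
    also have "\<dots> = integral {0..s} e"
      by (intro set_borel_integral_eq_integral borel_integrable_atLeastAtMost')
        (auto intro: continuous_on_subset[OF conte])
    finally show ?thesis .
  qed
  have "((\<lambda>s. integral {0..s} e) has_vector_derivative e t) (at t within {0..t+1})"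
    by (rule integral_has_vector_derivative) (use t in \<open>auto intro: continuous_on_subset[OF conte]\<close>)
  then have "((\<lambda>s. integral {0..s} e) has_vector_derivative e t) (at t)"
    using t at_within_Icc_at[of 0 t "t + 1"] by simp
  then have "((\<lambda>s. complex_of_real (integral {0..s} e)) has_vector_derivative of_real (e t)) (at t)"
    by (rule bounded_linear.has_vector_derivative[OF bounded_linear_of_real])
  then have "(W has_vector_derivative of_real (e t)) (at t)"
    by (rule has_vector_derivative_transform_within_open[of _ _ _ "{0<..}"])
      (use t WE Eint in \<open>auto simp: E_def\<close>)
  then have "w t = of_real (e t)" using dW'[OF t] vector_derivative_unique_at by blast
  then show ?thesis using e_ml[OF t] by simp
qed

section \<open>One-sided stable laws\<close>

text \<open>Every derivative of \<open>F w = exp (- c (1 - w)\<^sup>\<gamma>)\<close> is a combination of the functions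
  \<open>(1 - w)\<^sup>-\<^sup>a F w\<close>, \<open>a \<ge> 0\<close>, with nonnegative coefficients: differentiating produces the factors
  \<open>a (1 - w)\<^sup>-\<^sup>1\<close> and \<open>c \<gamma> (1 - w)\<^sup>\<gamma>\<^sup>-\<^sup>1\<close>, and \<open>\<gamma> \<le> 1\<close>. So the Taylor coefficients at 0 are nonnegative, and
  the expansion extends to \<open>q = 1\<close> by monotonicity. These are the weights of the discrete stable law.\<close>

lemma stable_pgf_coeffs:
  fixes \<gamma> c :: real
  assumes \<gamma>: "0 < \<gamma>" "\<gamma> \<le> 1" and c: "0 \<le> c"
  shows "\<exists>a::nat\<Rightarrow>real. (\<forall>k. 0 \<le> a k) \<and>
           (\<forall>q. 0 \<le> q \<and> q \<le> 1 \<longrightarrow> (\<lambda>k. a k * q ^ k) sums exp (- c * (1 - q) powr \<gamma>))"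
proof -
  define S where "S = {w::complex. Re w < 1}"
  define F where "F w = exp (- of_real c * (1 - w) powr of_real \<gamma>)" for w :: complex
  define G where "G xs w = (\<Sum>(b, a)\<leftarrow>xs. of_real b * (1 - w) powr (- of_real a))"
    for xs :: "(real \<times> real) list" and w :: complex
  have opS: "open S" unfolding S_def by (rule open_halfspace_Re_lt)
  have nn: "1 - w \<notin> \<real>\<^sub>\<le>\<^sub>0" if "w \<in> S" for w
    using that by (auto simp: S_def complex_nonpos_Reals_iff)
  have dF: "(F has_field_derivative (of_real (c * \<gamma>) * (1 - w) powr (of_real \<gamma> - 1)) * F w) (at w)"
    if "w \<in> S" for w
    unfolding F_def using nn[OF that]
    by (auto intro!: derivative_eq_intros simp: algebra_simps)
  have dG: "(G xs has_field_derivative G (map (\<lambda>(b, a). (b * a, a + 1)) xs) w) (at w)"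
    if "w \<in> S" for w xs
  proof (induction xs)
    case Nil
    then show ?case by (simp add: G_def)
  next
    case (Cons x xs)
    obtain b a where x: "x = (b, a)" by force
    have "- complex_of_real a - 1 = - of_real (a + 1)" by simp
    then have "((\<lambda>w. of_real b * (1 - w) powr (- of_real a)) has_field_derivative
            of_real (b * a) * (1 - w) powr (- of_real (a + 1))) (at w)"
      using nn[OF that] by (auto intro!: derivative_eq_intros)
    from DERIV_add[OF this Cons] show ?case
      by (simp add: G_def x)
  qed
  have Gapp: "G (xs @ ys) w = G xs w + G ys w" for xs ys w
    by (simp add: G_def)
  have Gshift: "G xs w * (of_real (c * \<gamma>) * (1 - w) powr (of_real \<gamma> - 1)) =
      G (map (\<lambda>(b, a). (b * (c * \<gamma>), a + 1 - \<gamma>)) xs) w" if "w \<in> S" for xs w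
  proof (induction xs)
    case Nil
    then show ?case by (simp add: G_def)
  next
    case (Cons x xs)
    obtain b a where x: "x = (b, a)" by force
    have "1 - w \<noteq> 0" using that by (auto simp: S_def)
    then have "(1 - w) powr (- of_real (a + 1 - \<gamma>)) =
        (1 - w) powr (- of_real a) * (1 - w) powr (of_real \<gamma> - 1)"
      by (subst powr_add[symmetric]) (simp_all add: algebra_simps)
    then show ?case using Cons by (simp add: G_def x algebra_simps)
  qed
  have D: "\<exists>xs. (\<forall>(b, a)\<in>set xs. 0 \<le> b \<and> 0 \<le> a) \<and> (\<forall>w\<in>S. (deriv ^^ k) F w = G xs w * F w)" for k
  proof (induction k)
    case 0
    show ?case
      by (rule exI[of _ "[(1, 0)]"]) (auto simp: G_def S_def)
  next
    case (Suc k)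
    then obtain xs where xs: "\<forall>(b, a)\<in>set xs. 0 \<le> b \<and> 0 \<le> a"
      and eq: "\<And>w. w \<in> S \<Longrightarrow> (deriv ^^ k) F w = G xs w * F w" by blast
    define ys where "ys = map (\<lambda>(b, a). (b * a, a + 1)) xs @
      map (\<lambda>(b, a). (b * (c * \<gamma>), a + 1 - \<gamma>)) xs"
    have "(deriv ^^ Suc k) F w = G ys w * F w" if w: "w \<in> S" for w
    proof -
      have "((\<lambda>w. G xs w * F w) has_field_derivative
         G (map (\<lambda>(b, a). (b * a, a + 1)) xs) w * F w +
         (of_real (c * \<gamma>) * (1 - w) powr (of_real \<gamma> - 1)) * F w * G xs w) (at w)"
        by (rule DERIV_mult[OF dG[OF w] dF[OF w]])
      then have "((deriv ^^ k) F has_field_derivative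
         G (map (\<lambda>(b, a). (b * a, a + 1)) xs) w * F w +
         (of_real (c * \<gamma>) * (1 - w) powr (of_real \<gamma> - 1)) * F w * G xs w) (at w)"
        by (rule has_field_derivative_transform_within_open[OF _ opS w]) (simp add: eq)
      then have "(deriv ^^ Suc k) F w = G (map (\<lambda>(b, a). (b * a, a + 1)) xs) w * F w +
         (G xs w * (of_real (c * \<gamma>) * (1 - w) powr (of_real \<gamma> - 1))) * F w"
        by (simp add: DERIV_imp_deriv algebra_simps)
      then show ?thesis
        unfolding Gshift[OF w] ys_def Gapp by (simp add: algebra_simps)
    qed
    moreover have "\<forall>(b, a)\<in>set ys. 0 \<le> b \<and> 0 \<le> a"
      using xs \<gamma> c unfolding ys_def by (fastforce intro!: mult_nonneg_nonneg)
    ultimately show ?case by blast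
  qed
  have "\<exists>a\<ge>0. (deriv ^^ k) F 0 / fact k = of_real a" for k
  proof -
    from D[of k] obtain xs where xs: "\<forall>(b, a)\<in>set xs. 0 \<le> b \<and> 0 \<le> a"
      and eq: "\<And>w. w \<in> S \<Longrightarrow> (deriv ^^ k) F w = G xs w * F w" by blast
    have "G xs 0 = of_real (\<Sum>(b, a)\<leftarrow>xs. b)"
      by (induction xs) (auto simp: G_def split: prod.splits)
    moreover have "0 \<le> (\<Sum>(b, a)\<leftarrow>xs. b)"
      using xs by (intro sum_list_nonneg) auto
    moreover have "F 0 = of_real (exp (- c))"
      by (simp add: F_def flip: exp_of_real)
    moreover have "0 \<in> S" by (simp add: S_def)
    ultimately have "(deriv ^^ k) F 0 / fact k = of_real ((\<Sum>(b, a)\<leftarrow>xs. b) * exp (- c) / fact k)"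
      "0 \<le> (\<Sum>(b, a)\<leftarrow>xs. b) * exp (- c) / fact k"
      by (auto simp: eq)
    then show ?thesis by blast
  qed
  then obtain a where a0: "\<And>k. 0 \<le> a k"
    and a: "\<And>k. (deriv ^^ k) F 0 / fact k = of_real (a k)" by metis
  have hol: "F holomorphic_on ball 0 1"
  proof -
    have "w \<in> S" if "w \<in> ball 0 1" for w
      using that complex_Re_le_cmod[of w] by (auto simp: S_def)
    then show ?thesis
      unfolding holomorphic_on_open[OF open_ball] using dF by blast
  qed
  have sm: "(\<lambda>k. a k * q ^ k) sums exp (- c * (1 - q) powr \<gamma>)" if q: "0 \<le> q" "q < 1" for q :: real
  proof -
    have "(\<lambda>k. (deriv ^^ k) F 0 / fact k * (of_real q - 0) ^ k) sums F (of_real q)"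
      by (rule holomorphic_power_series[OF hol]) (use q in auto)
    moreover have "F (of_real q) = of_real (exp (- c * (1 - q) powr \<gamma>))"
    proof -
      have "(1 - complex_of_real q) powr of_real \<gamma> = of_real ((1 - q) powr \<gamma>)"
        using powr_of_real[of "1 - q" \<gamma>] q by simp
      then show ?thesis unfolding F_def by (simp flip: exp_of_real)
    qed
    ultimately have "(\<lambda>k. complex_of_real (a k * q ^ k)) sums of_real (exp (- c * (1 - q) powr \<gamma>))"
      by (simp add: a)
    then show ?thesis by (simp only: sums_of_real_iff)
  qed
  have lim: "((\<lambda>q. exp (- c * (1 - q) powr \<gamma>)) \<longlongrightarrow> 1) (at_left (1::real))"
  proof -
    have "((\<lambda>q::real. 1 - q) \<longlongrightarrow> 1 - 1) (at_left 1)" by (intro tendsto_intros)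
    then have "((\<lambda>q::real. (1 - q) powr \<gamma>) \<longlongrightarrow> (1 - 1) powr \<gamma>) (at_left 1)"
      by (rule tendsto_powr2) (use \<gamma> in \<open>auto simp: eventually_at_left_field intro!: exI[of _ 0]\<close>)
    then have "((\<lambda>q. exp (- c * (1 - q) powr \<gamma>)) \<longlongrightarrow> exp (- c * (1 - 1) powr \<gamma>)) (at_left (1::real))"
      by (rule tendsto_exp[OF tendsto_mult[OF tendsto_const]])
    then show ?thesis by simp
  qed
  have ev: "eventually (\<lambda>q::real. 0 \<le> q \<and> q < 1) (at_left 1)"
    by (auto simp: eventually_at_left_field intro!: exI[of _ 0])
  have part: "sum a {..<K} \<le> 1" for K
  proof (rule tendsto_le[OF _ lim])
    show "((\<lambda>q. \<Sum>k<K. a k * q ^ k) \<longlongrightarrow> sum a {..<K}) (at_left 1)"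
      by (auto intro!: tendsto_eq_intros)
    show "eventually (\<lambda>q. (\<Sum>k<K. a k * q ^ k) \<le> exp (- c * (1 - q) powr \<gamma>)) (at_left 1)"
      using ev
    proof eventually_elim
      case (elim q)
      then show ?case using sm[of q] a0
        by (metis (no_types, lifting) finite_lessThan mult_nonneg_nonneg sum_le_suminf sums_iff zero_le_power)
    qed
  qed simp
  have summ: "summable a"
    by (rule bounded_imp_summable[where B = 1]) (use a0 part lessThan_Suc_atMost in \<open>metis\<close>)+
  have "suminf a \<le> 1" using summ part by (intro suminf_le_const) auto
  moreover have "1 \<le> suminf a"
  proof (rule tendsto_upperbound[OF lim])
    show "eventually (\<lambda>q. exp (- c * (1 - q) powr \<gamma>) \<le> suminf a) (at_left 1)"
      using ev
    proof eventually_elim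
      case (elim q)
      then have "(\<Sum>k. a k * q ^ k) \<le> suminf a"
        using sm[of q] a0 summ
        by (intro suminf_le) (auto simp: sums_iff intro!: mult_left_le power_le_one)
      then show ?case using sm[of q] elim by (simp add: sums_iff)
    qed
  qed simp
  ultimately have "a sums 1" using summ by (simp add: sums_iff)
  then have "(\<lambda>k. a k * q ^ k) sums exp (- c * (1 - q) powr \<gamma>)" if "0 \<le> q" "q \<le> 1" for q
    using sm[of q] that by (cases "q = 1") auto
  then show ?thesis using a0 by blast
qed

text \<open>The discrete stable law, placed on the lattice of mesh \<open>1 / (n + 1)\<close> and with \<open>c = (n + 1)\<^sup>\<gamma>\<close>. Its
  Laplace transform is the generating function at \<open>q = exp (- z / (n + 1))\<close>.\<close>

lemma stable_lattice_approx:
  fixes \<gamma> :: real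
  assumes \<gamma>: "0 < \<gamma>" "\<gamma> \<le> 1"
  shows "\<exists>\<mu>. real_distribution \<mu> \<and> (AE x in \<mu>. 0 \<le> x) \<and>
     (\<forall>z\<ge>0. (LINT x|\<mu>. exp (- z * \<bar>x\<bar>)) =
        exp (- ((real (Suc n) * (1 - exp (- z / real (Suc n)))) powr \<gamma>)))"
proof -
  let ?m = "real (Suc n)"
  obtain a where a0: "\<And>k. 0 \<le> a k"
    and a: "\<And>q. 0 \<le> q \<Longrightarrow> q \<le> 1 \<Longrightarrow> (\<lambda>k. a k * q ^ k) sums exp (- (?m powr \<gamma>) * (1 - q) powr \<gamma>)"
    using stable_pgf_coeffs[OF \<gamma>, of "?m powr \<gamma>"] by auto
  have a1: "a sums 1" using a[of 1] by simp
  define P where "P = embed_pmf a"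
  have P: "pmf P k = a k" for k
    unfolding P_def
    by (rule pmf_embed_pmf) (use a0 a1 in \<open>auto simp: nn_integral_count_space_nat suminf_ennreal2 sums_iff\<close>)
  define \<mu> where "\<mu> = distr (measure_pmf P) borel (\<lambda>k. real k / ?m)"
  have "real_distribution \<mu>"
    unfolding \<mu>_def real_distribution_def real_distribution_axioms_def
    by (auto intro!: measure_pmf.prob_space_distr)
  moreover have "AE x in \<mu>. 0 \<le> x"
    unfolding \<mu>_def by (subst AE_distr_iff) auto
  moreover have "(LINT x|\<mu>. exp (- z * \<bar>x\<bar>)) = exp (- ((?m * (1 - exp (- z / ?m))) powr \<gamma>))"
    if z: "0 \<le> z" for z
  proof -
    define q where "q = exp (- z / ?m)"
    have q: "0 \<le> q" "q \<le> 1" using z by (auto simp: q_def)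
    have "exp (- z * \<bar>real k / ?m\<bar>) = q ^ k" for k
      by (simp add: q_def flip: exp_of_nat_mult)
    then have "(LINT x|\<mu>. exp (- z * \<bar>x\<bar>)) = (LINT k|measure_pmf P. q ^ k)"
      unfolding \<mu>_def by (subst integral_distr) auto
    also have "\<dots> = enn2real (\<integral>\<^sup>+ k. ennreal (q ^ k) \<partial>measure_pmf P)"
      by (rule integral_eq_nn_integral) (use q in auto)
    also have "(\<integral>\<^sup>+ k. ennreal (q ^ k) \<partial>measure_pmf P) = (\<Sum>k. ennreal (a k * q ^ k))"
      by (simp add: nn_integral_measure_pmf nn_integral_count_space_nat P ennreal_mult' a0)
    also have "\<dots> = ennreal (exp (- (?m powr \<gamma>) * (1 - q) powr \<gamma>))"
      using a[OF q] a0 q by (simp add: suminf_ennreal2 sums_iff)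
    finally show ?thesis using q by (simp add: powr_mult q_def del: of_nat_Suc)
  qed
  ultimately show ?thesis by blast
qed

text \<open>Continuity theorem for Laplace transforms. That the limit tends to 1 at 0 gives tightness, because
  \<open>1 - exp (- x / K)\<close> is at least \<open>1 - exp (- 1)\<close> where \<open>x > K\<close>; a weakly convergent subsequence then
  provides the measure. Writing \<open>|x|\<close> makes the test functions bounded and continuous on the whole line.\<close>

lemma laplace_limit_measure:
  fixes \<mu> :: "nat \<Rightarrow> real measure" and f :: "real \<Rightarrow> real"
  assumes rd: "\<And>n. real_distribution (\<mu> n)"
    and nn: "\<And>n. AE x in \<mu> n. 0 \<le> x"
    and lim: "\<And>z. 0 \<le> z \<Longrightarrow> (\<lambda>n. LINT x|\<mu> n. exp (- z * \<bar>x\<bar>)) \<longlonglongrightarrow> f z"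
    and f0: "(f \<longlongrightarrow> 1) (at_right 0)"
  shows "\<exists>M. real_distribution M \<and> (\<forall>z\<ge>0. (LINT x|M. exp (- z * \<bar>x\<bar>)) = f z)"
proof -
  interpret \<mu>: real_distribution "\<mu> n" for n by (rule rd)
  have int: "integrable (\<mu> n) (\<lambda>x. exp (- z * \<bar>x\<bar>))" if "0 \<le> z" for n z
    by (rule \<mu>.integrable_const_bound[where B = 1]) (use that in auto)
  have tail: "measure (\<mu> n) {x. K < x} * (1 - exp (- 1)) \<le> 1 - (LINT x|\<mu> n. exp (- (1 / K) * \<bar>x\<bar>))"
    if K: "0 < K" for K n
  proof -
    have "measure (\<mu> n) {x. K < x} * (1 - exp (- 1)) = (LINT x|\<mu> n. indicator {x. K < x} x * (1 - exp (- 1)))"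
      by simp
    also have "\<dots> \<le> (LINT x|\<mu> n. 1 - exp (- (1 / K) * \<bar>x\<bar>))"
    proof (rule integral_mono_AE)
      show "AE x in \<mu> n. indicator {x. K < x} x * (1 - exp (- 1)) \<le> 1 - exp (- (1 / K) * \<bar>x\<bar>)"
        using K by (auto intro!: AE_I2 simp: indicator_def field_simps)
      show "integrable (\<mu> n) (\<lambda>x. 1 - exp (- (1 / K) * \<bar>x\<bar>))"
        using int[of "1 / K" n] K by auto
    qed (auto intro!: \<mu>.integrable_const_bound[where B = 1])
    also have "\<dots> = 1 - (LINT x|\<mu> n. exp (- (1 / K) * \<bar>x\<bar>))"
      using int[of "1 / K" n] K \<mu>.prob_space by (subst Bochner_Integration.integral_diff) auto
    finally show ?thesis .
  qed
  have "tight \<mu>"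
    unfolding tight_def
  proof (intro conjI allI impI rd)
    fix \<epsilon> :: real assume \<epsilon>: "0 < \<epsilon>"
    define \<delta> where "\<delta> = \<epsilon> * (1 - exp (- 1)) / 2"
    have \<delta>: "0 < \<delta>" using \<epsilon> by (simp add: \<delta>_def)
    have "eventually (\<lambda>z. 1 - \<delta> < f z) (at_right 0)"
      using f0 \<delta> by (auto intro: order_tendstoD)
    then obtain b where b: "b > 0" "\<And>z. 0 < z \<Longrightarrow> z < b \<Longrightarrow> 1 - \<delta> < f z"
      unfolding eventually_at_right_field by auto
    define z where "z = b / 2"
    have z: "0 < z" "1 - \<delta> < f z" using b by (auto simp: z_def)
    have "eventually (\<lambda>n. 1 - \<delta> < (LINT x|\<mu> n. exp (- z * \<bar>x\<bar>))) sequentially"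
      by (rule order_tendstoD(1)[OF lim]) (use z in auto)
    then obtain N where N: "\<And>n. N \<le> n \<Longrightarrow> 1 - \<delta> < (LINT x|\<mu> n. exp (- z * \<bar>x\<bar>))"
      unfolding eventually_sequentially by blast
    have Kn: "\<exists>K>0. 1 - \<epsilon> < measure (\<mu> n) {x. x \<le> K}" for n
    proof -
      have "(cdf (\<mu> n) \<longlongrightarrow> 1) at_top" by (rule \<mu>.cdf_lim_at_top_prob)
      then have "eventually (\<lambda>K. 1 - \<epsilon> < cdf (\<mu> n) K) at_top"
        by (rule order_tendstoD) (use \<epsilon> in simp)
      then have "eventually (\<lambda>K. 1 - \<epsilon> < cdf (\<mu> n) K \<and> 0 < K) at_top"
        using eventually_gt_at_top by (rule eventually_conj)
      then obtain K where "1 - \<epsilon> < cdf (\<mu> n) K" "0 < K"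
        using eventually_happens'[OF trivial_limit_at_top_linorder] by blast
      then show ?thesis by (auto simp: cdf_def2 atMost_def)
    qed
    then obtain Kf where Kf: "\<And>n. 0 < Kf n" "\<And>n. 1 - \<epsilon> < measure (\<mu> n) {x. x \<le> Kf n}" by metis
    define K where "K = Max (insert (1 / z) (Kf ` {..N}))"
    have K: "1 / z \<le> K" "\<And>n. n \<le> N \<Longrightarrow> Kf n \<le> K"
      unfolding K_def by (auto intro!: Max_ge simp del: Max_insert)
    have K0: "0 < K" using K(1) z(1) by (meson divide_pos_pos less_le_trans zero_less_one)
    have big: "1 - \<epsilon> < measure (\<mu> n) {x. x \<le> K}" for n
    proof (cases "n \<le> N")
      case True
      have "measure (\<mu> n) {x. x \<le> Kf n} \<le> measure (\<mu> n) {x. x \<le> K}"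
        using K(2)[OF True] by (intro \<mu>.finite_measure_mono) auto
      then show ?thesis using Kf(2)[of n] by linarith
    next
      case False
      have "measure (\<mu> n) {x. 1 / z < x} * (1 - exp (- 1)) \<le> 1 - (LINT x|\<mu> n. exp (- (1 / (1 / z)) * \<bar>x\<bar>))"
        by (rule tail) (use z in simp)
      also have "\<dots> < \<epsilon> * (1 - exp (- 1))"
        using N[of n] False \<delta> by (simp add: \<delta>_def)
      finally have "measure (\<mu> n) {x. 1 / z < x} < \<epsilon>" by simp
      moreover have "measure (\<mu> n) {x. x \<le> 1 / z} = 1 - measure (\<mu> n) {x. 1 / z < x}"
      proof -
        have *: "{x. x \<le> 1 / z} = space (\<mu> n) - {x. 1 / z < x}" by auto
        show ?thesis unfolding * by (rule \<mu>.prob_compl) simp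
      qed
      moreover have "measure (\<mu> n) {x. x \<le> 1 / z} \<le> measure (\<mu> n) {x. x \<le> K}"
        using K(1) by (intro \<mu>.finite_measure_mono) auto
      ultimately show ?thesis by linarith
    qed
    have "measure (\<mu> n) {-1<..K} = measure (\<mu> n) {x. x \<le> K}" for n
    proof (rule \<mu>.finite_measure_eq_AE)
      show "AE x in \<mu> n. (x \<in> {-1<..K}) = (x \<in> {x. x \<le> K})" using nn[of n] by eventually_elim auto
    qed auto
    then show "\<exists>a b. a < b \<and> (\<forall>n. 1 - \<epsilon> < measure (\<mu> n) {a<..b})"
      using big K0 by (intro exI[of _ "-1"] exI[of _ K]) auto
  qed
  from tight_imp_convergent_subsubsequence[OF this strict_mono_id]
  obtain r M where r: "strict_mono r" and M: "real_distribution M" and w: "weak_conv_m (\<mu> \<circ> id \<circ> r) M"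
    by blast
  have "(LINT x|M. exp (- z * \<bar>x\<bar>)) = f z" if "0 \<le> z" for z
  proof (rule LIMSEQ_unique)
    show "(\<lambda>n. LINT x|(\<mu> \<circ> id \<circ> r) n. exp (- z * \<bar>x\<bar>)) \<longlonglongrightarrow> (LINT x|M. exp (- z * \<bar>x\<bar>))"
      by (rule weak_conv_imp_integral_bdd_continuous_conv[where B = 1])
        (use that M w rd in \<open>auto intro!: continuous_intros simp: o_def\<close>)
    show "(\<lambda>n. LINT x|(\<mu> \<circ> id \<circ> r) n. exp (- z * \<bar>x\<bar>)) \<longlonglongrightarrow> f z"
      using LIMSEQ_subseq_LIMSEQ[OF lim[OF that] r] by (simp add: o_def)
  qed
  then show ?thesis using M by blast
qed

text \<open>The lattice laws converge because \<open>n (1 - exp (- z / n))\<close> tends to \<open>z\<close>. The limit does not charge 0,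
  since its Laplace transform vanishes at infinity.\<close>

lemma stable_law:
  fixes \<gamma> :: real
  assumes \<gamma>: "0 < \<gamma>" "\<gamma> \<le> 1"
  shows "\<exists>M. prob_space M \<and> sets M = sets borel \<and> (AE x in M. 0 < x) \<and>
     (\<forall>z\<ge>0. (LINT x|M. exp (- z * x)) = exp (- (z powr \<gamma>)))"
proof -
  obtain \<mu> where rd: "\<And>n. real_distribution (\<mu> n)" and nn: "\<And>n. AE x in \<mu> n. 0 \<le> x"
    and L: "\<And>n z. 0 \<le> z \<Longrightarrow> (LINT x|\<mu> n. exp (- z * \<bar>x\<bar>)) =
        exp (- ((real (Suc n) * (1 - exp (- z / real (Suc n)))) powr \<gamma>))"
    using stable_lattice_approx[OF \<gamma>] by metis
  have c: "(\<lambda>n. LINT x|\<mu> n. exp (- z * \<bar>x\<bar>)) \<longlonglongrightarrow> exp (- (z powr \<gamma>))" if z: "0 \<le> z" for z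
  proof -
    have "(\<lambda>n. real n * (1 - exp (- z / real n))) \<longlonglongrightarrow> z" by real_asymp
    from LIMSEQ_Suc[OF this]
    have "(\<lambda>n. (real (Suc n) * (1 - exp (- z / real (Suc n)))) powr \<gamma>) \<longlonglongrightarrow> z powr \<gamma>"
      by (rule tendsto_powr2) (use \<gamma> z in \<open>auto intro!: always_eventually mult_nonneg_nonneg\<close>)
    then show ?thesis unfolding L[OF z] by (rule tendsto_exp[OF tendsto_minus])
  qed
  have "((\<lambda>z. exp (- (z powr \<gamma>))) \<longlongrightarrow> exp (- (0 powr \<gamma>))) (at_right 0)"
    by (intro tendsto_intros tendsto_powr2) (use \<gamma> in \<open>auto simp: eventually_at_right_less intro: eventually_mono[OF eventually_at_right_less]\<close>)
  then have 0: "((\<lambda>z. exp (- (z powr \<gamma>))) \<longlongrightarrow> 1) (at_right 0)" using \<gamma> by simp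
  obtain M where M: "real_distribution M" and LM: "\<And>z. 0 \<le> z \<Longrightarrow> (LINT x|M. exp (- z * \<bar>x\<bar>)) = exp (- (z powr \<gamma>))"
    using laplace_limit_measure[OF rd nn c 0] by blast
  interpret M: real_distribution M by (rule M)
  have "measure M {0} \<le> exp (- (z powr \<gamma>))" if "0 \<le> z" for z
  proof -
    have "measure M {0} = (LINT x|M. indicator {0} x)" by simp
    also have "\<dots> \<le> (LINT x|M. exp (- z * \<bar>x\<bar>))"
      using that by (intro integral_mono) (auto intro!: M.integrable_const_bound[where B = 1] simp: indicator_def)
    finally show ?thesis using LM[OF that] by simp
  qed
  moreover have "((\<lambda>z. exp (- (z powr \<gamma>))) \<longlongrightarrow> 0) at_top"
    using \<gamma> by real_asymp
  ultimately have "measure M {0} \<le> 0"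
    by (intro tendsto_lowerbound[of _ 0 at_top]) (auto intro: eventually_mono[OF eventually_ge_at_top[of 0]])
  then have "emeasure M {0} = 0" by (simp add: M.emeasure_eq_measure measure_le_0_iff)
  then have "AE x in M. x \<noteq> 0"
    by (intro AE_I[of _ _ "{0}"]) auto
  then have "AE x in distr M borel abs. 0 < x" by (subst AE_distr_iff) auto
  moreover have "(LINT x|distr M borel abs. exp (- z * x)) = exp (- (z powr \<gamma>))" if "0 \<le> z" for z
    by (subst integral_distr) (use LM[OF that] in auto)
  ultimately show ?thesis
    by (intro exI[of _ "distr M borel abs"]) (auto intro!: M.prob_space_distr)
qed

text \<open>The stable law as a random variable that is positive at every point, which spares almost-everywhere
  qualifications later on.\<close>

lemma stable_random_variable:
  fixes \<gamma> :: real
  assumes \<gamma>: "0 < \<gamma>" "\<gamma> \<le> 1"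
  shows "\<exists>(M::real measure) X. prob_space M \<and> X \<in> borel_measurable M \<and> (\<forall>\<omega>. 0 < X \<omega>) \<and>
     (\<forall>z\<ge>0. (LINT \<omega>|M. exp (- z * X \<omega>)) = exp (- (z powr \<gamma>)))"
proof -
  obtain M where M: "prob_space M" "sets M = sets borel" "AE x in M. 0 < x"
    "\<And>z. 0 \<le> z \<Longrightarrow> (LINT x|M. exp (- z * x)) = exp (- (z powr \<gamma>))"
    using stable_law[OF \<gamma>] by blast
  define X where "X x = (if 0 < x then x else 1)" for x :: real
  have id: "(\<lambda>x. x) \<in> borel_measurable M" by (simp add: measurable_cong_sets[OF M(2) refl])
  have X: "X \<in> borel_measurable M"
    unfolding X_def using id by measurable
  have "(LINT x|M. exp (- z * X x)) = (LINT x|M. exp (- z * x))" for z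
    by (rule integral_cong_AE) (use M(3) X id in \<open>auto simp: X_def\<close>)
  then show ?thesis using M X by (intro exI[of _ M] exI[of _ X]) (auto simp: X_def)
qed

section \<open>Subordination by stable laws\<close>

text \<open>For \<open>\<nu> = \<alpha> k\<close>, integrating \<open>\<Gamma>(\<nu>) x\<^sup>-\<^sup>\<nu> = \<integral> z\<^sup>\<nu>\<^sup>-\<^sup>1 exp (- z x) dz\<close> against the law of \<open>X\<close> leaves
  \<open>\<integral> z\<^sup>\<nu>\<^sup>-\<^sup>1 exp (- z\<^sup>\<alpha>) dz\<close>. Here \<open>exp (- z\<^sup>\<alpha>)\<close> is the integral of \<open>exp (- r)\<close> over \<open>r \<ge> z\<^sup>\<alpha>\<close>, so by
  Tonelli this equals \<open>\<integral> exp (- r) r\<^sup>k / \<nu> dr = k! / \<nu>\<close>.\<close>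

lemma stable_negative_moment:
  assumes \<alpha>: "0 < \<alpha>" and M: "prob_space M" and X[measurable]: "X \<in> borel_measurable M" and X0: "\<And>\<omega>. 0 < X \<omega>"
    and L: "\<And>z. 0 \<le> z \<Longrightarrow> (LINT \<omega>|M. exp (- z * X \<omega>)) = exp (- (z powr \<alpha>))"
  shows "has_bochner_integral M (\<lambda>\<omega>. (X \<omega> powr (- \<alpha>)) ^ k) (fact k / Gamma (\<alpha> * real k + 1))"
proof (cases "k = 0")
  case True
  interpret prob_space M by (rule M)
  show ?thesis using True X0[THEN less_imp_neq] by (simp add: has_bochner_integral_iff prob_space)
next
  case False
  interpret prob_space M by (rule M)
  interpret P: pair_sigma_finite M "lborel :: real measure" ..
  define \<nu> where "\<nu> = \<alpha> * real k"
  let ?e = "\<lambda>z r. ennreal (indicator {0..} z * z powr (\<nu> - 1)) * ennreal (indicator {z powr \<alpha>..} r * exp (- r))"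
  let ?w = "\<lambda>z. indicator {0..} z * z powr (\<nu> - 1)"
  have \<nu>: "0 < \<nu>" using False \<alpha> by (simp add: \<nu>_def)
  have G: "0 < Gamma \<nu>" using \<nu> by simp
  have pw: "(X \<omega> powr (- \<alpha>)) ^ k = X \<omega> powr (- \<nu>)" for \<omega>
    using X0[of \<omega>] by (simp add: \<nu>_def powr_powr flip: powr_realpow)
  have scale: "(\<integral>\<^sup>+ z. ennreal (?w z * exp (- z * x)) \<partial>lborel) = ennreal (Gamma \<nu> * x powr (- \<nu>))"
    if x: "0 < x" for x :: real
  proof -
    have "ennreal (Gamma \<nu>) = (\<integral>\<^sup>+ t. ennreal (indicator {0..} t * t powr (\<nu> - 1) / exp t) \<partial>lborel)"
      by (rule Gamma_conv_nn_integral_real[OF \<nu>])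
    also have "\<dots> = ennreal \<bar>x\<bar> * (\<integral>\<^sup>+ z. ennreal (indicator {0..} (0 + x * z) * (0 + x * z) powr (\<nu> - 1) / exp (0 + x * z)) \<partial>lborel)"
      by (rule nn_integral_real_affine) (use x in auto)
    also have "\<dots> = ennreal (x * x powr (\<nu> - 1)) * (\<integral>\<^sup>+ z. ennreal (?w z * exp (- z * x)) \<partial>lborel)"
    proof -
      have "ennreal (indicator {0..} (0 + x * z) * (0 + x * z) powr (\<nu> - 1) / exp (0 + x * z)) =
        ennreal (x powr (\<nu> - 1)) * ennreal (?w z * exp (- z * x))" for z
        using x by (auto simp: indicator_def zero_le_mult_iff powr_mult exp_minus field_simps simp flip: ennreal_mult')
      then show ?thesis using x by (simp add: nn_integral_cmult ennreal_mult' mult.assoc)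
    qed
    also have "x * x powr (\<nu> - 1) = x powr \<nu>" using x powr_add[of x 1 "\<nu> - 1"] by simp
    finally have *: "ennreal (Gamma \<nu>) = ennreal (x powr \<nu>) * (\<integral>\<^sup>+ z. ennreal (?w z * exp (- z * x)) \<partial>lborel)" .
    have "ennreal (Gamma \<nu> * x powr (- \<nu>)) = ennreal (x powr (- \<nu>)) * ennreal (Gamma \<nu>)"
      using G by (simp add: ennreal_mult' mult.commute less_imp_le)
    also have "\<dots> = (ennreal (x powr (- \<nu>)) * ennreal (x powr \<nu>)) * (\<integral>\<^sup>+ z. ennreal (?w z * exp (- z * x)) \<partial>lborel)"
      by (simp add: * mult.assoc)
    also have "ennreal (x powr (- \<nu>)) * ennreal (x powr \<nu>) = 1"
      using x by (simp flip: ennreal_mult' powr_add)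
    finally show ?thesis by simp
  qed
  have "(\<integral>\<^sup>+ \<omega>. ennreal (Gamma \<nu> * X \<omega> powr (- \<nu>)) \<partial>M) =
      (\<integral>\<^sup>+ \<omega>. (\<integral>\<^sup>+ z. ennreal (?w z * exp (- z * X \<omega>)) \<partial>lborel) \<partial>M)"
    using scale[OF X0] by simp
  also have "\<dots> = (\<integral>\<^sup>+ z. (\<integral>\<^sup>+ \<omega>. ennreal (?w z * exp (- z * X \<omega>)) \<partial>M) \<partial>lborel)"
    by (rule P.Fubini'[symmetric]) measurable
  also have "\<dots> = (\<integral>\<^sup>+ z. ennreal (?w z * exp (- (z powr \<alpha>))) \<partial>lborel)"
  proof (rule nn_integral_cong)
    fix z :: real
    show "(\<integral>\<^sup>+ \<omega>. ennreal (?w z * exp (- z * X \<omega>)) \<partial>M) = ennreal (?w z * exp (- (z powr \<alpha>)))"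
    proof (cases "0 \<le> z")
      case True
      have "(\<integral>\<^sup>+ \<omega>. ennreal (exp (- z * X \<omega>)) \<partial>M) = ennreal (exp (- (z powr \<alpha>)))"
        unfolding L[OF True, symmetric]
        by (rule nn_integral_eq_integral) (use True X0[THEN less_imp_le] in \<open>auto intro!: integrable_const_bound[where B = 1]\<close>)
      then show ?thesis using True by (simp add: ennreal_mult' nn_integral_cmult)
    qed simp
  qed
  also have "\<dots> = (\<integral>\<^sup>+ z. (\<integral>\<^sup>+ r. ?e z r \<partial>lborel) \<partial>lborel)"
  proof (rule nn_integral_cong)
    fix z :: real
    have "(\<integral>\<^sup>+ r. ennreal (exp (- r)) * indicator {z powr \<alpha>..} r \<partial>lborel) = ennreal (0 - (- exp (- (z powr \<alpha>))))"
    proof (rule nn_integral_FTC_atLeast)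
      show "((\<lambda>r. - exp (- r)) \<longlongrightarrow> 0) (at_top :: real filter)" by real_asymp
    qed (auto intro!: derivative_eq_intros)
    then have "(\<integral>\<^sup>+ r. ennreal (indicator {z powr \<alpha>..} r * exp (- r)) \<partial>lborel) = ennreal (exp (- (z powr \<alpha>)))"
      by (simp add: ennreal_mult' ennreal_indicator mult.commute)
    then show "ennreal (?w z * exp (- (z powr \<alpha>))) =
      (\<integral>\<^sup>+ r. ?e z r \<partial>lborel)"
      by (simp add: nn_integral_cmult ennreal_mult')
  qed
  also have "\<dots> = (\<integral>\<^sup>+ r. (\<integral>\<^sup>+ z. ?e z r \<partial>lborel) \<partial>lborel)"
  proof (rule lborel_pair.Fubini'[symmetric])
    have "(\<lambda>(z, r). ennreal (?w z) * ennreal (indicator {p. fst p powr \<alpha> \<le> snd p} (z, r) * exp (- r))) \<in> borel_measurable (lborel \<Otimes>\<^sub>M lborel)"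
      by measurable
    then show "(\<lambda>(z, r). ?e z r) \<in> borel_measurable (lborel \<Otimes>\<^sub>M lborel)"
      by (simp add: indicator_def)
  qed
  also have "\<dots> = (\<integral>\<^sup>+ r. ennreal (1 / \<nu>) * ennreal (indicator {0..} r * r powr (real (Suc k) - 1) / exp r) \<partial>lborel)"
  proof (rule nn_integral_cong_AE)
    show "AE r in lborel. (\<integral>\<^sup>+ z. ?e z r \<partial>lborel)
      = ennreal (1 / \<nu>) * ennreal (indicator {0..} r * r powr (real (Suc k) - 1) / exp r)"
      using AE_lborel_singleton[of 0]
    proof eventually_elim
      case (elim r)
      show ?case
      proof (cases "0 < r")
        case True
        define b where "b = r powr (1 / \<alpha>)"
        have b: "0 < b" using True by (simp add: b_def)
        have bn: "b powr \<nu> = r ^ k" using True \<alpha> by (simp add: b_def \<nu>_def powr_powr powr_realpow)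
        have zb: "z powr \<alpha> \<le> r \<longleftrightarrow> z \<le> b" if "0 < z" for z
        proof -
          have "r = b powr \<alpha>" using True \<alpha> by (simp add: b_def powr_powr)
          then show ?thesis using that b \<alpha> powr_mono2[of \<alpha> z b] powr_less_mono2[of \<alpha> b z] by force
        qed
        have hb: "has_bochner_integral lborel (\<lambda>z. indicator {0<..<b} z * ((b - z) powr (1 - 1) * (z - 0) powr (\<nu> - 1))) (Beta \<nu> 1 * (b - 0) powr (\<nu> + 1 - 1))"
          by (rule has_bochner_integral_beta) (use \<nu> b in auto)
        have "(\<integral>\<^sup>+ z. ?e z r \<partial>lborel)
          = (\<integral>\<^sup>+ z. ennreal (exp (- r)) * ennreal (indicator {0<..<b} z * ((b - z) powr (1 - 1) * (z - 0) powr (\<nu> - 1))) \<partial>lborel)"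
        proof (rule nn_integral_cong_AE)
          show "AE z in lborel. ?e z r =
            ennreal (exp (- r)) * ennreal (indicator {0<..<b} z * ((b - z) powr (1 - 1) * (z - 0) powr (\<nu> - 1)))"
            using AE_lborel_singleton[of b]
          proof eventually_elim
            case (elim z)
            then show ?case using zb[of z] by (cases "0 < z") (auto simp: indicator_def mult.commute)
          qed
        qed
        also have "\<dots> = ennreal (exp (- r)) * ennreal (Beta \<nu> 1 * b powr \<nu>)"
          using hb by (subst nn_integral_cmult) (auto simp: has_bochner_integral_iff nn_integral_eq_integral)
        also have "Beta \<nu> 1 = 1 / \<nu>"
          using Gamma_plus1[of \<nu>] \<nu> G[THEN less_imp_neq] by (simp add: Beta_def add.commute nonpos_Ints_def)
        finally show ?thesis
          using True \<nu> by (simp add: bn powr_realpow exp_minus field_simps flip: ennreal_mult')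
      next
        case False
        then have "r < 0" using elim by simp
        then have "indicator {z powr \<alpha>..} r = (0::real)" for z :: real
          using powr_ge_zero[of z \<alpha>] by (auto simp: indicator_def simp del: powr_ge_zero)
        then show ?thesis using \<open>r < 0\<close> by simp
      qed
    qed
  qed
  also have "\<dots> = ennreal (1 / \<nu>) * ennreal (Gamma (real (Suc k)))"
    by (subst Gamma_conv_nn_integral_real) (auto simp: nn_integral_cmult)
  also have "\<dots> = ennreal (fact k / \<nu>)"
    using \<nu> by (simp add: Gamma_fact[of k, where 'a=real, simplified add.commute] flip: ennreal_mult')
  finally have "(\<integral>\<^sup>+ \<omega>. ennreal (Gamma \<nu> * X \<omega> powr (- \<nu>)) \<partial>M) = ennreal (fact k / \<nu>)" .
  then have "has_bochner_integral M (\<lambda>\<omega>. Gamma \<nu> * X \<omega> powr (- \<nu>)) (fact k / \<nu>)"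
    by (intro has_bochner_integral_nn_integral) (use \<nu> G in auto)
  then have "has_bochner_integral M (\<lambda>\<omega>. (1 / Gamma \<nu>) * (Gamma \<nu> * X \<omega> powr (- \<nu>))) ((1 / Gamma \<nu>) * (fact k / \<nu>))"
    by (intro has_bochner_integral_mult_right) auto
  moreover have "Gamma (\<alpha> * real k + 1) = \<nu> * Gamma \<nu>"
    using Gamma_plus1[of \<nu>] \<nu> by (simp add: \<nu>_def add.commute nonpos_Ints_def)
  ultimately show ?thesis using G unfolding pw by (simp add: mult_ac)
qed

lemma exp_moment_series:
  fixes \<Theta> :: "'b \<Rightarrow> real"
  assumes mom: "\<And>k. has_bochner_integral M (\<lambda>\<omega>. \<Theta> \<omega> ^ (k + j)) (m k)"
    and pos: "\<And>\<omega>. 0 \<le> \<Theta> \<omega>"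
    and summ: "summable (\<lambda>k. \<bar>a\<bar> ^ k / fact k * m k)"
  shows "has_bochner_integral M (\<lambda>\<omega>. \<Theta> \<omega> ^ j * exp (a * \<Theta> \<omega>)) (\<Sum>k. a ^ k / fact k * m k)"
proof -
  define f where "f k \<omega> = a ^ k / fact k * \<Theta> \<omega> ^ (k + j)" for k \<omega>
  have f: "has_bochner_integral M (f k) (a ^ k / fact k * m k)" for k
    unfolding f_def by (rule has_bochner_integral_mult_right) (use mom in auto)
  have nf: "norm (f k \<omega>) = \<bar>a\<bar> ^ k / fact k * \<Theta> \<omega> ^ (k + j)" for k \<omega>
    using pos[of \<omega>] by (simp add: f_def abs_mult power_abs)
  have "has_bochner_integral M (\<lambda>\<omega>. norm (f k \<omega>)) (\<bar>a\<bar> ^ k / fact k * m k)" for k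
    unfolding nf by (rule has_bochner_integral_mult_right) (use mom in auto)
  then have s1: "summable (\<lambda>k. \<integral>\<omega>. norm (f k \<omega>) \<partial>M)"
    using summ by (simp add: has_bochner_integral_iff)
  have es: "(\<lambda>k. b ^ k / fact k * \<Theta> \<omega> ^ (k + j)) sums (\<Theta> \<omega> ^ j * exp (b * \<Theta> \<omega>))" for b \<omega>
  proof -
    have "(\<lambda>k. \<Theta> \<omega> ^ j * ((b * \<Theta> \<omega>) ^ k /\<^sub>R fact k)) sums (\<Theta> \<omega> ^ j * exp (b * \<Theta> \<omega>))"
      by (intro sums_mult exp_converges)
    then show ?thesis by (simp add: power_mult_distrib power_add divide_inverse mult_ac)
  qed
  have s2: "summable (\<lambda>k. norm (f k \<omega>))" for \<omega>
    unfolding nf using es by (rule sums_summable)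
  have int: "integrable M (f k)" for k using f by (simp add: has_bochner_integral_iff)
  have I: "integrable M (\<lambda>\<omega>. \<Sum>k. f k \<omega>)" and S: "(\<lambda>k. \<integral>\<omega>. f k \<omega> \<partial>M) sums (\<integral>\<omega>. (\<Sum>k. f k \<omega>) \<partial>M)"
    by (rule integrable_suminf[OF int AE_I2[OF s2] s1], rule sums_integral[OF int AE_I2[OF s2] s1])
  have "(\<Sum>k. f k \<omega>) = \<Theta> \<omega> ^ j * exp (a * \<Theta> \<omega>)" for \<omega>
    using es[of a \<omega>] by (simp add: f_def sums_iff)
  then show ?thesis
    using I S f by (simp add: has_bochner_integral_iff sums_iff)
qed

text \<open>The moments of \<open>X\<^sup>-\<^sup>\<alpha>\<close> are \<open>k! / \<Gamma>(\<alpha> k + 1)\<close>, so the expectation of the exponential series is the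
  Mittag-Leffler series.\<close>

lemma mittag_leffler_subordination:
  assumes \<alpha>: "0 < \<alpha>" "\<alpha> < 1" and M: "prob_space M" and X[measurable]: "X \<in> borel_measurable M" and X0: "\<And>\<omega>. 0 < X \<omega>"
    and L: "\<And>z. 0 \<le> z \<Longrightarrow> (LINT \<omega>|M. exp (- z * X \<omega>)) = exp (- (z powr \<alpha>))"
  shows "integrable M (\<lambda>\<omega>. X \<omega> powr (- \<alpha>))"
    and "(LINT \<omega>|M. exp (a * X \<omega> powr (- \<alpha>))) = mittag_leffler \<alpha> 1 a"
    and "(LINT \<omega>|M. \<alpha> * X \<omega> powr (- \<alpha>) * exp (a * X \<omega> powr (- \<alpha>))) = mittag_leffler \<alpha> \<alpha> a"
proof -
  have mom: "has_bochner_integral M (\<lambda>\<omega>. (X \<omega> powr (- \<alpha>)) ^ k) (fact k / Gamma (\<alpha> * real k + 1))" for k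
    by (rule stable_negative_moment[OF \<alpha>(1) M X X0 L])
  show "integrable M (\<lambda>\<omega>. X \<omega> powr (- \<alpha>))"
    using mom[of 1] by (simp add: has_bochner_integral_iff)
  have "has_bochner_integral M (\<lambda>\<omega>. (X \<omega> powr (- \<alpha>)) ^ 0 * exp (a * X \<omega> powr (- \<alpha>)))
      (\<Sum>k. a ^ k / fact k * (fact k / Gamma (\<alpha> * real k + 1)))"
    by (rule exp_moment_series) (use mom \<alpha> summable_mittag_leffler[of \<alpha> 1 "\<bar>a\<bar>"] in auto)
  then show "(LINT \<omega>|M. exp (a * X \<omega> powr (- \<alpha>))) = mittag_leffler \<alpha> 1 a"
    by (simp add: has_bochner_integral_iff mittag_leffler_def)
  have eq: "b ^ k / fact k * (fact (k + 1) / Gamma (\<alpha> * real (k + 1) + 1)) = (1 / \<alpha>) * (b ^ k / Gamma (\<alpha> * real k + \<alpha>))" for b k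
  proof -
    have p: "0 < \<alpha> * real k + \<alpha>" using \<alpha> by (simp add: add_nonneg_pos)
    have "Gamma (\<alpha> * real (k + 1) + 1) = (\<alpha> * real k + \<alpha>) * Gamma (\<alpha> * real k + \<alpha>)"
      using Gamma_plus1[of "\<alpha> * real k + \<alpha>"] p by (simp add: algebra_simps nonpos_Ints_def)
    also have "\<alpha> * real k + \<alpha> = \<alpha> * (real k + 1)" by (simp add: algebra_simps)
    finally have "Gamma (\<alpha> * real (k + 1) + 1) = \<alpha> * (real k + 1) * Gamma (\<alpha> * (real k + 1))" .
    moreover define G where "G = Gamma (\<alpha> * (real k + 1))"
    moreover define q where "q = real k + 1"
    ultimately have 1: "Gamma (\<alpha> * real (k + 1) + 1) = \<alpha> * q * G" by simp
    have 2: "Gamma (\<alpha> * real k + \<alpha>) = G" by (simp add: G_def algebra_simps)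
    have 3: "fact (k + 1) = q * (fact k :: real)" by (simp add: q_def)
    have "G > 0" unfolding G_def using \<alpha> by (intro Gamma_real_pos) auto
    moreover have "0 < q" by (simp add: q_def)
    ultimately show ?thesis
      using \<alpha> unfolding 1 2 3 by (simp add: field_simps)
  qed
  have "has_bochner_integral M (\<lambda>\<omega>. (X \<omega> powr (- \<alpha>)) ^ 1 * exp (a * X \<omega> powr (- \<alpha>)))
      (\<Sum>k. a ^ k / fact k * (fact (k + 1) / Gamma (\<alpha> * real (k + 1) + 1)))"
  proof (rule exp_moment_series)
    show "summable (\<lambda>k. \<bar>a\<bar> ^ k / fact k * (fact (k + 1) / Gamma (\<alpha> * real (k + 1) + 1)))"
      unfolding eq using \<alpha> by (intro summable_mult summable_mittag_leffler) auto
  qed (rule mom, simp)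
  then have "(LINT \<omega>|M. X \<omega> powr (- \<alpha>) * exp (a * X \<omega> powr (- \<alpha>))) = (\<Sum>k. (1 / \<alpha>) * (a ^ k / Gamma (\<alpha> * real k + \<alpha>)))"
    unfolding eq by (simp add: has_bochner_integral_iff)
  also have "\<dots> = (1 / \<alpha>) * mittag_leffler \<alpha> \<alpha> a"
    unfolding mittag_leffler_def using \<alpha> by (intro suminf_mult summable_mittag_leffler) auto
  finally show "(LINT \<omega>|M. \<alpha> * X \<omega> powr (- \<alpha>) * exp (a * X \<omega> powr (- \<alpha>))) = mittag_leffler \<alpha> \<alpha> a"
    using \<alpha> by (simp add: mult.assoc)
qed

text \<open>Take \<open>V = X\<^sub>2 X\<^sub>1\<^sup>-\<^sup>\<alpha>\<^sup>/\<^sup>\<beta>\<close> and \<open>\<Theta> = \<alpha> X\<^sub>1\<^sup>-\<^sup>\<alpha>\<close> with independent \<open>X\<^sub>1\<close>, stable of index \<open>\<alpha>\<close>, and \<open>X\<^sub>2\<close>,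
  stable of index \<open>\<beta>\<close>. Given \<open>X\<^sub>1\<close>, the Laplace transform of \<open>V\<close> at \<open>z\<close> is \<open>exp (- z\<^sup>\<beta> X\<^sub>1\<^sup>-\<^sup>\<alpha>)\<close>, to which
  the preceding lemma applies.\<close>

lemma subordination_variables:
  assumes \<alpha>: "0 < \<alpha>" "\<alpha> < 1" and \<beta>: "0 < \<beta>" "\<beta> \<le> 1"
  shows "\<exists>(Q :: (real \<times> real) measure) V \<Theta>. prob_space Q \<and> V \<in> borel_measurable Q \<and> integrable Q \<Theta> \<and>
     (\<forall>\<omega>. 0 < V \<omega>) \<and> (\<forall>\<omega>. 0 < \<Theta> \<omega>) \<and>
     (\<forall>z\<ge>0. (LINT \<omega>|Q. exp (- z * V \<omega>)) = mittag_leffler \<alpha> 1 (- (z powr \<beta>))) \<and>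
     (\<forall>z\<ge>0. (LINT \<omega>|Q. \<Theta> \<omega> * exp (- z * V \<omega>)) = mittag_leffler \<alpha> \<alpha> (- (z powr \<beta>)))"
proof -
  obtain M1 :: "real measure" and X1 where M1: "prob_space M1" and X1[measurable]: "X1 \<in> borel_measurable M1"
    and X10: "\<And>\<omega>. 0 < X1 \<omega>" and L1: "\<And>z. 0 \<le> z \<Longrightarrow> (LINT \<omega>|M1. exp (- z * X1 \<omega>)) = exp (- (z powr \<alpha>))"
    using stable_random_variable[of \<alpha>] \<alpha> by fastforce
  obtain M2 :: "real measure" and X2 where M2: "prob_space M2" and X2[measurable]: "X2 \<in> borel_measurable M2"
    and X20: "\<And>\<omega>. 0 < X2 \<omega>" and L2: "\<And>z. 0 \<le> z \<Longrightarrow> (LINT \<omega>|M2. exp (- z * X2 \<omega>)) = exp (- (z powr \<beta>))"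
    using stable_random_variable[of \<beta>] \<beta> by fastforce
  interpret M1: prob_space M1 by (rule M1)
  interpret M2: prob_space M2 by (rule M2)
  interpret P: pair_prob_space M1 M2 ..
  define V where "V = (\<lambda>(s, r). X2 r * X1 s powr (- (\<alpha> / \<beta>)))"
  define \<Theta> where "\<Theta> = (\<lambda>(s, r::real). \<alpha> * X1 s powr (- \<alpha>))"
  note ml = mittag_leffler_subordination[OF \<alpha> M1 X1 X10 L1]
  have Vm[measurable]: "V \<in> borel_measurable (M1 \<Otimes>\<^sub>M M2)" unfolding V_def by measurable
  have \<Theta>m[measurable]: "\<Theta> \<in> borel_measurable (M1 \<Otimes>\<^sub>M M2)" unfolding \<Theta>_def by measurable
  have V0: "0 < V \<omega>" for \<omega> unfolding V_def using X20 X10[THEN less_imp_neq] by (auto split: prod.splits)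
  have \<Theta>0: "0 < \<Theta> \<omega>" for \<omega> unfolding \<Theta>_def using \<alpha> X10[THEN less_imp_neq] by (auto split: prod.splits)
  have \<Theta>i: "integrable (M1 \<Otimes>\<^sub>M M2) \<Theta>"
  proof (rule P.Fubini_integrable[OF \<Theta>m])
    show "integrable M1 (\<lambda>x. LINT y|M2. norm (\<Theta> (x, y)))"
      using ml(1) by (simp add: \<Theta>_def M2.prob_space)
    show "AE x in M1. integrable M2 (\<lambda>y. \<Theta> (x, y))" by (simp add: \<Theta>_def)
  qed
  have inner: "(LINT r|M2. exp (- z * V (s, r))) = exp ((- (z powr \<beta>)) * X1 s powr (- \<alpha>))" if z: "0 \<le> z" for z s
  proof -
    have "(LINT r|M2. exp (- z * V (s, r))) = (LINT r|M2. exp (- (z * X1 s powr (- (\<alpha> / \<beta>))) * X2 r))"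
      by (simp add: V_def mult_ac)
    also have "\<dots> = exp (- ((z * X1 s powr (- (\<alpha> / \<beta>))) powr \<beta>))" using z by (intro L2) simp
    also have "(z * X1 s powr (- (\<alpha> / \<beta>))) powr \<beta> = z powr \<beta> * X1 s powr (- \<alpha>)"
      using z \<beta> by (simp add: powr_mult powr_powr)
    finally show ?thesis by simp
  qed
  have i1: "integrable (M1 \<Otimes>\<^sub>M M2) (\<lambda>\<omega>. exp (- z * V \<omega>))" if z: "0 \<le> z" for z
    by (rule P.P.integrable_const_bound[where B = 1]) (use z V0[THEN less_imp_le] in auto)
  have i2: "integrable (M1 \<Otimes>\<^sub>M M2) (\<lambda>\<omega>. \<Theta> \<omega> * exp (- z * V \<omega>))" if z: "0 \<le> z" for z
    by (rule Bochner_Integration.integrable_bound[OF \<Theta>i])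
      (use z V0[THEN less_imp_le] \<Theta>0[THEN less_imp_le] in \<open>auto simp: abs_mult intro!: mult_left_le mult_nonneg_nonneg\<close>)
  have 1: "(LINT \<omega>|(M1 \<Otimes>\<^sub>M M2). exp (- z * V \<omega>)) = mittag_leffler \<alpha> 1 (- (z powr \<beta>))" if z: "0 \<le> z" for z
    by (subst P.integral_fst'[OF i1[OF z], symmetric]) (simp only: inner[OF z] ml(2))
  have 2: "(LINT \<omega>|(M1 \<Otimes>\<^sub>M M2). \<Theta> \<omega> * exp (- z * V \<omega>)) = mittag_leffler \<alpha> \<alpha> (- (z powr \<beta>))" if z: "0 \<le> z" for z
  proof -
    have *: "(LINT r|M2. \<Theta> (s, r) * exp (- z * V (s, r))) = \<alpha> * X1 s powr (- \<alpha>) * exp ((- (z powr \<beta>)) * X1 s powr (- \<alpha>))" for s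
      unfolding inner[OF z, symmetric] by (simp add: \<Theta>_def)
    show ?thesis
      by (subst P.integral_fst'[OF i2[OF z], symmetric]) (simp only: * ml(3))
  qed
  show ?thesis
    by (rule exI[of _ "M1 \<Otimes>\<^sub>M M2"], rule exI[of _ V], rule exI[of _ \<Theta>])
      (use P.prob_space_axioms Vm \<Theta>i V0 \<Theta>0 1 2 in auto)
qed

section \<open>Heat kernels and uniqueness of Fourier transforms\<close>

definition heat_kernel :: "real \<Rightarrow> 'a::euclidean_space \<Rightarrow> real" where
  "heat_kernel r x = (4 * pi * r) powr (- (real DIM('a) / 2)) * exp (- (norm x)\<^sup>2 / (4 * r))"

lemma heat_kernel_nonneg: "0 \<le> heat_kernel r x"
  by (simp add: heat_kernel_def)

lemma heat_kernel_pos: "0 < r \<Longrightarrow> 0 < heat_kernel r x"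
  by (simp add: heat_kernel_def)

lemma heat_kernel_measurable[measurable]:
  "(\<lambda>(r, x). heat_kernel r (x :: 'a::euclidean_space)) \<in> borel_measurable (borel \<Otimes>\<^sub>M borel)"
  unfolding heat_kernel_def by measurable

text \<open>The characteristic function of the standard normal law, rescaled by \<open>sqrt (2 r)\<close>.\<close>

lemma gaussian_fourier_1d:
  fixes r k :: real
  assumes r: "0 < r"
  shows "has_bochner_integral lborel
     (\<lambda>y. complex_of_real ((4 * pi * r) powr (- (1 / 2)) * exp (- y\<^sup>2 / (4 * r))) * cis (- (k * y)))
     (of_real (exp (- r * k\<^sup>2)))"
proof -
  define s where "s = sqrt (2 * r)"
  have s: "0 < s" "s\<^sup>2 = 2 * r" using r by (auto simp: s_def)
  have "char std_normal_distribution (- k * s) = complex_of_real (exp (- ((- k * s)\<^sup>2) / 2))"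
    by (simp add: char_std_normal_distribution)
  also have "- ((- k * s)\<^sup>2) / 2 = - r * k\<^sup>2" by (simp add: power_mult_distrib s)
  also have "char std_normal_distribution (- k * s) =
      (LBINT x. std_normal_density x *\<^sub>R iexp ((- k * s) * x))"
    unfolding char_def by (subst integral_density) (auto simp: normal_density_nonneg)
  finally have 1: "(LBINT x. std_normal_density x *\<^sub>R iexp ((- k * s) * x)) = of_real (exp (- r * k\<^sup>2))" .
  have "integrable lborel (\<lambda>x. std_normal_density x)"
    by (rule integrable_normal_density) simp
  then have "integrable lborel (\<lambda>x. std_normal_density x *\<^sub>R iexp ((- k * s) * x))"
    by (rule Bochner_Integration.integrable_bound) (auto simp: norm_mult)
  with 1 have 2: "has_bochner_integral lborel (\<lambda>x. std_normal_density x *\<^sub>R iexp ((- k * s) * x)) (of_real (exp (- r * k\<^sup>2)))"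
    by (simp add: has_bochner_integral_iff)
  have sq: "sqrt (4 * pi * r) = s * sqrt (2 * pi)"
    using r by (simp add: s_def flip: real_sqrt_mult)
  let ?f = "\<lambda>y. complex_of_real ((4 * pi * r) powr (- (1 / 2)) * exp (- y\<^sup>2 / (4 * r))) * cis (- (k * y))"
  have "std_normal_density x *\<^sub>R iexp ((- k * s) * x) = s *\<^sub>R ?f (0 + s * x)" for x
  proof -
    have "s * (4 * pi * r) powr (- (1/2)) = 1 / sqrt (2 * pi)"
      using r s(1) by (simp add: powr_minus_divide powr_half_sqrt sq)
    then have "std_normal_density x = s * ((4 * pi * r) powr (- (1/2)) * exp (- x\<^sup>2 / 2))"
      unfolding std_normal_density_def by (simp only: mult.assoc[symmetric])
    moreover have "- (s * x)\<^sup>2 / (4 * r) = - x\<^sup>2 / 2" using r by (simp add: power_mult_distrib s(2))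
    moreover have "iexp ((- k * s) * x) = cis (- (k * (s * x)))" by (simp add: cis_conv_exp mult_ac)
    ultimately show ?thesis
      by (simp add: scaleR_conv_of_real mult_ac)
  qed
  then have "has_bochner_integral lborel (\<lambda>x. ?f (0 + s * x)) (of_real (exp (- r * k\<^sup>2)) /\<^sub>R s)"
    using has_bochner_integral_scaleR_right[of "inverse s", OF 2] s(1) by simp
  then show ?thesis
    using lborel_has_bochner_integral_real_affine_iff[of s ?f "of_real (exp (- r * k\<^sup>2))" 0] s(1)
    by (simp add: inverse_eq_divide)
qed

text \<open>The integrand is a product of functions of the single coordinates.\<close>

lemma heat_kernel_fourier:
  fixes \<xi> :: "'a::euclidean_space"
  assumes r: "0 < r"
  shows "has_bochner_integral lborel (\<lambda>x. complex_of_real (heat_kernel r x) * cis (- (\<xi> \<bullet> x)))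
     (of_real (exp (- r * (norm \<xi>)\<^sup>2)))"
proof -
  define g where "g b y = complex_of_real ((4 * pi * r) powr (- (1 / 2)) * exp (- y\<^sup>2 / (4 * r))) * cis (- ((\<xi> \<bullet> b) * y))"
    for b :: 'a and y :: real
  interpret product_sigma_finite "\<lambda>_::'a. lborel :: real measure" ..
  have gb: "integrable lborel (g b)" "(LBINT y. g b y) = of_real (exp (- r * (\<xi> \<bullet> b)\<^sup>2))" for b
    using gaussian_fourier_1d[OF r, of "\<xi> \<bullet> b"] unfolding has_bochner_integral_iff g_def[abs_def] by auto
  have gm[measurable]: "g b \<in> borel_measurable borel" for b using gb(1)[of b] by auto
  have prod: "complex_of_real (heat_kernel r x) * cis (- (\<xi> \<bullet> x)) = (\<Prod>b\<in>Basis. g b (x \<bullet> b))" for x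
  proof -
    have "(norm x)\<^sup>2 = (\<Sum>b\<in>Basis. (x \<bullet> b)\<^sup>2)"
      by (subst power2_norm_eq_inner, subst euclidean_inner) (simp add: power2_eq_square)
    then have e: "exp (- (norm x)\<^sup>2 / (4 * r)) = (\<Prod>b\<in>Basis. exp (- (x \<bullet> b)\<^sup>2 / (4 * r)))"
      by (simp add: sum_divide_distrib sum_negf flip: exp_sum)
    have "\<xi> \<bullet> x = (\<Sum>b\<in>Basis. (\<xi> \<bullet> b) * (x \<bullet> b))" by (rule euclidean_inner)
    then have c: "cis (- (\<xi> \<bullet> x)) = (\<Prod>b\<in>Basis. cis (- ((\<xi> \<bullet> b) * (x \<bullet> b))))"
      by (simp add: cis_conv_exp sum_distrib_left sum_negf flip: exp_sum)
    have p: "(4 * pi * r) powr (- (real DIM('a) / 2)) = (\<Prod>b\<in>(Basis::'a set). (4 * pi * r) powr (- (1 / 2)))"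
      using r by (simp add: powr_powr flip: powr_realpow)
    show ?thesis unfolding heat_kernel_def e c p g_def
      by (simp add: prod.distrib)
  qed
  have proj: "(\<Sum>b\<in>Basis. f b *\<^sub>R b) \<bullet> b' = f b'" if "b' \<in> Basis" for f and b' :: 'a
    using that by simp
  have m: "(\<lambda>f. \<Sum>b\<in>(Basis::'a set). f b *\<^sub>R b) \<in> measurable (\<Pi>\<^sub>M b\<in>Basis. lborel) borel"
    by measurable
  have m2: "(\<lambda>x. \<Prod>b\<in>(Basis::'a set). g b (x \<bullet> b)) \<in> borel_measurable borel" by measurable
  have eq: "(\<Prod>b\<in>(Basis::'a set). g b ((\<Sum>b\<in>Basis. f b *\<^sub>R b) \<bullet> b)) = (\<Prod>b\<in>Basis. g b (f b))" for f
    by (rule prod.cong) (auto simp: proj)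
  have "integrable (\<Pi>\<^sub>M b\<in>(Basis::'a set). lborel) (\<lambda>f. \<Prod>b\<in>Basis. g b (f b))"
    by (rule product_integrable_prod) (use gb in auto)
  then have "integrable lborel (\<lambda>x. \<Prod>b\<in>(Basis::'a set). g b (x \<bullet> b))"
    unfolding lborel_eq[where 'a='a] by (subst integrable_distr_eq[OF m m2]) (simp only: eq)
  moreover have "(LBINT x. \<Prod>b\<in>(Basis::'a set). g b (x \<bullet> b)) = (\<Prod>b\<in>(Basis::'a set). LBINT y. g b y)"
    unfolding lborel_eq[where 'a='a]
    by (subst integral_distr[OF m m2]) (simp only: eq product_integral_prod[OF finite_Basis gb(1)])
  moreover have "(\<Prod>b\<in>(Basis::'a set). LBINT y. g b y) = of_real (exp (- r * (norm \<xi>)\<^sup>2))"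
  proof -
    have "(norm \<xi>)\<^sup>2 = (\<Sum>b\<in>Basis. (\<xi> \<bullet> b)\<^sup>2)"
      by (subst power2_norm_eq_inner, subst euclidean_inner) (simp add: power2_eq_square)
    then have "exp (- r * (norm \<xi>)\<^sup>2) = (\<Prod>b\<in>Basis. exp (- r * (\<xi> \<bullet> b)\<^sup>2))"
      by (simp add: sum_distrib_left sum_negf flip: exp_sum)
    then show ?thesis by (simp add: gb)
  qed
  ultimately show ?thesis unfolding prod by (simp add: has_bochner_integral_iff)
qed

lemma heat_kernel_integral:
  assumes r: "0 < r"
  shows "has_bochner_integral lborel (heat_kernel r :: 'a::euclidean_space \<Rightarrow> real) 1"
proof -
  have "has_bochner_integral lborel (\<lambda>x::'a. complex_of_real (heat_kernel r x)) (of_real 1)"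
    using heat_kernel_fourier[OF r, of "0::'a"] by simp
  then show ?thesis
    unfolding has_bochner_integral_iff by (metis complex_of_real_integrable_eq integral_complex_of_real of_real_eq_iff)
qed

text \<open>Away from the origin the heat kernel is bounded uniformly in time. This is what makes mixtures over
  arbitrary times finite and continuous there. With \<open>y = |x|\<^sup>2 / 4 r\<close> the kernel is a multiple of
  \<open>|x|\<^sup>-\<^sup>N y\<^sup>N\<^sup>/\<^sup>2 exp (- y)\<close>.\<close>

lemma heat_kernel_bound:
  fixes x :: "'a::euclidean_space"
  assumes r: "0 < r" and d: "0 < d" "d \<le> norm x"
  shows "heat_kernel r x \<le> (1 + fact DIM('a)) * (pi * d\<^sup>2) powr (- (real DIM('a) / 2))"
proof -
  let ?N = "real DIM('a)"
  define y where "y = (norm x)\<^sup>2 / (4 * r)"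
  have nx: "0 < norm x" using d by linarith
  have y: "0 < y" using r nx by (simp add: y_def)
  have eq: "4 * pi * r = (pi * (norm x)\<^sup>2) / y" using r nx by (simp add: y_def field_simps)
  have "(4 * pi * r) powr (- (?N / 2)) = (pi * (norm x)\<^sup>2) powr (- (?N / 2)) / y powr (- (?N / 2))"
    unfolding eq by (rule powr_divide)
  then have "(4 * pi * r) powr (- (?N / 2)) = (pi * (norm x)\<^sup>2) powr (- (?N / 2)) * y powr (?N / 2)"
    by (metis divide_inverse inverse_inverse_eq powr_minus)
  then have eq: "heat_kernel r x = (pi * (norm x)\<^sup>2) powr (- (?N / 2)) * (y powr (?N / 2) * exp (- y))"
    by (simp add: heat_kernel_def y_def)
  have "y powr (?N / 2) \<le> 1 + y ^ DIM('a)"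
  proof (cases "y \<le> 1")
    case True
    then have "y powr (?N / 2) \<le> 1 powr (?N / 2)" using y by (intro powr_mono2) auto
    then show ?thesis using y by (simp add: add_increasing2)
  next
    case False
    then have "y powr (?N / 2) \<le> y powr ?N" by (intro powr_mono) auto
    then show ?thesis using y by (simp add: powr_realpow)
  qed
  moreover have "y ^ DIM('a) \<le> fact DIM('a) * exp y"
  proof -
    have s: "(\<lambda>n. y ^ n /\<^sub>R fact n) sums exp y" by (rule exp_converges)
    have "(\<Sum>n\<in>{DIM('a)}. y ^ n /\<^sub>R fact n) \<le> (\<Sum>n. y ^ n /\<^sub>R fact n)"
      using s y by (intro sum_le_suminf) (auto simp: sums_iff)
    then have "y ^ DIM('a) / fact DIM('a) \<le> exp y"
      using s by (simp add: sums_iff divide_inverse mult.commute)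
    then show ?thesis by (simp add: field_simps)
  qed
  moreover have "1 \<le> exp y" using y by simp
  ultimately have "y powr (?N / 2) \<le> (1 + fact DIM('a)) * exp y"
    unfolding distrib_right by linarith
  then have "y powr (?N / 2) * exp (- y) \<le> (1 + fact DIM('a)) * exp y * exp (- y)"
    by (intro mult_right_mono) auto
  then have b: "y powr (?N / 2) * exp (- y) \<le> 1 + fact DIM('a)"
    by (simp add: mult.assoc flip: exp_add)
  have "(pi * (norm x)\<^sup>2) powr (- (?N / 2)) \<le> (pi * d\<^sup>2) powr (- (?N / 2))"
    using d by (intro powr_mono2') (auto intro!: power_mono)
  then show ?thesis unfolding eq using b y by (subst mult.commute) (intro mult_mono, auto)
qed

text \<open>Parabolic scaling of the time by \<open>s\<close>, together with radial monotonicity.\<close>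

lemma heat_kernel_parabolic_lower:
  fixes x e :: "'a::euclidean_space"
  assumes r: "0 < r" and s: "0 < s" and x: "(norm x)\<^sup>2 \<le> (norm e)\<^sup>2 * s"
  shows "s powr (- (real DIM('a) / 2)) * heat_kernel r e \<le> heat_kernel (r * s) x"
proof -
  have "(4 * pi * (r * s)) powr (- (real DIM('a) / 2)) = (4 * pi * r) powr (- (real DIM('a) / 2)) * s powr (- (real DIM('a) / 2))"
    using r s by (subst powr_mult[symmetric]) (auto simp: mult.assoc)
  moreover have "exp (- (norm e)\<^sup>2 / (4 * r)) \<le> exp (- (norm x)\<^sup>2 / (4 * (r * s)))"
    using r s x by (simp add: field_simps)
  ultimately have "heat_kernel (r * s) x \<ge>
      ((4 * pi * r) powr (- (real DIM('a) / 2)) * s powr (- (real DIM('a) / 2))) * exp (- (norm e)\<^sup>2 / (4 * r))"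
    unfolding heat_kernel_def by (simp only: mult_left_mono mult_nonneg_nonneg powr_ge_zero)
  then show ?thesis unfolding heat_kernel_def by (simp only: mult_ac)
qed

text \<open>Pairing the vanishing transform with a Gaussian and using Fubini gives
  \<open>\<integral> f y exp (- r |y - x|\<^sup>2) dy = 0\<close> for every \<open>r > 0\<close>. If \<open>f x\<close> were positive, then for large \<open>r\<close> the
  contribution of a small ball around \<open>x\<close> would exceed that of the rest.\<close>

lemma fourier_zero_imp_zero:
  fixes f :: "real ^ 'n \<Rightarrow> real"
  assumes int: "integrable lborel f" and F: "\<And>\<xi>. fourier_transform f \<xi> = 0" and cont: "isCont f x"
  shows "f x = 0"
proof -
  let ?w = "\<lambda>r y. exp (- r * (norm (y - x))\<^sup>2)"
  have [measurable]: "f \<in> borel_measurable borel" using int by auto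
  have gauss: "(LBINT y. f y * ?w r y) = 0" if r: "0 < r" for r
  proof -
    define h where "h \<xi> y = complex_of_real (f y) * (complex_of_real (heat_kernel r \<xi>) * cis (- ((y - x) \<bullet> \<xi>)))"
      for \<xi> y :: "real^'n"
    have hm[measurable]: "(\<lambda>(\<xi>, y). h \<xi> y) \<in> borel_measurable (lborel \<Otimes>\<^sub>M lborel)"
      unfolding h_def cis_conv_exp by measurable
    have nh: "norm (h \<xi> y) = \<bar>f y\<bar> * heat_kernel r \<xi>" for \<xi> y
      by (simp add: h_def norm_mult heat_kernel_nonneg)
    have hk: "integrable lborel (heat_kernel r :: real^'n \<Rightarrow> real)" "(LBINT x::real^'n. heat_kernel r x) = 1"
      using heat_kernel_integral[OF r, where 'a="real^'n"] by (auto simp: has_bochner_integral_iff)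
    have inth: "integrable (lborel \<Otimes>\<^sub>M lborel) (\<lambda>(\<xi>, y). h \<xi> y)"
    proof (rule lborel_pair.Fubini_integrable[OF hm])
      show "integrable lborel (\<lambda>\<xi>. LBINT y. norm (case (\<xi>, y) of (\<xi>, y) \<Rightarrow> h \<xi> y))"
        using hk by (simp add: nh)
      have "integrable lborel (h \<xi>)" for \<xi>
      proof (rule Bochner_Integration.integrable_bound)
        show "integrable lborel (\<lambda>y. \<bar>f y\<bar> * heat_kernel r \<xi>)" using int by simp
        show "h \<xi> \<in> borel_measurable lborel" unfolding h_def cis_conv_exp by measurable
        show "AE y in lborel. norm (h \<xi> y) \<le> norm (\<bar>f y\<bar> * heat_kernel r \<xi>)"
          by (simp add: nh heat_kernel_nonneg)
      qed
      then show "AE \<xi> in lborel. integrable lborel (\<lambda>y. case (\<xi>, y) of (\<xi>, y) \<Rightarrow> h \<xi> y)" by simp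
    qed
    have z: "(LBINT y. h \<xi> y) = 0" for \<xi>
    proof -
      have "cis (- ((y - x) \<bullet> \<xi>)) = cis (x \<bullet> \<xi>) * cis (- (\<xi> \<bullet> y))" for y
        by (simp add: cis_mult inner_diff_right inner_commute[of _ \<xi>])
      then have "(LBINT y. h \<xi> y) = (LBINT y. (complex_of_real (heat_kernel r \<xi>) * cis (x \<bullet> \<xi>)) * (complex_of_real (f y) * cis (- (\<xi> \<bullet> y))))"
        by (simp add: h_def mult_ac)
      also have "\<dots> = (complex_of_real (heat_kernel r \<xi>) * cis (x \<bullet> \<xi>)) * fourier_transform f \<xi>"
        unfolding fourier_transform_def by (rule integral_mult_right_zero)
      finally show ?thesis by (simp add: F)
    qed
    have "(LBINT y. LBINT \<xi>. h \<xi> y) = (LBINT \<xi>. LBINT y. h \<xi> y)"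
      by (rule lborel_pair.Fubini_integral[OF inth])
    then have "(LBINT y. LBINT \<xi>. h \<xi> y) = 0" by (simp add: z)
    moreover have "(LBINT \<xi>. h \<xi> y) = complex_of_real (f y * ?w r y)" for y
      using heat_kernel_fourier[OF r, of "y - x"] unfolding h_def
      by (simp add: has_bochner_integral_iff)
    ultimately have "(LBINT y. complex_of_real (f y * ?w r y)) = 0" by simp
    then show ?thesis unfolding integral_complex_of_real by simp
  qed
  have "\<not> 0 < g x" if g: "integrable lborel g" "isCont g x"
    and gg: "\<And>r. 0 < r \<Longrightarrow> (LBINT y. g y * ?w r y) = 0" for g :: "real^'n \<Rightarrow> real"
  proof
    assume pos: "0 < g x"
    define \<eta> where "\<eta> = g x / 2"
    have \<eta>: "0 < \<eta>" using pos by (simp add: \<eta>_def)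
    from g(2) obtain \<delta> where \<delta>: "0 < \<delta>" "\<And>y. dist y x < \<delta> \<Longrightarrow> dist (g y) (g x) < \<eta>"
      unfolding continuous_at_eps_delta using \<eta> by blast
    have near: "\<eta> < g y" if "norm (y - x) < \<delta>" for y
      using \<delta>(2)[of y] that by (auto simp: dist_norm \<eta>_def abs_if split: if_splits)
    define V where "V = measure lborel (ball x (\<delta> / 2))"
    have V: "0 < V" unfolding V_def using \<delta> by (simp add: content_ball_pos)
    let ?b = "\<lambda>r y. \<eta> * exp (- r * (\<delta>\<^sup>2 / 4)) * indicator (ball x (\<delta> / 2)) y"
    \<comment> \<open>Inside radius \<open>\<delta> / 2\<close> the weight is at least \<open>exp (- r \<delta>\<^sup>2 / 4)\<close>, outside radius \<open>\<delta>\<close> it is at most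
      \<open>exp (- r \<delta>\<^sup>2)\<close>, and in between the integrand is nonnegative.\<close>
    have ineq: "\<eta> * V \<le> exp (- r * (3 * \<delta>\<^sup>2 / 4)) * (LBINT y. \<bar>g y\<bar>)" if r: "0 < r" for r
    proof -
      have "(LBINT y. ?b r y - exp (- r * \<delta>\<^sup>2) * \<bar>g y\<bar>)
         \<le> (LBINT y. g y * ?w r y)"
      proof (rule integral_mono)
        show "integrable lborel (\<lambda>y. ?b r y - exp (- r * \<delta>\<^sup>2) * \<bar>g y\<bar>)"
          using g(1) emeasure_lborel_ball_finite[of x "\<delta> / 2"] by (intro Bochner_Integration.integrable_diff Bochner_Integration.integrable_mult_right) (auto intro!: integrable_real_indicator)
        have "integrable lborel (\<lambda>y. \<bar>g y\<bar>)" using g(1) by simp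
        then show "integrable lborel (\<lambda>y. g y * ?w r y)"
          by (rule Bochner_Integration.integrable_bound) (use g(1) r in \<open>auto simp: abs_mult mult_left_le\<close>)
        fix y
        show "?b r y - exp (- r * \<delta>\<^sup>2) * \<bar>g y\<bar>
          \<le> g y * ?w r y"
        proof (cases "norm (y - x) < \<delta>")
          case True
          note gy = near[OF True]
          show ?thesis
          proof (cases "norm (y - x) < \<delta> / 2")
            case True
            have "(norm (y - x))\<^sup>2 \<le> (\<delta> / 2)\<^sup>2" using True by (intro power_mono) auto
            then have "\<eta> * exp (- r * (\<delta>\<^sup>2 / 4)) \<le> g y * ?w r y"
              using gy \<eta> r by (intro mult_mono) (auto simp: power_divide)
            moreover have "y \<in> ball x (\<delta> / 2)" using True by (simp add: dist_norm norm_minus_commute)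
            ultimately show ?thesis by (simp add: diff_le_eq add_increasing2)
          next
            case False
            then have "?b r y = 0"
              by (simp add: dist_norm norm_minus_commute)
            moreover have "0 \<le> exp (- r * \<delta>\<^sup>2) * \<bar>g y\<bar>" "0 \<le> g y * ?w r y"
              using gy \<eta> by auto
            ultimately show ?thesis by linarith
          qed
        next
          case False
          then have "y \<notin> ball x (\<delta> / 2)" using \<delta>(1) by (simp add: dist_norm norm_minus_commute)
          moreover have "\<bar>g y\<bar> * ?w r y \<le> \<bar>g y\<bar> * exp (- r * \<delta>\<^sup>2)"
            using False \<delta>(1) r by (intro mult_left_mono) (auto intro!: power_mono)
          moreover have "- \<bar>g y\<bar> * ?w r y \<le> g y * ?w r y"
            by (intro mult_right_mono) auto
          ultimately show ?thesis by (simp add: mult.commute)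
        qed
      qed
      also have "\<dots> = 0" by (rule gg[OF r])
      also have "(LBINT y. ?b r y - exp (- r * \<delta>\<^sup>2) * \<bar>g y\<bar>)
         = \<eta> * exp (- r * (\<delta>\<^sup>2 / 4)) * V - exp (- r * \<delta>\<^sup>2) * (LBINT y. \<bar>g y\<bar>)"
        unfolding V_def using g(1) emeasure_lborel_ball_finite[of x "\<delta> / 2"]
        by (subst Bochner_Integration.integral_diff) (auto intro!: integrable_real_indicator Bochner_Integration.integrable_mult_right)
      finally have "\<eta> * V * exp (- r * (\<delta>\<^sup>2 / 4)) \<le> exp (- r * \<delta>\<^sup>2) * (LBINT y. \<bar>g y\<bar>)" by (simp add: mult_ac)
      also have "exp (- r * \<delta>\<^sup>2) = exp (- r * (3 * \<delta>\<^sup>2 / 4)) * exp (- r * (\<delta>\<^sup>2 / 4))"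
        by (simp add: algebra_simps flip: exp_add)
      finally have "\<eta> * V * exp (- r * (\<delta>\<^sup>2 / 4)) \<le> exp (- r * (3 * \<delta>\<^sup>2 / 4)) * (LBINT y. \<bar>g y\<bar>) * exp (- r * (\<delta>\<^sup>2 / 4))"
        by (simp add: mult_ac)
      then show ?thesis by simp
    qed
    have "((\<lambda>r. exp (- r * (3 * \<delta>\<^sup>2 / 4)) * (LBINT y. \<bar>g y\<bar>)) \<longlongrightarrow> 0) at_top"
    proof -
      define c where "c = 3 * \<delta>\<^sup>2 / 4"
      have "0 < c" using \<delta>(1) by (simp add: c_def)
      then have "((\<lambda>r. exp (- r * c)) \<longlongrightarrow> 0) at_top" by real_asymp
      then show ?thesis unfolding c_def by (rule tendsto_mult_left_zero)
    qed
    then have "\<eta> * V \<le> 0"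
      by (rule tendsto_lowerbound) (use ineq in \<open>auto intro: eventually_mono[OF eventually_gt_at_top[of 0]]\<close>)
    then show False using \<eta> V by (simp add: mult_le_0_iff)
  qed
  from this[of f] this[of "\<lambda>y. - f y"] show ?thesis using int cont gauss by fastforce
qed

section \<open>Mixtures of heat kernels\<close>

definition gauss_mix :: "'b measure \<Rightarrow> ('b \<Rightarrow> real) \<Rightarrow> ('b \<Rightarrow> real) \<Rightarrow> 'a::euclidean_space \<Rightarrow> real" where
  "gauss_mix M c v x = (\<integral>\<omega>. c \<omega> * heat_kernel (v \<omega>) x \<partial>M)"

lemma gauss_mix_integrand:
  fixes x :: "'a::euclidean_space"
  assumes c: "integrable M c" and v[measurable]: "v \<in> borel_measurable M" and v0: "\<And>\<omega>. 0 < v \<omega>"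
    and x: "x \<noteq> 0"
  shows "integrable M (\<lambda>\<omega>. c \<omega> * heat_kernel (v \<omega>) x)"
proof (rule Bochner_Integration.integrable_bound)
  let ?C = "(1 + fact DIM('a)) * (pi * (norm x)\<^sup>2) powr (- (real DIM('a) / 2))"
  show "integrable M (\<lambda>\<omega>. c \<omega> * ?C)" using c by simp
  have [measurable]: "c \<in> borel_measurable M" using c by auto
  show "(\<lambda>\<omega>. c \<omega> * heat_kernel (v \<omega>) x) \<in> borel_measurable M"
    unfolding heat_kernel_def by measurable
  show "AE \<omega> in M. norm (c \<omega> * heat_kernel (v \<omega>) x) \<le> norm (c \<omega> * ?C)"
    using heat_kernel_bound[OF v0, of "norm x" x] x
    by (intro AE_I2) (auto simp: abs_mult heat_kernel_nonneg intro!: mult_left_mono)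
qed

text \<open>Dominated convergence, by the uniform bound on heat kernels away from the origin.\<close>

lemma gauss_mix_isCont:
  fixes x :: "'a::euclidean_space"
  assumes c: "integrable M c" and v[measurable]: "v \<in> borel_measurable M" and v0: "\<And>\<omega>. 0 < v \<omega>"
    and x: "x \<noteq> 0"
  shows "isCont (gauss_mix M c v) x"
proof -
  define d where "d = norm x / 2"
  have d: "0 < d" "d < norm x" using x by (auto simp: d_def)
  let ?C = "(1 + fact DIM('a)) * (pi * d\<^sup>2) powr (- (real DIM('a) / 2))"
  let ?S = "{y::'a. d < norm y}"
  have [measurable]: "c \<in> borel_measurable M" using c by auto
  have "open ?S" by (intro open_Collect_less continuous_intros)
  moreover have "continuous_on ?S (gauss_mix M c v)"
    unfolding continuous_on_sequentially
  proof safe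
    fix X :: "nat \<Rightarrow> 'a" and a assume a: "d < norm a" and X: "\<forall>n. X n \<in> ?S" "X \<longlonglongrightarrow> a"
    show "(gauss_mix M c v \<circ> X) \<longlonglongrightarrow> gauss_mix M c v a"
      unfolding gauss_mix_def o_def
    proof (rule integral_dominated_convergence)
      show "integrable M (\<lambda>\<omega>. \<bar>c \<omega>\<bar> * ?C)" using c by simp
      show "(\<lambda>\<omega>. c \<omega> * heat_kernel (v \<omega>) a) \<in> borel_measurable M"
        "(\<lambda>\<omega>. c \<omega> * heat_kernel (v \<omega>) (X n)) \<in> borel_measurable M" for n
        unfolding heat_kernel_def by measurable
      have "v \<omega> \<noteq> 0" for \<omega> using v0[of \<omega>] by simp
      then show "AE \<omega> in M. (\<lambda>n. c \<omega> * heat_kernel (v \<omega>) (X n)) \<longlonglongrightarrow> c \<omega> * heat_kernel (v \<omega>) a"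
        unfolding heat_kernel_def by (intro AE_I2 tendsto_intros X) simp
      show "AE \<omega> in M. norm (c \<omega> * heat_kernel (v \<omega>) (X n)) \<le> \<bar>c \<omega>\<bar> * ?C" for n
        using heat_kernel_bound[OF v0 d(1), of "X n"] X(1)
        by (intro AE_I2) (auto simp: abs_mult heat_kernel_nonneg less_imp_le intro!: mult_left_mono)
    qed
  qed
  ultimately show ?thesis using d by (simp add: continuous_on_eq_continuous_at)
qed

lemma gauss_mix_fourier:
  fixes c :: "'b \<Rightarrow> real" and \<xi> :: "real^'n"
  assumes M: "sigma_finite_measure M"
    and c: "integrable M c" and v[measurable]: "v \<in> borel_measurable M" and v0: "\<And>\<omega>. 0 < v \<omega>"
  shows "integrable lborel (gauss_mix M c v :: real^'n \<Rightarrow> real)"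
    and "fourier_transform (gauss_mix M c v) \<xi> = of_real (\<integral>\<omega>. c \<omega> * exp (- (norm \<xi>)\<^sup>2 * v \<omega>) \<partial>M)"
proof -
  interpret M: sigma_finite_measure M by (rule M)
  interpret P: pair_sigma_finite M "lborel :: (real^'n) measure" ..
  have cm[measurable]: "c \<in> borel_measurable M" using c by auto
  define h where "h \<xi> \<omega> x = complex_of_real (c \<omega>) * (complex_of_real (heat_kernel (v \<omega>) x) * cis (- (\<xi> \<bullet> x)))"
    for \<xi> x :: "real^'n" and \<omega>
  have hk: "integrable lborel (heat_kernel (v \<omega>) :: real^'n \<Rightarrow> real)" "(LBINT x::real^'n. heat_kernel (v \<omega>) x) = 1" for \<omega>
    using heat_kernel_integral[OF v0, where 'a="real^'n"] by (auto simp: has_bochner_integral_iff)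
  have nh: "norm (h \<xi> \<omega> x) = \<bar>c \<omega>\<bar> * heat_kernel (v \<omega>) x" for \<xi> \<omega> x
    by (simp add: h_def norm_mult heat_kernel_nonneg)
  have inth: "integrable (M \<Otimes>\<^sub>M lborel) (\<lambda>(\<omega>, x). h \<xi> \<omega> x)" for \<xi>
  proof (rule P.Fubini_integrable)
    show "(\<lambda>(\<omega>, x). h \<xi> \<omega> x) \<in> borel_measurable (M \<Otimes>\<^sub>M lborel)"
      unfolding h_def cis_conv_exp heat_kernel_def by measurable
    show "integrable M (\<lambda>\<omega>. LBINT y. norm (case (\<omega>, y) of (\<omega>, x) \<Rightarrow> h \<xi> \<omega> x))"
      using c by (simp add: nh hk)
    have "integrable lborel (h \<xi> \<omega>)" for \<omega>
      unfolding h_def using heat_kernel_fourier[OF v0[of \<omega>], of \<xi>] by (auto simp: has_bochner_integral_iff)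
    then show "AE \<omega> in M. integrable lborel (\<lambda>y. case (\<omega>, y) of (\<omega>, x) \<Rightarrow> h \<xi> \<omega> x)" by simp
  qed
  have sn: "(\<integral>\<omega>. h \<xi> \<omega> x \<partial>M) = of_real (gauss_mix M c v x) * cis (- (\<xi> \<bullet> x))" for \<xi> x
  proof -
    have "(\<integral>\<omega>. h \<xi> \<omega> x \<partial>M) = (\<integral>\<omega>. complex_of_real (c \<omega> * heat_kernel (v \<omega>) x) * cis (- (\<xi> \<bullet> x)) \<partial>M)"
      by (simp add: h_def mult_ac)
    also have "\<dots> = of_real (gauss_mix M c v x) * cis (- (\<xi> \<bullet> x))"
      unfolding gauss_mix_def integral_complex_of_real[symmetric] by (rule integral_mult_left_zero)
    finally show ?thesis .
  qed
  have "integrable lborel (\<lambda>x::real^'n. complex_of_real (gauss_mix M c v x))"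
    using P.integrable_snd[OF inth[of 0]] by (simp add: sn)
  then show "integrable lborel (gauss_mix M c v :: real^'n \<Rightarrow> real)"
    by (simp only: complex_of_real_integrable_eq)
  have inner: "(LBINT x. h \<xi> \<omega> x) = complex_of_real (c \<omega> * exp (- (norm \<xi>)\<^sup>2 * v \<omega>))" for \<omega>
    using heat_kernel_fourier[OF v0[of \<omega>], of \<xi>] unfolding h_def
    by (simp add: has_bochner_integral_iff mult.commute)
  have "fourier_transform (gauss_mix M c v) \<xi> = (LBINT x. \<integral>\<omega>. h \<xi> \<omega> x \<partial>M)"
    by (simp add: sn fourier_transform_def)
  also have "\<dots> = (\<integral>\<omega>. (LBINT x. h \<xi> \<omega> x) \<partial>M)"
    by (rule P.Fubini_integral[OF inth])
  also have "\<dots> = (\<integral>\<omega>. complex_of_real (c \<omega> * exp (- (norm \<xi>)\<^sup>2 * v \<omega>)) \<partial>M)"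
    unfolding inner ..
  finally show "fourier_transform (gauss_mix M c v) \<xi> = of_real (\<integral>\<omega>. c \<omega> * exp (- (norm \<xi>)\<^sup>2 * v \<omega>) \<partial>M)"
    by (simp only: integral_complex_of_real)
qed

lemma eq_gauss_mix:
  fixes f :: "real^'n \<Rightarrow> real"
  assumes M: "sigma_finite_measure M" and c: "integrable M c" and v: "v \<in> borel_measurable M" and v0: "\<And>\<omega>. 0 < v \<omega>"
    and f: "integrable lborel f" "isCont f x" and x: "x \<noteq> 0"
    and F: "\<And>\<xi>. fourier_transform f \<xi> = of_real (\<integral>\<omega>. c \<omega> * exp (- (norm \<xi>)\<^sup>2 * v \<omega>) \<partial>M)"
  shows "f x = gauss_mix M c v x"
proof -
  let ?g = "gauss_mix M c v :: real^'n \<Rightarrow> real"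
  note g = gauss_mix_fourier[OF M c v v0]
  have i: "integrable lborel (\<lambda>y. complex_of_real (h y) * cis (- (\<xi> \<bullet> y)))" if h: "integrable lborel h" for h :: "real^'n \<Rightarrow> real" and \<xi>
  proof (rule Bochner_Integration.integrable_bound[OF h])
    have [measurable]: "h \<in> borel_measurable borel" using h by auto
    show "(\<lambda>y. complex_of_real (h y) * cis (- (\<xi> \<bullet> y))) \<in> borel_measurable lborel"
      unfolding cis_conv_exp by measurable
  qed (simp add: norm_mult)
  have "f x - ?g x = 0"
  proof (rule fourier_zero_imp_zero)
    show "integrable lborel (\<lambda>y. f y - ?g y)" by (rule Bochner_Integration.integrable_diff[OF f(1) g(1)])
    show "isCont (\<lambda>y. f y - ?g y) x"
      using f(2) gauss_mix_isCont[OF c v v0 x] by (intro continuous_intros)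
    show "fourier_transform (\<lambda>y. f y - ?g y) \<xi> = 0" for \<xi>
    proof -
      have "fourier_transform (\<lambda>y. f y - ?g y) \<xi> = fourier_transform f \<xi> - fourier_transform ?g \<xi>"
        unfolding fourier_transform_def
        by (subst Bochner_Integration.integral_diff[symmetric]) (auto simp: i f g(1) left_diff_distrib)
      then show ?thesis by (simp add: F g(2))
    qed
  qed
  then show ?thesis by simp
qed

section \<open>The fundamental solution and its companion kernel\<close>

lemma integrable_prod_mult:
  fixes f :: "'b \<Rightarrow> real" and g :: "'c \<Rightarrow> real"
  assumes "sigma_finite_measure A" "sigma_finite_measure B" and f: "integrable A f" and g: "integrable B g"
  shows "integrable (A \<Otimes>\<^sub>M B) (\<lambda>(x, y). f x * g y)"
proof -
  interpret A: sigma_finite_measure A by fact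
  interpret B: sigma_finite_measure B by fact
  interpret pair_sigma_finite A B ..
  have [measurable]: "f \<in> borel_measurable A" "g \<in> borel_measurable B" using f g by auto
  show ?thesis
  proof (rule Fubini_integrable)
    show "(\<lambda>(x, y). f x * g y) \<in> borel_measurable (A \<Otimes>\<^sub>M B)" by measurable
    show "integrable A (\<lambda>x. LINT y|B. norm (case (x, y) of (x, y) \<Rightarrow> f x * g y))"
      using f by (simp add: abs_mult)
    show "AE x in A. integrable B (\<lambda>y. case (x, y) of (x, y) \<Rightarrow> f x * g y)" using g by simp
  qed
qed

text \<open>The fundamental theorem of calculus for integrands that may be singular at 0.\<close>

lemma has_derivative_LBINT_from_0:
  fixes g :: "real \<Rightarrow> real"
  assumes cont: "continuous_on {0<..} g" and int: "\<And>T. 0 < T \<Longrightarrow> set_integrable lborel {0<..<T} g" and t: "0 < t"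
  shows "((\<lambda>t. LBINT s:{0<..<t}. g s) has_real_derivative g t) (at t)"
proof -
  define a where "a = t / 2"
  have a: "0 < a" "a < t" using t by (auto simp: a_def)
  have ci: "continuous_on {a..T} g" for T by (rule continuous_on_subset[OF cont]) (use a in auto)
  have eq: "(LBINT s:{0<..<a}. g s) + integral {a..T} g = (LBINT s:{0<..<T}. g s)" if T: "a < T" for T
  proof -
    have "(LBINT s:{0<..<T}. g s) = (LBINT s:({0<..<a} \<union> {a..<T}). g s)"
      using a T by (intro arg_cong2[where f = "\<lambda>A. set_lebesgue_integral lborel A"]) auto
    also have "\<dots> = (LBINT s:{0<..<a}. g s) + (LBINT s:{a..<T}. g s)"
    proof (rule set_integral_Un)
      have "set_integrable lborel {0<..<T} g" using int a T by auto
      then show "set_integrable lborel {a..<T} g" by (rule set_integrable_subset) (use a in auto)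
      show "set_integrable lborel {0<..<a} g" using int a by auto
    qed auto
    also have "(LBINT s:{a..<T}. g s) = (LBINT s:{a..T}. g s)"
      unfolding set_lebesgue_integral_def
      by (rule integral_discrete_difference[where X = "{T}"]) (auto simp: indicator_def)
    also have "\<dots> = integral {a..T} g"
      by (intro set_borel_integral_eq_integral borel_integrable_atLeastAtMost' ci)
    finally show ?thesis by simp
  qed
  have "((\<lambda>T. integral {a..T} g) has_vector_derivative g t) (at t within {a..t+1})"
    by (rule integral_has_vector_derivative) (use a ci in auto)
  then have "((\<lambda>T. integral {a..T} g) has_vector_derivative g t) (at t)"
    using a at_within_Icc_at[of a t "t + 1"] by simp
  then have "((\<lambda>T. (LBINT s:{0<..<a}. g s) + integral {a..T} g) has_vector_derivative 0 + g t) (at t)"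
    by (intro has_vector_derivative_add has_vector_derivative_const)
  then have "((\<lambda>T. LBINT s:{0<..<T}. g s) has_vector_derivative 0 + g t) (at t)"
    by (rule has_vector_derivative_transform_within_open[of _ _ _ "{a<..}"]) (use a eq in auto)
  then show ?thesis by (simp add: has_real_derivative_iff_has_vector_derivative)
qed

text \<open>The abstract properties of the pair \<open>V\<close>, \<open>\<Theta>\<close> from which the kernels are built.\<close>

locale subordination = prob_space Q
  for Q :: "'w measure" +
  fixes \<alpha> \<beta> :: real and V \<Theta> :: "'w \<Rightarrow> real"
  assumes \<alpha>: "0 < \<alpha>" "\<alpha> < 1" and \<beta>: "0 < \<beta>"
    and V_meas[measurable]: "V \<in> borel_measurable Q"
    and \<Theta>_int: "integrable Q \<Theta>"
    and V_pos: "0 < V \<omega>" and \<Theta>_pos: "0 < \<Theta> \<omega>"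
    and V_laplace: "0 \<le> z \<Longrightarrow> (LINT \<omega>|Q. exp (- z * V \<omega>)) = mittag_leffler \<alpha> 1 (- (z powr \<beta>))"
    and \<Theta>_laplace: "0 \<le> z \<Longrightarrow> (LINT \<omega>|Q. \<Theta> \<omega> * exp (- z * V \<omega>)) = mittag_leffler \<alpha> \<alpha> (- (z powr \<beta>))"
begin

definition Zmix :: "real^'n \<Rightarrow> real \<Rightarrow> real" where
  "Zmix x t = gauss_mix Q (\<lambda>_. 1) (\<lambda>\<omega>. V \<omega> * t powr (\<alpha> / \<beta>)) x"

definition Ymix :: "real^'n \<Rightarrow> real \<Rightarrow> real" where
  "Ymix x t = t powr (\<alpha> - 1) * gauss_mix Q \<Theta> (\<lambda>\<omega>. V \<omega> * t powr (\<alpha> / \<beta>)) x"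

lemma \<Theta>_meas[measurable]: "\<Theta> \<in> borel_measurable Q"
  using \<Theta>_int by auto

lemma powr_\<beta>:
  fixes \<xi> :: "real^'n"
  assumes "0 < t"
  shows "((norm \<xi>)\<^sup>2 * t powr (\<alpha> / \<beta>)) powr \<beta> = norm \<xi> powr (2 * \<beta>) * t powr \<alpha>"
proof -
  have "((norm \<xi>)\<^sup>2) powr \<beta> = norm \<xi> powr (2 * \<beta>)"
  proof (cases "\<xi> = 0")
    case False
    then have "(norm \<xi>)\<^sup>2 = norm \<xi> powr 2" by simp
    then show ?thesis by (simp only: powr_powr)
  qed simp
  then show ?thesis using assms \<beta> by (simp add: powr_mult powr_powr)
qed

lemma V_transform:
  fixes \<xi> :: "real^'n"
  assumes t: "0 < t"
  shows "(LINT \<omega>|Q. exp (- (norm \<xi>)\<^sup>2 * (V \<omega> * t powr (\<alpha> / \<beta>)))) = ml_kernel \<alpha> 1 (norm \<xi> powr (2 * \<beta>)) t"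
    and "t powr (\<alpha> - 1) * (LINT \<omega>|Q. \<Theta> \<omega> * exp (- (norm \<xi>)\<^sup>2 * (V \<omega> * t powr (\<alpha> / \<beta>)))) = ml_kernel \<alpha> \<alpha> (norm \<xi> powr (2 * \<beta>)) t"
proof -
  have e: "- (norm \<xi>)\<^sup>2 * (V \<omega> * t powr (\<alpha> / \<beta>)) = - ((norm \<xi>)\<^sup>2 * t powr (\<alpha> / \<beta>)) * V \<omega>" for \<omega>
    by simp
  show "(LINT \<omega>|Q. exp (- (norm \<xi>)\<^sup>2 * (V \<omega> * t powr (\<alpha> / \<beta>)))) = ml_kernel \<alpha> 1 (norm \<xi> powr (2 * \<beta>)) t"
    unfolding e by (subst V_laplace) (use t in \<open>auto simp: powr_\<beta>[OF t] ml_kernel_def\<close>)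
  show "t powr (\<alpha> - 1) * (LINT \<omega>|Q. \<Theta> \<omega> * exp (- (norm \<xi>)\<^sup>2 * (V \<omega> * t powr (\<alpha> / \<beta>)))) = ml_kernel \<alpha> \<alpha> (norm \<xi> powr (2 * \<beta>)) t"
    unfolding e by (subst \<Theta>_laplace) (use t in \<open>auto simp: powr_\<beta>[OF t] ml_kernel_def\<close>)
qed

text \<open>For every frequency the transform of \<open>Z\<close> solves the relaxation equation with rate
  \<open>|\<xi>|\<^sup>2\<^sup>\<beta>\<close>, so it is the transform of the mixture; continuity off the origin gives equality at each point.\<close>

lemma fundamental_solution_eq_Zmix:
  fixes Z :: "real^'n \<Rightarrow> real \<Rightarrow> real"
  assumes Z: "fundamental_solution \<alpha> \<beta> Z" and x: "x \<noteq> 0" and t: "0 < t"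
  shows "Z x t = Zmix x t"
  unfolding Zmix_def
proof (rule eq_gauss_mix)
  show "sigma_finite_measure Q" by unfold_locales
  show "integrable lborel (\<lambda>x. Z x t)" using Z t by (simp add: fundamental_solution_def)
  have cont: "continuous_on ((- {0}) \<times> {0<..}) (\<lambda>(x, t). Z x t)" using Z by (simp add: fundamental_solution_def)
  have "continuous_on (- {0}) (\<lambda>x. (\<lambda>(x, t). Z x t) (x, t))"
    by (rule continuous_on_compose2[OF cont]) (use t in \<open>auto intro!: continuous_intros\<close>)
  then show "isCont (\<lambda>x. Z x t) x"
    using x by (simp add: continuous_on_eq_continuous_at open_Compl)
  fix \<xi> :: "real^'n"
  define w where "w = (\<lambda>t. if t = 0 then 1 else fourier_transform (\<lambda>x. Z x t) \<xi>)"
  have w: "continuous_on {0..} w" "\<And>t. 0 < t \<Longrightarrow> has_caputo_derivative \<alpha> w (- ((norm \<xi> powr (2 * \<beta>)) *\<^sub>R w t)) t"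
    using Z unfolding fundamental_solution_def Let_def w_def by auto
  have "w t = of_real (ml_kernel \<alpha> 1 (norm \<xi> powr (2 * \<beta>)) t)"
    by (rule caputo_relaxation_unique[OF \<alpha> w(1) _ w(2) t]) (simp_all add: w_def)
  then show "fourier_transform (\<lambda>x. Z x t) \<xi> = of_real (LINT \<omega>|Q. 1 * exp (- (norm \<xi>)\<^sup>2 * (V \<omega> * t powr (\<alpha> / \<beta>))))"
    using t V_transform(1)[OF t, of \<xi>] by (simp add: w_def)
qed (use x t V_pos in auto)

lemma Ymix_bound:
  fixes x :: "real^'n"
  assumes x: "x \<noteq> 0"
  shows "\<exists>C. \<forall>t>0. \<bar>Ymix x t\<bar> \<le> C * t powr (\<alpha> - 1)"
proof -
  let ?C = "(1 + fact DIM(real^'n)) * (pi * (norm x)\<^sup>2) powr (- (real DIM(real^'n) / 2))"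
  have "\<bar>Ymix x t\<bar> \<le> (LINT \<omega>|Q. \<Theta> \<omega> * ?C) * t powr (\<alpha> - 1)" if t: "0 < t" for t
  proof -
    have "\<bar>gauss_mix Q \<Theta> (\<lambda>\<omega>. V \<omega> * t powr (\<alpha> / \<beta>)) x\<bar> \<le> (LINT \<omega>|Q. \<Theta> \<omega> * ?C)"
      unfolding gauss_mix_def
    proof (rule order_trans[OF integral_abs_bound integral_mono'])
      show "integrable Q (\<lambda>\<omega>. \<Theta> \<omega> * ?C)" using \<Theta>_int by simp
      fix \<omega>
      show "\<bar>\<Theta> \<omega> * heat_kernel (V \<omega> * t powr (\<alpha> / \<beta>)) x\<bar> \<le> \<Theta> \<omega> * ?C"
        using heat_kernel_bound[of "V \<omega> * t powr (\<alpha> / \<beta>)" "norm x" x] x t V_pos \<Theta>_pos[of \<omega>]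
        by (simp add: abs_mult heat_kernel_nonneg)
      show "0 \<le> \<Theta> \<omega> * ?C" using \<Theta>_pos[of \<omega>] by simp
    qed
    then show ?thesis unfolding Ymix_def by (simp add: abs_mult mult.commute mult_left_mono)
  qed
  then show ?thesis by blast
qed

text \<open>\<open>Y_kernel\<close> is a pointwise time derivative. Continuity of the candidate in time is what lets the
  fundamental theorem of calculus identify the two.\<close>

lemma Ymix_continuous:
  fixes x :: "real^'n"
  assumes x: "x \<noteq> 0"
  shows "continuous_on {0<..} (Ymix x)"
  unfolding Ymix_def[abs_def]
proof (intro continuous_on_mult)
  show "continuous_on {0<..} (\<lambda>t. t powr (\<alpha> - 1))" by (intro continuous_intros) auto
  let ?C = "(1 + fact DIM(real^'n)) * (pi * (norm x)\<^sup>2) powr (- (real DIM(real^'n) / 2))"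
  show "continuous_on {0<..} (\<lambda>t. gauss_mix Q \<Theta> (\<lambda>\<omega>. V \<omega> * t powr (\<alpha> / \<beta>)) x)"
    unfolding continuous_on_sequentially
  proof safe
    fix X :: "nat \<Rightarrow> real" and a assume a: "0 < a" and X: "\<forall>n. X n \<in> {0<..}" "X \<longlonglongrightarrow> a"
    show "((\<lambda>t. gauss_mix Q \<Theta> (\<lambda>\<omega>. V \<omega> * t powr (\<alpha> / \<beta>)) x) \<circ> X) \<longlonglongrightarrow> gauss_mix Q \<Theta> (\<lambda>\<omega>. V \<omega> * a powr (\<alpha> / \<beta>)) x"
      unfolding gauss_mix_def o_def
    proof (rule integral_dominated_convergence)
      show "integrable Q (\<lambda>\<omega>. \<Theta> \<omega> * ?C)" using \<Theta>_int by simp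
      show "(\<lambda>\<omega>. \<Theta> \<omega> * heat_kernel (V \<omega> * a powr (\<alpha> / \<beta>)) x) \<in> borel_measurable Q"
        "(\<lambda>\<omega>. \<Theta> \<omega> * heat_kernel (V \<omega> * X n powr (\<alpha> / \<beta>)) x) \<in> borel_measurable Q" for n
        unfolding heat_kernel_def by measurable
      have "V \<omega> * a powr (\<alpha> / \<beta>) \<noteq> 0" for \<omega> using V_pos[of \<omega>] a by simp
      then show "AE \<omega> in Q. (\<lambda>n. \<Theta> \<omega> * heat_kernel (V \<omega> * X n powr (\<alpha> / \<beta>)) x) \<longlonglongrightarrow> \<Theta> \<omega> * heat_kernel (V \<omega> * a powr (\<alpha> / \<beta>)) x"
        unfolding heat_kernel_def using a by (intro AE_I2 tendsto_intros X) auto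
      show "AE \<omega> in Q. norm (\<Theta> \<omega> * heat_kernel (V \<omega> * X n powr (\<alpha> / \<beta>)) x) \<le> \<Theta> \<omega> * ?C" for n
      proof (rule AE_I2)
        fix \<omega>
        have "0 < X n" using X by auto
        then show "norm (\<Theta> \<omega> * heat_kernel (V \<omega> * X n powr (\<alpha> / \<beta>)) x) \<le> \<Theta> \<omega> * ?C"
          using heat_kernel_bound[of "V \<omega> * X n powr (\<alpha> / \<beta>)" "norm x" x] x V_pos \<Theta>_pos[of \<omega>]
          by (simp add: abs_mult heat_kernel_nonneg)
      qed
    qed
  qed
qed

lemma Ymix_integrable:
  fixes x :: "real^'n"
  assumes x: "x \<noteq> 0" and T: "0 < T"
  shows "set_integrable lborel {0<..<T} (Ymix x)"
proof -
  obtain C where C: "\<And>t. 0 < t \<Longrightarrow> \<bar>Ymix x t\<bar> \<le> C * t powr (\<alpha> - 1)" using Ymix_bound[OF x] by blast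
  have "set_integrable lborel {0<..<T} (\<lambda>s. (T - s) powr (1 - 1) *\<^sub>R Ymix x s)"
    by (rule set_integrable_frac_kernel[of _ \<alpha> _ _ C])
      (use \<alpha> T C in \<open>auto intro: continuous_on_subset[OF Ymix_continuous[OF x]]\<close>)
  then show ?thesis
    by (rule set_integrable_cong[OF refl refl, THEN iffD1, rotated -1]) auto
qed

text \<open>Both sides are mixtures of heat kernels over pairs \<open>(s, \<omega>)\<close> with the same times and with weights
  \<open>c1\<close> and \<open>c2\<close>. The transform of either one is \<open>ml_kernel \<alpha> (1 + \<alpha>)\<close>: on the left as the integral of order
  \<open>\<alpha>\<close> of \<open>ml_kernel \<alpha> 1\<close>, on the right as the integral of order 1 of \<open>ml_kernel \<alpha> \<alpha>\<close>.\<close>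

lemma frac_integral_Zmix:
  fixes x :: "real^'n"
  assumes x: "x \<noteq> 0" and t: "0 < t"
  shows "frac_integral \<alpha> (Zmix x) t = (LBINT s:{0<..<t}. Ymix x s)"
proof -
  let ?M = "(lborel :: real measure) \<Otimes>\<^sub>M Q"
  interpret P: pair_sigma_finite "lborel :: real measure" Q ..
  have PM: "sigma_finite_measure ?M" by (rule P.P.sigma_finite_measure_axioms)
  define k1 where "k1 s = indicator {0<..<t} s * ((t - s) powr (\<alpha> - 1) / Gamma \<alpha>)" for s
  define k2 where "k2 s = indicator {0<..<t} s * s powr (\<alpha> - 1)" for s
  define c1 where "c1 = (\<lambda>(s, \<omega>::'w). k1 s * 1)"
  define c2 where "c2 = (\<lambda>(s, \<omega>). k2 s * \<Theta> \<omega>)"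
  define v where "v = (\<lambda>(s, \<omega>). if 0 < s then V \<omega> * s powr (\<alpha> / \<beta>) else 1)"
  have v0: "0 < v p" for p using V_pos by (auto simp: v_def split: prod.splits)
  have vm[measurable]: "v \<in> borel_measurable ?M" unfolding v_def by measurable
  have "integrable lborel (\<lambda>s. (1 / Gamma \<alpha>) * (indicator {0<..<t} s * ((t - s) powr (\<alpha> - 1) * (s - 0) powr (1 - 1))))"
    using has_bochner_integral_beta[of 1 \<alpha> 0 t] \<alpha> t by (simp add: has_bochner_integral_iff)
  then have k1i: "integrable lborel k1"
    by (rule Bochner_Integration.integrable_cong[THEN iffD1, rotated -1]) (auto simp: k1_def indicator_def)
  have "integrable lborel (\<lambda>s. (indicator {0<..<t} s * ((t - s) powr (1 - 1) * (s - 0) powr (\<alpha> - 1))))"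
    using has_bochner_integral_beta[of \<alpha> 1 0 t] \<alpha> t by (simp add: has_bochner_integral_iff)
  then have k2i: "integrable lborel k2"
    by (rule Bochner_Integration.integrable_cong[THEN iffD1, rotated -1]) (auto simp: k2_def indicator_def)
  have c1i: "integrable ?M c1" unfolding c1_def
    by (rule integrable_prod_mult) (use k1i in \<open>auto intro: sigma_finite_lborel sigma_finite_measure_axioms\<close>)
  have c2i: "integrable ?M c2" unfolding c2_def
    by (rule integrable_prod_mult) (use k2i \<Theta>_int in \<open>auto intro: sigma_finite_lborel sigma_finite_measure_axioms\<close>)
  define c where "c p = c1 p - c2 p" for p
  have ci: "integrable ?M c" unfolding c_def using c1i c2i by simp
  have mix1: "gauss_mix ?M c1 v x = frac_integral \<alpha> (Zmix x) t"
  proof -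
    have "gauss_mix ?M c1 v x = (LBINT s. LINT \<omega>|Q. c1 (s, \<omega>) * heat_kernel (v (s, \<omega>)) x)"
      unfolding gauss_mix_def by (rule P.integral_fst'[symmetric, OF gauss_mix_integrand[OF c1i vm v0 x]])
    also have "\<dots> = (LBINT s. (1 / Gamma \<alpha>) *\<^sub>R (indicator {0<..<t} s *\<^sub>R ((t - s) powr (\<alpha> - 1) *\<^sub>R Zmix x s)))"
      by (rule Bochner_Integration.integral_cong)
        (auto simp: c1_def k1_def v_def Zmix_def gauss_mix_def indicator_def)
    also have "\<dots> = frac_integral \<alpha> (Zmix x) t"
      unfolding frac_integral_def set_lebesgue_integral_def by (rule integral_scaleR_right)
    finally show ?thesis .
  qed
  have mix2: "gauss_mix ?M c2 v x = (LBINT s:{0<..<t}. Ymix x s)"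
  proof -
    have "gauss_mix ?M c2 v x = (LBINT s. LINT \<omega>|Q. c2 (s, \<omega>) * heat_kernel (v (s, \<omega>)) x)"
      unfolding gauss_mix_def by (rule P.integral_fst'[symmetric, OF gauss_mix_integrand[OF c2i vm v0 x]])
    also have "\<dots> = (LBINT s. indicator {0<..<t} s *\<^sub>R Ymix x s)"
      by (rule Bochner_Integration.integral_cong)
        (auto simp: c2_def k2_def v_def Ymix_def gauss_mix_def indicator_def mult.assoc)
    finally show ?thesis unfolding set_lebesgue_integral_def .
  qed
  have ei: "integrable ?M (\<lambda>p. d p * exp (- (norm \<xi>)\<^sup>2 * v p))" if d: "integrable ?M d" for d and \<xi> :: "real^'n"
  proof (rule Bochner_Integration.integrable_bound[OF d])
    have [measurable]: "d \<in> borel_measurable ?M" using d by auto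
    show "(\<lambda>p. d p * exp (- (norm \<xi>)\<^sup>2 * v p)) \<in> borel_measurable ?M" by measurable
    show "AE p in ?M. norm (d p * exp (- (norm \<xi>)\<^sup>2 * v p)) \<le> norm (d p)"
      using v0[THEN less_imp_le] by (intro AE_I2) (simp add: abs_mult mult_left_le)
  qed
  have tr: "(LINT p|?M. c p * exp (- (norm \<xi>)\<^sup>2 * v p)) = 0" for \<xi> :: "real^'n"
  proof -
    let ?a = "norm \<xi> powr (2 * \<beta>)"
    have "(LINT p|?M. c1 p * exp (- (norm \<xi>)\<^sup>2 * v p)) = (LBINT s. LINT \<omega>|Q. c1 (s, \<omega>) * exp (- (norm \<xi>)\<^sup>2 * v (s, \<omega>)))"
      by (rule P.integral_fst'[symmetric, OF ei[OF c1i]])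
    also have "\<dots> = (LBINT s. (1 / Gamma \<alpha>) *\<^sub>R (indicator {0<..<t} s *\<^sub>R ((t - s) powr (\<alpha> - 1) *\<^sub>R ml_kernel \<alpha> 1 ?a s)))"
      by (rule Bochner_Integration.integral_cong)
        (auto simp: c1_def k1_def v_def indicator_def V_transform(1)[symmetric])
    also have "\<dots> = frac_integral \<alpha> (ml_kernel \<alpha> 1 ?a) t"
      unfolding frac_integral_def set_lebesgue_integral_def by (rule integral_scaleR_right)
    also have "\<dots> = ml_kernel \<alpha> (1 + \<alpha>) ?a t"
      by (rule frac_integral_ml_kernel) (use \<alpha> t in auto)
    finally have 1: "(LINT p|?M. c1 p * exp (- (norm \<xi>)\<^sup>2 * v p)) = ml_kernel \<alpha> (1 + \<alpha>) ?a t" .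
    have "(LINT p|?M. c2 p * exp (- (norm \<xi>)\<^sup>2 * v p)) = (LBINT s. LINT \<omega>|Q. c2 (s, \<omega>) * exp (- (norm \<xi>)\<^sup>2 * v (s, \<omega>)))"
      by (rule P.integral_fst'[symmetric, OF ei[OF c2i]])
    also have "\<dots> = (LBINT s. indicator {0<..<t} s *\<^sub>R ml_kernel \<alpha> \<alpha> ?a s)"
      by (rule Bochner_Integration.integral_cong)
        (auto simp: c2_def k2_def v_def indicator_def V_transform(2)[symmetric] mult.assoc)
    also have "\<dots> = frac_integral 1 (ml_kernel \<alpha> \<alpha> ?a) t"
      unfolding frac_integral_1 set_lebesgue_integral_def ..
    also have "\<dots> = ml_kernel \<alpha> (\<alpha> + 1) ?a t"
      by (rule frac_integral_ml_kernel) (use \<alpha> t in auto)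
    finally have 2: "(LINT p|?M. c2 p * exp (- (norm \<xi>)\<^sup>2 * v p)) = ml_kernel \<alpha> (1 + \<alpha>) ?a t" by (simp add: add.commute)
    have "(LINT p|?M. c p * exp (- (norm \<xi>)\<^sup>2 * v p)) =
      (LINT p|?M. c1 p * exp (- (norm \<xi>)\<^sup>2 * v p)) - (LINT p|?M. c2 p * exp (- (norm \<xi>)\<^sup>2 * v p))"
      unfolding c_def left_diff_distrib by (rule Bochner_Integration.integral_diff[OF ei[OF c1i] ei[OF c2i]])
    then show ?thesis using 1 2 by simp
  qed
  have "gauss_mix ?M c v x = 0"
  proof (rule fourier_zero_imp_zero)
    show "integrable lborel (gauss_mix ?M c v :: real^'n \<Rightarrow> real)"
      by (rule gauss_mix_fourier[OF PM ci vm v0])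
    show "fourier_transform (gauss_mix ?M c v) \<xi> = 0" for \<xi> :: "real^'n"
      by (subst gauss_mix_fourier(2)[OF PM ci vm v0]) (simp only: tr of_real_0)
    show "isCont (gauss_mix ?M c v) x" by (rule gauss_mix_isCont[OF ci vm v0 x])
  qed
  moreover have "gauss_mix ?M c v x = gauss_mix ?M c1 v x - gauss_mix ?M c2 v x"
    unfolding gauss_mix_def c_def left_diff_distrib
    by (rule Bochner_Integration.integral_diff) (intro gauss_mix_integrand c1i c2i vm v0 x)+
  ultimately show ?thesis using mix1 mix2 by simp
qed

lemma Y_kernel_eq_Ymix:
  fixes Z :: "real^'n \<Rightarrow> real \<Rightarrow> real"
  assumes Z: "fundamental_solution \<alpha> \<beta> Z" and x: "x \<noteq> 0" and t: "0 < t"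
  shows "Y_kernel \<alpha> Z x t = Ymix x t"
proof -
  have d: "((\<lambda>t. LBINT s:{0<..<t}. Ymix x s) has_real_derivative Ymix x t) (at t)"
    by (rule has_derivative_LBINT_from_0[OF Ymix_continuous[OF x] Ymix_integrable[OF x] t])
  have eq: "(LBINT s:{0<..<T}. Ymix x s) = frac_integral \<alpha> (Z x) T" if "0 < T" for T
    using frac_integral_Zmix[OF x that] frac_integral_cong[of T "Z x" "Zmix x" \<alpha>]
      fundamental_solution_eq_Zmix[OF Z x] by simp
  have "(frac_integral \<alpha> (Z x) has_real_derivative Ymix x t) (at t)"
    by (rule has_field_derivative_transform_within_open[OF d, of "{0<..}"]) (use t eq in auto)
  then show ?thesis
    by (simp add: Y_kernel_def riemann_liouville_derivative_def DERIV_imp_deriv)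
qed

text \<open>By parabolic scaling the bound at time \<open>t\<close> reduces to the value of the mixture at time 1 and at
  a point of norm \<open>K = |e|\<close>, which is positive.\<close>

lemma mix_lower_bounds:
  fixes e :: "real^'n"
  assumes e: "e \<noteq> 0"
  shows "\<exists>c>0. \<forall>(x :: real^'n) t. 0 < t \<and> x \<noteq> 0 \<and> norm x \<le> norm e * t powr (\<alpha> / (2 * \<beta>)) \<longrightarrow>
     c * t powr (- (real CARD('n) * \<alpha> / (2 * \<beta>))) \<le> Zmix x t \<and>
     c * t powr (\<alpha> - 1 - real CARD('n) * \<alpha> / (2 * \<beta>)) \<le> Ymix x t"
proof -
  let ?N = "real CARD('n)"
  define cZ where "cZ = gauss_mix Q (\<lambda>_. 1) V e"
  define cY where "cY = gauss_mix Q \<Theta> V e"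
  have pos: "0 < gauss_mix Q c V e" if c: "integrable Q c" "\<And>\<omega>. 0 < c \<omega>" for c
  proof -
    have i: "integrable Q (\<lambda>\<omega>. c \<omega> * heat_kernel (V \<omega>) e)"
      by (rule gauss_mix_integrand) (use c V_pos e in auto)
    have p: "0 < c \<omega> * heat_kernel (V \<omega>) e" for \<omega> by (intro mult_pos_pos c(2) heat_kernel_pos V_pos)
    have "gauss_mix Q c V e \<noteq> 0"
    proof
      assume "gauss_mix Q c V e = 0"
      then have "AE \<omega> in Q. c \<omega> * heat_kernel (V \<omega>) e = 0"
        unfolding gauss_mix_def by (subst (asm) integral_nonneg_eq_0_iff_AE[OF i]) (use p in \<open>auto intro: less_imp_le\<close>)
      then have "AE \<omega> in Q. False" by eventually_elim (use p in \<open>metis less_irrefl\<close>)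
      then show False by simp
    qed
    moreover have "0 \<le> gauss_mix Q c V e"
      unfolding gauss_mix_def by (intro integral_nonneg_AE AE_I2 less_imp_le p)
    ultimately show ?thesis by simp
  qed
  have c0: "0 < cZ" "0 < cY" unfolding cZ_def cY_def using pos[of "\<lambda>_. 1"] pos[OF \<Theta>_int \<Theta>_pos] by auto
  have main: "t powr (- (?N * \<alpha> / (2 * \<beta>))) * gauss_mix Q c V e \<le> gauss_mix Q c (\<lambda>\<omega>. V \<omega> * t powr (\<alpha> / \<beta>)) x"
    if c: "integrable Q c" "\<And>\<omega>. 0 < c \<omega>" and t: "0 < t" and x: "x \<noteq> 0" "norm x \<le> norm e * t powr (\<alpha> / (2 * \<beta>))" for c t and x :: "real^'n"
  proof -
    have "t powr (\<alpha> / (2 * \<beta>)) = (t powr (\<alpha> / \<beta>)) powr (1/2)" using t by (simp add: powr_powr mult.commute)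
    also have "\<dots> = sqrt (t powr (\<alpha> / \<beta>))" by (rule powr_half_sqrt) simp
    finally have "(norm x)\<^sup>2 \<le> (norm e * sqrt (t powr (\<alpha> / \<beta>)))\<^sup>2"
      using x by (intro power_mono) auto
    then have x2: "(norm x)\<^sup>2 \<le> (norm e)\<^sup>2 * t powr (\<alpha> / \<beta>)" by (simp add: power_mult_distrib)
    have tp: "(t powr (\<alpha> / \<beta>)) powr (- (real DIM(real^'n) / 2)) = t powr (- (?N * \<alpha> / (2 * \<beta>)))"
      using t by (simp add: powr_powr mult.commute)
    have "t powr (- (?N * \<alpha> / (2 * \<beta>))) * gauss_mix Q c V e =
       (LINT \<omega>|Q. t powr (- (?N * \<alpha> / (2 * \<beta>))) * (c \<omega> * heat_kernel (V \<omega>) e))"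
      unfolding gauss_mix_def by simp
    also have "\<dots> \<le> (LINT \<omega>|Q. c \<omega> * heat_kernel (V \<omega> * t powr (\<alpha> / \<beta>)) x)"
    proof (rule integral_mono)
      show "integrable Q (\<lambda>\<omega>. t powr (- (?N * \<alpha> / (2 * \<beta>))) * (c \<omega> * heat_kernel (V \<omega>) e))"
        using gauss_mix_integrand[OF c(1) V_meas V_pos e] by simp
      show "integrable Q (\<lambda>\<omega>. c \<omega> * heat_kernel (V \<omega> * t powr (\<alpha> / \<beta>)) x)"
        by (rule gauss_mix_integrand) (use c t V_pos x in auto)
      fix \<omega>
      have "t powr (- (?N * \<alpha> / (2 * \<beta>))) * heat_kernel (V \<omega>) e \<le> heat_kernel (V \<omega> * t powr (\<alpha> / \<beta>)) x"
        using heat_kernel_parabolic_lower[OF V_pos _ x2] t unfolding tp by simp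
      then show "t powr (- (?N * \<alpha> / (2 * \<beta>))) * (c \<omega> * heat_kernel (V \<omega>) e) \<le> c \<omega> * heat_kernel (V \<omega> * t powr (\<alpha> / \<beta>)) x"
        using c(2)[of \<omega>] by (simp add: mult.left_commute)
    qed
    finally show ?thesis unfolding gauss_mix_def .
  qed
  show ?thesis
  proof (intro exI[of _ "min cZ cY"] conjI allI impI)
    show "0 < min cZ cY" using c0 by simp
    fix x :: "real^'n" and t :: real
    assume a: "0 < t \<and> x \<noteq> 0 \<and> norm x \<le> norm e * t powr (\<alpha> / (2 * \<beta>))"
    have "min cZ cY * t powr (- (?N * \<alpha> / (2 * \<beta>))) \<le> t powr (- (?N * \<alpha> / (2 * \<beta>))) * cZ"
      by (subst mult.commute) (intro mult_left_mono, auto)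
    also have "\<dots> \<le> Zmix x t"
      unfolding cZ_def Zmix_def by (rule main) (use a in auto)
    finally show "min cZ cY * t powr (- (?N * \<alpha> / (2 * \<beta>))) \<le> Zmix x t" .
    have "t powr (\<alpha> - 1 - ?N * \<alpha> / (2 * \<beta>)) = t powr (\<alpha> - 1) * t powr (- (?N * \<alpha> / (2 * \<beta>)))"
      by (subst powr_add[symmetric]) simp
    then have "t powr (\<alpha> - 1) * (t powr (- (?N * \<alpha> / (2 * \<beta>))) * cY) = t powr (\<alpha> - 1 - ?N * \<alpha> / (2 * \<beta>)) * cY"
      by simp
    then have "min cZ cY * t powr (\<alpha> - 1 - ?N * \<alpha> / (2 * \<beta>)) \<le> t powr (\<alpha> - 1) * (t powr (- (?N * \<alpha> / (2 * \<beta>))) * cY)"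
      by (simp only:) (subst mult.commute, intro mult_left_mono, auto)
    also have "\<dots> \<le> Ymix x t"
      unfolding cY_def Ymix_def by (intro mult_left_mono main) (use a \<Theta>_int \<Theta>_pos in auto)
    finally show "min cZ cY * t powr (\<alpha> - 1 - ?N * \<alpha> / (2 * \<beta>)) \<le> Ymix x t" .
  qed
qed

lemma mix_nonneg: "0 \<le> Zmix x t" "0 \<le> Ymix x t"
  unfolding Zmix_def Ymix_def gauss_mix_def
  by (auto intro!: mult_nonneg_nonneg integral_nonneg_AE AE_I2 heat_kernel_nonneg less_imp_le[OF \<Theta>_pos])

end

text \<open>All that the blow-up argument has to know about the kernels. The constant does not depend on the
  fundamental solution.\<close>

theorem fundamental_solution_lower_bounds:
  fixes \<alpha> \<beta> K :: real
  assumes \<alpha>: "0 < \<alpha>" "\<alpha> < 1" and \<beta>: "0 < \<beta>" "\<beta> \<le> 1" and K: "0 < K"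
  shows "\<exists>c>0. \<forall>(Z :: real ^ 'n::finite \<Rightarrow> real \<Rightarrow> real) x t.
     fundamental_solution \<alpha> \<beta> Z \<and> x \<noteq> 0 \<and> 0 < t \<longrightarrow>
       0 \<le> Z x t \<and> 0 \<le> Y_kernel \<alpha> Z x t \<and>
       (norm x \<le> K * t powr (\<alpha> / (2 * \<beta>)) \<longrightarrow>
          c * t powr (- (real CARD('n) * \<alpha> / (2 * \<beta>))) \<le> Z x t \<and>
          c * t powr (\<alpha> - 1 - real CARD('n) * \<alpha> / (2 * \<beta>)) \<le> Y_kernel \<alpha> Z x t)"
proof -
  obtain Q :: "(real \<times> real) measure" and V \<Theta> where "prob_space Q" "V \<in> borel_measurable Q" "integrable Q \<Theta>"
     "\<And>\<omega>. 0 < V \<omega>" "\<And>\<omega>. 0 < \<Theta> \<omega>"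
     "\<And>z. 0 \<le> z \<Longrightarrow> (LINT \<omega>|Q. exp (- z * V \<omega>)) = mittag_leffler \<alpha> 1 (- (z powr \<beta>))"
     "\<And>z. 0 \<le> z \<Longrightarrow> (LINT \<omega>|Q. \<Theta> \<omega> * exp (- z * V \<omega>)) = mittag_leffler \<alpha> \<alpha> (- (z powr \<beta>))"
    using subordination_variables[OF \<alpha> \<beta>] by blast
  then interpret subordination Q \<alpha> \<beta> V \<Theta>
    unfolding subordination_def subordination_axioms_def using \<alpha> \<beta> by blast
  obtain e :: "real^'n" where e: "norm e = K" using vector_choose_size[of K] K by auto
  obtain c where c: "0 < c" "\<And>(x::real^'n) t. 0 < t \<and> x \<noteq> 0 \<and> norm x \<le> norm e * t powr (\<alpha> / (2 * \<beta>)) \<Longrightarrow>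
     c * t powr (- (real CARD('n) * \<alpha> / (2 * \<beta>))) \<le> Zmix x t \<and>
     c * t powr (\<alpha> - 1 - real CARD('n) * \<alpha> / (2 * \<beta>)) \<le> Ymix x t"
    using mix_lower_bounds[of e] e K by fastforce
  show ?thesis
    using c e mix_nonneg by (intro exI[of _ c]) (auto simp: fundamental_solution_eq_Zmix Y_kernel_eq_Ymix)
qed

section \<open>Lebesgue norms and convolutions\<close>

text \<open>Uniformly in \<open>q\<close>, an \<open>L\<^sup>q\<close> function is bounded up to an integrable error: for finite \<open>q\<close> because
  \<open>|f| \<le> 1 + |f|\<^sup>q\<close>.\<close>

lemma in_Lq_dominated:
  fixes f :: "real^'n \<Rightarrow> real"
  assumes q: "1 \<le> q" and f: "f \<in> borel_measurable borel" and fin: "Lq_norm q f < \<infinity>"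
  shows "\<exists>M g. 0 \<le> M \<and> (\<forall>x. 0 \<le> g x) \<and> integrable lborel g \<and> (AE x in lborel. \<bar>f x\<bar> \<le> M + g x)"
proof (cases "q = \<infinity>")
  case True
  note [measurable] = f
  define M where "M = enn2real (esssup lborel (\<lambda>x. ennreal \<bar>f x\<bar>))"
  have e: "ennreal M = esssup lborel (\<lambda>x. ennreal \<bar>f x\<bar>)"
    using fin True by (simp add: M_def Lq_norm_def)
  have "AE x in lborel. ennreal \<bar>f x\<bar> \<le> ennreal M" unfolding e by (rule esssup_AE)
  then have "AE x in lborel. \<bar>f x\<bar> \<le> M + 0" by eventually_elim (simp add: M_def)
  then show ?thesis by (intro exI[of _ M] exI[of _ "\<lambda>_. 0"]) (auto simp: M_def)
next
  case False
  note [measurable] = f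
  obtain r where r: "q = ereal r" "1 \<le> r" using q False by (cases q) auto
  define g where "g x = \<bar>f x\<bar> powr r" for x
  have [measurable]: "g \<in> borel_measurable borel" unfolding g_def by measurable
  have "(\<integral>\<^sup>+ x. ennreal (g x) \<partial>lborel) \<noteq> \<infinity>"
    using fin False r unfolding Lq_norm_def g_def by (auto simp: Let_def split: if_splits)
  then have "integrable lborel g"
    by (intro integrableI_nonneg) (auto simp: g_def less_top)
  moreover have "\<bar>f x\<bar> \<le> 1 + g x" for x
  proof (cases "\<bar>f x\<bar> \<le> 1")
    case False
    then have "\<bar>f x\<bar> powr 1 \<le> \<bar>f x\<bar> powr r" using r by (intro powr_mono) auto
    then show ?thesis using False by (simp add: g_def)
  qed (simp add: g_def add_increasing2)
  ultimately show ?thesis by (intro exI[of _ 1] exI[of _ g]) (auto simp: g_def)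
qed

lemma Lq_norm_mono:
  fixes f g :: "real^'n \<Rightarrow> real"
  assumes q: "1 \<le> q" and f: "f \<in> borel_measurable borel" and le: "AE x in lborel. \<bar>f x\<bar> \<le> \<bar>g x\<bar>"
  shows "Lq_norm q f \<le> Lq_norm q g"
proof (cases "q = \<infinity>")
  case True
  note [measurable] = f
  have "AE x in lborel. ennreal \<bar>f x\<bar> \<le> ennreal \<bar>g x\<bar>" using le by eventually_elim (rule ennreal_leI)
  then show ?thesis using True unfolding Lq_norm_def by (auto intro!: esssup_AE_mono)
next
  case False
  obtain r where r: "q = ereal r" "1 \<le> r" using q False by (cases q) auto
  let ?I = "\<lambda>h. \<integral>\<^sup>+ x. ennreal (\<bar>h x\<bar> powr r) \<partial>lborel"
  have I: "?I f \<le> ?I g"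
    by (rule nn_integral_mono_AE) (use le r in \<open>auto elim!: eventually_mono intro!: ennreal_leI powr_mono2\<close>)
  show ?thesis
  proof (cases "?I g = \<infinity>")
    case True
    then show ?thesis using False r by (simp add: Lq_norm_def)
  next
    case fin: False
    then have "?I f \<noteq> \<infinity>" using I by (auto simp: top_unique)
    moreover have "enn2real (?I f) \<le> enn2real (?I g)"
      using I fin by (intro enn2real_mono) (auto simp: less_top)
    ultimately show ?thesis
      using False fin r by (simp add: Lq_norm_def powr_mono2 ennreal_leI)
  qed
qed

lemma Lq_norm_eq_0D:
  fixes f :: "real^'n \<Rightarrow> real"
  assumes q: "1 \<le> q" and f: "f \<in> borel_measurable borel" and 0: "Lq_norm q f = 0"
  shows "AE x in lborel. f x = 0"
proof (cases "q = \<infinity>")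
  case True
  note [measurable] = f
  have "AE x in lborel. ennreal \<bar>f x\<bar> \<le> esssup lborel (\<lambda>x. ennreal \<bar>f x\<bar>)" by (rule esssup_AE)
  moreover have "esssup lborel (\<lambda>x. ennreal \<bar>f x\<bar>) = 0" using 0 True by (simp add: Lq_norm_def)
  ultimately show ?thesis by (auto elim!: eventually_mono)
next
  case False
  note [measurable] = f
  obtain r where r: "q = ereal r" "1 \<le> r" using q False by (cases q) auto
  let ?I = "\<integral>\<^sup>+ x. ennreal (\<bar>f x\<bar> powr r) \<partial>lborel"
  have "?I \<noteq> \<infinity>" and "enn2real ?I powr (1 / r) = 0"
    using 0 False r by (auto simp: Lq_norm_def Let_def split: if_splits)
  then have "?I = 0" by (simp add: enn2real_eq_0_iff)
  then have "AE x in lborel. ennreal (\<bar>f x\<bar> powr r) = 0" by (subst (asm) nn_integral_0_iff_AE) auto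
  then show ?thesis by eventually_elim simp
qed

text \<open>Needed so that a limit along this filter carries information.\<close>

lemma ess_at_right_neq_bot: "ess_at_right a \<noteq> bot"
proof
  assume "ess_at_right a = bot"
  then have "eventually (\<lambda>_. False) (ess_at_right a)" by simp
  then obtain P Q where P: "eventually P (at_right a)" and Q: "eventually Q (ae_filter lborel)"
    and PQ: "\<And>x. P x \<Longrightarrow> Q x \<Longrightarrow> False"
    unfolding ess_at_right_def eventually_inf by blast
  obtain b where b: "a < b" "\<And>x. a < x \<Longrightarrow> x < b \<Longrightarrow> P x"
    using P unfolding eventually_at_right_field by auto
  have "AE x in lborel. x \<notin> {a<..<b}" using Q by eventually_elim (use b PQ in auto)
  then have "emeasure lborel {x. \<not> x \<notin> {a<..<b}} = 0" by (subst (asm) AE_iff_measurable[OF _ refl]) auto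
  then have "emeasure lborel {a<..<b} = 0" by (simp only: not_not Collect_mem_eq)
  then show False using b by simp
qed

lemma AE_imp_eventually_ess_at_right:
  assumes "AE t in lborel. P t"
  shows "eventually P (ess_at_right a)"
  unfolding ess_at_right_def using assms filter_leD[OF inf_le2] by blast

text \<open>The negative part of \<open>u0\<close> is dominated by \<open>|u t - u0|\<close> whenever \<open>u t\<close> is nonnegative, so its norm is 0.\<close>

lemma initial_datum_nonneg:
  fixes u0 :: "real^'n \<Rightarrow> real"
  assumes q: "1 \<le> q" and u0: "u0 \<in> borel_measurable borel"
    and nn: "AE t in lborel. 0 < t \<longrightarrow> (AE x in lborel. 0 \<le> u x t)"
    and lim: "((\<lambda>t. Lq_norm q (\<lambda>x. u x t - u0 x)) \<longlongrightarrow> 0) (ess_at_right 0)"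
  shows "AE x in lborel. 0 \<le> u0 x"
proof -
  note [measurable] = u0
  let ?m = "\<lambda>x. min (u0 x) 0"
  have m: "?m \<in> borel_measurable borel" by measurable
  have "eventually (\<lambda>t::real. 0 < t) (at_right 0)" by (rule eventually_at_right_less)
  then have "eventually (\<lambda>t::real. 0 < t) (ess_at_right 0)"
    unfolding ess_at_right_def using filter_leD[OF inf_le1] by blast
  with AE_imp_eventually_ess_at_right[OF nn, of 0]
  have "eventually (\<lambda>t. Lq_norm q ?m \<le> Lq_norm q (\<lambda>x. u x t - u0 x)) (ess_at_right 0)"
  proof eventually_elim
    case (elim t)
    then have "AE x in lborel. 0 \<le> u x t" by simp
    then show ?case
      by (intro Lq_norm_mono q m) (auto elim!: eventually_mono)
  qed
  then have "Lq_norm q ?m \<le> 0"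
    by (rule tendsto_lowerbound[OF lim]) (rule ess_at_right_neq_bot)
  then have "AE x in lborel. min (u0 x) 0 = 0" by (intro Lq_norm_eq_0D[OF q m]) simp
  then show ?thesis by eventually_elim (simp add: min_def split: if_splits)
qed

lemma lborel_distr_reflect:
  fixes x :: "'a::euclidean_space"
  shows "distr lborel borel (\<lambda>y. x - y) = lborel"
  by (subst lborel_affine[of "-1" x]) (auto simp: density_1)

text \<open>After splitting \<open>f\<close> into a bounded and an integrable part, Tonelli's theorem suffices.\<close>

lemma convolution_integrable_AE:
  fixes f k :: "real^'n \<Rightarrow> real"
  assumes q: "1 \<le> q" and f: "in_Lq q f" and k: "integrable lborel k"
  shows "AE x in lborel. integrable lborel (\<lambda>y. f y * k (x - y))"
proof -
  have fm[measurable]: "f \<in> borel_measurable borel" using f by (simp add: in_Lq_def)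
  have km[measurable]: "k \<in> borel_measurable borel" using k by auto
  obtain M g where M: "0 \<le> M" and g0: "\<And>x. 0 \<le> g x" and g: "integrable lborel g"
    and b: "AE x in lborel. \<bar>f x\<bar> \<le> M + g x"
    using in_Lq_dominated[OF q fm] f unfolding in_Lq_def by blast
  have gm[measurable]: "g \<in> borel_measurable borel" using g by auto
  have kx: "integrable lborel (\<lambda>y. k (x - y))" for x
  proof -
    have "integrable (distr lborel borel (\<lambda>y. x - y)) k" using k by (simp add: lborel_distr_reflect)
    then show ?thesis by (subst (asm) integrable_distr_eq) auto
  qed
  have kt: "(\<integral>\<^sup>+ x. ennreal \<bar>k (x - y)\<bar> \<partial>lborel) = (\<integral>\<^sup>+ x. ennreal \<bar>k x\<bar> \<partial>lborel)" for y
  proof -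
    have "(\<integral>\<^sup>+ x. ennreal \<bar>k x\<bar> \<partial>lborel) = (\<integral>\<^sup>+ x. ennreal \<bar>k x\<bar> \<partial>distr lborel borel ((+) (- y)))"
      by (simp add: lborel_distr_plus)
    also have "\<dots> = (\<integral>\<^sup>+ x. ennreal \<bar>k (x - y)\<bar> \<partial>lborel)"
      by (subst nn_integral_distr) auto
    finally show ?thesis by simp
  qed
  have "(\<integral>\<^sup>+ x. (\<integral>\<^sup>+ y. ennreal (g y) * ennreal \<bar>k (x - y)\<bar> \<partial>lborel) \<partial>lborel) =
      (\<integral>\<^sup>+ y. (\<integral>\<^sup>+ x. ennreal (g y) * ennreal \<bar>k (x - y)\<bar> \<partial>lborel) \<partial>lborel)"
    by (rule lborel_pair.Fubini') measurable
  also have "\<dots> = (\<integral>\<^sup>+ y. ennreal (g y) \<partial>lborel) * (\<integral>\<^sup>+ x. ennreal \<bar>k x\<bar> \<partial>lborel)"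
    by (simp add: nn_integral_cmult kt nn_integral_multc)
  also have "\<dots> < \<infinity>"
  proof -
    have "(\<integral>\<^sup>+ y. ennreal (g y) \<partial>lborel) < \<infinity>"
      using g g0 by (simp add: integrable_iff_bounded)
    moreover have "(\<integral>\<^sup>+ y. ennreal \<bar>k y\<bar> \<partial>lborel) < \<infinity>"
      using k by (simp add: integrable_iff_bounded)
    ultimately show ?thesis by (simp add: ennreal_mult_less_top)
  qed
  finally have "AE x in lborel. (\<integral>\<^sup>+ y. ennreal (g y) * ennreal \<bar>k (x - y)\<bar> \<partial>lborel) \<noteq> \<infinity>"
    by (intro nn_integral_PInf_AE) auto
  then show ?thesis
  proof eventually_elim
    case (elim x)
    have "integrable lborel (\<lambda>y. g y * k (x - y))"
      unfolding integrable_iff_bounded using elim g0 by (auto simp: abs_mult ennreal_mult' less_top)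
    then have "integrable lborel (\<lambda>y. M * k (x - y) + g y * k (x - y))" using kx[of x] by simp
    then show ?case
    proof (rule Bochner_Integration.integrable_bound)
      show "AE y in lborel. norm (f y * k (x - y)) \<le> norm (M * k (x - y) + g y * k (x - y))"
        using b
      proof eventually_elim
        case (elim y)
        then have "\<bar>f y\<bar> * \<bar>k (x - y)\<bar> \<le> \<bar>M + g y\<bar> * \<bar>k (x - y)\<bar>" by (intro mult_right_mono) auto
        then show ?case by (simp add: abs_mult flip: distrib_right)
      qed
    qed measurable
  qed
qed

section \<open>Blow-up\<close>

text \<open>Jensen's inequality for the power function on a set of measure \<open>b\<close>, from the tangent at the mean
  value \<open>a / b\<close>.\<close>

lemma nn_integral_powr_ge:
  assumes p: "1 < p" and f[measurable]: "f \<in> borel_measurable M" and f0: "\<And>x. 0 \<le> f x"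
    and B: "B \<in> sets M" "emeasure M B = ennreal b" "0 < b"
    and a: "0 \<le> a" "ennreal a \<le> (\<integral>\<^sup>+ x. ennreal (f x) * indicator B x \<partial>M)"
  shows "ennreal (a powr p * b powr (1 - p)) \<le> (\<integral>\<^sup>+ x. ennreal (f x powr p) * indicator B x \<partial>M)"
proof (cases "a = 0")
  case True
  then show ?thesis by simp
next
  case False
  note [measurable] = B(1)
  define e where "e = a / b"
  have e: "0 < e" using False a B by (simp add: e_def)
  have tang: "p * e powr (p - 1) * x \<le> x powr p + (p - 1) * e powr p" if x: "0 \<le> x" for x
  proof (cases "x = 0")
    case True
    then show ?thesis using p by simp
  next
    case False
    have cv: "convex_on {0<..} (\<lambda>x. x powr p)"
      by (rule powr_convex) (use p in simp)
    have d: "((\<lambda>x. x powr p) has_real_derivative (p * e powr (p - 1))) (at e within {0<..})"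
      using e by (auto intro!: derivative_eq_intros)
    have "p * e powr (p - 1) * (x - e) \<le> x powr p - e powr p"
      by (rule convex_on_imp_above_tangent[OF cv _ _ _ d]) (use e x False in \<open>auto simp: interior_open\<close>)
    moreover have "e powr (p - 1) * e = e powr p" using e powr_add[of e "p - 1" 1] by simp
    then have "p * e powr (p - 1) * (x - e) = p * e powr (p - 1) * x - p * e powr p"
      by (simp only: right_diff_distrib mult.assoc)
    ultimately show ?thesis by (simp only: left_diff_distrib mult_1)
  qed
  let ?L = "\<integral>\<^sup>+ x. ennreal (f x powr p) * indicator B x \<partial>M"
  have "ennreal (p * e powr (p - 1) * a) = ennreal (p * e powr (p - 1)) * ennreal a"
    using p by (intro ennreal_mult') auto
  also have "\<dots> \<le> ennreal (p * e powr (p - 1)) * (\<integral>\<^sup>+ x. ennreal (f x) * indicator B x \<partial>M)"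
    by (rule mult_left_mono) (use a in auto)
  also have "\<dots> = (\<integral>\<^sup>+ x. ennreal (p * e powr (p - 1)) * (ennreal (f x) * indicator B x) \<partial>M)"
    by (rule nn_integral_cmult[symmetric]) measurable
  also have "\<dots> \<le> (\<integral>\<^sup>+ x. ennreal (f x powr p) * indicator B x + ennreal ((p - 1) * e powr p) * indicator B x \<partial>M)"
  proof (rule nn_integral_mono)
    fix x
    have "ennreal (p * e powr (p - 1)) * ennreal (f x) \<le> ennreal (f x powr p) + ennreal ((p - 1) * e powr p)"
      using tang[OF f0[of x]] p f0[of x] by (simp flip: ennreal_mult' ennreal_plus)
    then show "ennreal (p * e powr (p - 1)) * (ennreal (f x) * indicator B x) \<le> ennreal (f x powr p) * indicator B x + ennreal ((p - 1) * e powr p) * indicator B x"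
      by (simp add: indicator_def)
  qed
  also have "\<dots> = ?L + ennreal ((p - 1) * e powr p) * ennreal b"
    by (subst nn_integral_add) (auto simp: nn_integral_cmult_indicator B)
  also have "ennreal ((p - 1) * e powr p) * ennreal b = ennreal ((p - 1) * (e powr p * b))"
    using p B(3) by (simp add: mult.assoc flip: ennreal_mult')
  finally have le: "ennreal (p * e powr (p - 1) * a) \<le> ?L + ennreal ((p - 1) * (e powr p * b))" .
  have eb: "e powr p * b = a powr p * b powr (1 - p)"
    using B(3) a by (simp add: e_def powr_divide powr_diff)
  have ea: "e powr (p - 1) * a = a powr p * b powr (1 - p)"
  proof -
    have "e powr (p - 1) * e = e powr p" using e powr_add[of e "p - 1" 1] by simp
    then have "e powr (p - 1) * a = e powr p * b" using B(3) by (simp add: e_def field_simps)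
    then show ?thesis using eb by simp
  qed
  show ?thesis
  proof (cases ?L)
    case (real l)
    then have "p * e powr (p - 1) * a \<le> l + (p - 1) * (e powr p * b)"
      using le p B(3) a by (simp flip: ennreal_plus)
    then have "a powr p * b powr (1 - p) \<le> l" unfolding eb mult.assoc ea by (simp add: algebra_simps)
    then show ?thesis using real by (simp add: ennreal_leI)
  qed simp
qed

text \<open>On the increasing times \<open>\<tau> k = R/2 - (R/4) 2\<^sup>-\<^sup>k\<close> one obtains \<open>F \<ge> a k\<close> after \<open>\<tau> k\<close>, by integrating the
  previous bound over \<open>(\<tau> k, \<tau> (k + 1))\<close>. The interval shrinks by the factor \<open>2\<^sup>-\<^sup>k\<close>, and \<open>a k = A l\<^sup>k\<close> with
  \<open>l\<^sup>p\<^sup>-\<^sup>1 = 2\<close> makes the gain \<open>(a k)\<^sup>p\<^sup>-\<^sup>1\<close> compensate exactly for that. So \<open>F\<close> exceeds every bound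
  after \<open>R/2\<close>.\<close>

lemma blowup_iteration:
  fixes F H :: "real \<Rightarrow> ennreal"
  assumes R: "0 < R" and A: "0 < A" and k0: "0 < k0" and b: "0 < b" and p: "1 < p"
    and H[measurable]: "H \<in> borel_measurable borel"
    and J: "\<And>s a. 0 \<le> a \<Longrightarrow> ennreal a \<le> F s \<Longrightarrow> ennreal (a powr p * b powr (1 - p)) \<le> H s"
    and F1: "AE t in lborel. R / 4 < t \<and> t < R \<longrightarrow> ennreal A \<le> F t"
    and F2: "AE t in lborel. 0 < t \<and> t < R \<longrightarrow> (\<integral>\<^sup>+ s. ennreal k0 * H s * indicator {0<..<t} s \<partial>lborel) \<le> F t"
    and big: "8 * 2 powr (1 / (p - 1)) \<le> k0 * b powr (1 - p) * R * A powr (p - 1)"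
  shows "AE t in lborel. R / 2 < t \<and> t < R \<longrightarrow> F t = \<infinity>"
proof -
  define l where "l = (2::real) powr (1 / (p - 1))"
  have l: "1 < l" unfolding l_def using p by (simp add: gr_one_powr)
  have lp: "l powr (p - 1) = 2" unfolding l_def using p by (simp add: powr_powr)
  define \<tau> where "\<tau> k = R / 2 - (R / 4) * (1/2) ^ k" for k :: nat
  have \<tau>: "R / 4 \<le> \<tau> k" "\<tau> k < R / 2" "\<tau> (Suc k) - \<tau> k = R / 8 * (1/2) ^ k" for k
    using R power_le_one[of "1/2::real" k] by (auto simp: \<tau>_def field_simps)
  define a where "a k = A * l ^ k" for k :: nat
  have a0: "0 < a k" for k using A l by (simp add: a_def)
  have step: "a (Suc k) \<le> k0 * (a k powr p * b powr (1 - p)) * (\<tau> (Suc k) - \<tau> k)" for k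
  proof -
    have pl: "(l ^ k) powr (p - 1) = 2 ^ k"
    proof -
      have "(l ^ k) powr (p - 1) = (l powr (p - 1)) ^ k"
        using l by (simp add: powr_powr mult.commute flip: powr_realpow)
      then show ?thesis by (simp add: lp)
    qed
    have "a k powr p = a k powr (p - 1) * a k"
      using a0[of k] powr_add[of "a k" "p - 1" 1] by simp
    also have "a k powr (p - 1) = A powr (p - 1) * 2 ^ k"
      using A l by (simp add: a_def powr_mult pl)
    finally have ap: "a k powr p = A powr (p - 1) * 2 ^ k * a k" .
    have "k0 * (a k powr p * b powr (1 - p)) * (\<tau> (Suc k) - \<tau> k) =
        (k0 * b powr (1 - p) * R * A powr (p - 1)) / 8 * a k * (2 ^ k * (1/2) ^ k)"
      unfolding ap \<tau>(3) by simp
    also have "(2::real) ^ k * (1/2) ^ k = 1" by (simp flip: power_mult_distrib)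
    finally have "k0 * (a k powr p * b powr (1 - p)) * (\<tau> (Suc k) - \<tau> k) = (k0 * b powr (1 - p) * R * A powr (p - 1)) / 8 * a k" by simp
    moreover have "l * a k \<le> (k0 * b powr (1 - p) * R * A powr (p - 1)) / 8 * a k"
      using big a0[of k] by (intro mult_right_mono) (auto simp: l_def)
    moreover have "a (Suc k) = l * a k" by (simp add: a_def)
    ultimately show ?thesis by linarith
  qed
  have ind: "AE t in lborel. \<tau> k < t \<and> t < R \<longrightarrow> ennreal (a k) \<le> F t" for k
  proof (induction k)
    case 0
    have "\<tau> 0 = R / 4" by (simp add: \<tau>_def)
    then show ?case using F1 by (simp only: a_def power_0 mult_1_right)
  next
    case (Suc k)
    show ?case
      using F2
    proof eventually_elim
      case (elim t)
      show ?case
      proof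
        assume t: "\<tau> (Suc k) < t \<and> t < R"
        have lt: "\<tau> k < \<tau> (Suc k)" using \<tau>(3)[of k] R by (smt (verit) divide_pos_pos mult_pos_pos zero_less_power)
        let ?h = "a k powr p * b powr (1 - p)"
        have "ennreal (a (Suc k)) \<le> ennreal (k0 * ?h * (\<tau> (Suc k) - \<tau> k))"
          by (rule ennreal_leI) (rule step)
        also have "\<dots> = (\<integral>\<^sup>+ s. ennreal (k0 * ?h) * indicator {\<tau> k<..<\<tau> (Suc k)} s \<partial>lborel)"
          using lt k0 by (subst nn_integral_cmult_indicator) (auto simp flip: ennreal_mult')
        also have "\<dots> \<le> (\<integral>\<^sup>+ s. ennreal k0 * H s * indicator {0<..<t} s \<partial>lborel)"
        proof (rule nn_integral_mono_AE)
          show "AE s in lborel. ennreal (k0 * ?h) * indicator {\<tau> k<..<\<tau> (Suc k)} s \<le> ennreal k0 * H s * indicator {0<..<t} s"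
            using Suc
          proof eventually_elim
            case (elim s)
            show ?case
            proof (cases "s \<in> {\<tau> k<..<\<tau> (Suc k)}")
              case True
              then have s: "\<tau> k < s" "s < R" "s \<in> {0<..<t}" using t \<tau>(1)[of k] R by auto
              then have "ennreal ?h \<le> H s" using elim a0[of k] by (intro J) auto
              then have "ennreal k0 * ennreal ?h \<le> ennreal k0 * H s" by (intro mult_left_mono) auto
              then show ?thesis using True s k0 by (simp add: ennreal_mult')
            qed simp
          qed
        qed
        also have "\<dots> \<le> F t" using elim t \<tau>(1)[of "Suc k"] R by auto
        finally show "ennreal (a (Suc k)) \<le> F t" .
      qed
    qed
  qed
  have "AE t in lborel. \<forall>k. \<tau> k < t \<and> t < R \<longrightarrow> ennreal (a k) \<le> F t"
    unfolding AE_all_countable using ind by blast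
  then show ?thesis
  proof eventually_elim
    case (elim t)
    show ?case
    proof
      assume t: "R / 2 < t \<and> t < R"
      have ge: "ennreal (a k) \<le> F t" for k using elim t \<tau>(2)[of k] by (meson less_trans)
      show "F t = \<infinity>"
      proof (cases "F t")
        case (real x)
        then have "a k \<le> x" for k using ge[of k] by simp
        moreover obtain k where "x / A < l ^ k" using real_arch_pow[OF l] by blast
        ultimately show ?thesis using A by (metis a_def divide_less_eq mult.commute not_less)
      qed simp
    qed
  qed
qed

text \<open>Near the boundary of the large ball the small ball is pushed towards the centre.\<close>

lemma ball_inter_large:
  fixes y :: "'a::euclidean_space"
  assumes y: "norm y < \<rho>" and \<sigma>: "0 < \<sigma>" "\<sigma> \<le> \<rho>"
  shows "\<exists>z. ball z (\<sigma> / 2) \<subseteq> ball 0 \<rho> \<inter> cball y \<sigma>"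
proof (cases "norm y \<le> \<sigma> / 2")
  case True
  have "ball y (\<sigma> / 2) \<subseteq> ball 0 \<rho> \<inter> cball y \<sigma>"
  proof
    fix x assume "x \<in> ball y (\<sigma> / 2)"
    then have "dist y x < \<sigma> / 2" by simp
    moreover have "norm x \<le> norm y + dist y x" by (metis dist_commute dist_norm norm_triangle_sub)
    ultimately show "x \<in> ball 0 \<rho> \<inter> cball y \<sigma>" using True \<sigma> by simp
  qed
  then show ?thesis by blast
next
  case False
  define z where "z = (1 - \<sigma> / (2 * norm y)) *\<^sub>R y"
  have ny: "0 < norm y" using False \<sigma> by linarith
  have yz: "y - z = (\<sigma> / (2 * norm y)) *\<^sub>R y" by (simp add: z_def algebra_simps)
  have "dist y z = \<sigma> / 2" unfolding dist_norm yz using ny \<sigma> by simp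
  have "norm z = \<bar>1 - \<sigma> / (2 * norm y)\<bar> * norm y" by (simp add: z_def)
  also have "\<bar>1 - \<sigma> / (2 * norm y)\<bar> = 1 - \<sigma> / (2 * norm y)" using False ny by (simp add: field_simps)
  also have "(1 - \<sigma> / (2 * norm y)) * norm y = norm y - \<sigma> / 2" using ny by (simp add: field_simps)
  finally have nz: "norm z = norm y - \<sigma> / 2" .
  have "ball z (\<sigma> / 2) \<subseteq> ball 0 \<rho> \<inter> cball y \<sigma>"
  proof
    fix x assume "x \<in> ball z (\<sigma> / 2)"
    then have d: "dist z x < \<sigma> / 2" by simp
    have "norm x \<le> norm z + dist z x" by (metis dist_commute dist_norm norm_triangle_sub)
    moreover have "dist y x \<le> dist y z + dist z x" by (rule dist_triangle)
    ultimately show "x \<in> ball 0 \<rho> \<inter> cball y \<sigma>" using d nz y \<open>dist y z = \<sigma> / 2\<close> by simp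
  qed
  then show ?thesis by blast
qed

text \<open>The double integral in the mild formulation is a Bochner integral; since its integrand is nonnegative
  almost everywhere, it is bounded below by a nonnegative integral with a smaller kernel \<open>L\<close>.\<close>

lemma duhamel_lower_bound:
  fixes u :: "real^'n \<Rightarrow> real \<Rightarrow> real" and Yk L :: "real^'n \<Rightarrow> real \<Rightarrow> real"
  assumes p: "1 < p" and t: "0 < t"
    and nn: "AE s in lborel. 0 < s \<longrightarrow> (AE y in lborel. 0 \<le> u y s)"
    and Yk: "\<And>z \<tau>. z \<noteq> 0 \<Longrightarrow> 0 < \<tau> \<Longrightarrow> 0 \<le> L z \<tau> \<and> L z \<tau> \<le> Yk z \<tau>"
    and int: "set_integrable (lborel \<Otimes>\<^sub>M lborel) (UNIV \<times> {0<..<t})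
         (\<lambda>(y, s). \<bar>u y s\<bar> powr (p - 1) * u y s * Yk (x - y) (t - s))"
  shows "0 \<le> (LBINT s:{0<..<t}. LBINT y. \<bar>u y s\<bar> powr (p - 1) * u y s * Yk (x - y) (t - s))"
    and "(\<integral>\<^sup>+ s. (\<integral>\<^sup>+ y. ennreal (max 0 (u y s) powr p * L (x - y) (t - s)) * indicator {0<..<t} s \<partial>lborel) \<partial>lborel)
       \<le> ennreal (LBINT s:{0<..<t}. LBINT y. \<bar>u y s\<bar> powr (p - 1) * u y s * Yk (x - y) (t - s))"
proof -
  let ?D = "LBINT s:{0<..<t}. LBINT y. \<bar>u y s\<bar> powr (p - 1) * u y s * Yk (x - y) (t - s)"
  let ?l = "\<lambda>s y. ennreal (max 0 (u y s) powr p * L (x - y) (t - s)) * indicator {0<..<t} s"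
  define g where "g y s = indicator {0<..<t} s * (\<bar>u y s\<bar> powr (p - 1) * u y s * Yk (x - y) (t - s))" for y s
  have gi: "integrable (lborel \<Otimes>\<^sub>M lborel) (\<lambda>(y, s). g y s)"
    using int unfolding set_integrable_def g_def by (simp add: indicator_times case_prod_beta')
  have eq: "?D = (LBINT s. LBINT y. g y s)"
    unfolding set_lebesgue_integral_def g_def by simp
  have I: "integrable lborel (\<lambda>s. LBINT y. g y s)" by (rule lborel_pair.integrable_snd[OF gi])
  have gs: "AE s in lborel. integrable lborel (\<lambda>y. g y s)" by (rule lborel_pair.AE_integrable_snd[OF gi])
  have key: "AE s in lborel. 0 \<le> (LBINT y. g y s) \<and>
     (\<integral>\<^sup>+ y. ?l s y \<partial>lborel) \<le> ennreal (LBINT y. g y s)"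
    using nn gs
  proof eventually_elim
    case (elim s)
    show ?case
    proof (cases "s \<in> {0<..<t}")
      case True
      then have "AE y in lborel. 0 \<le> u y s" using elim by simp
      then have ae: "AE y in lborel. 0 \<le> g y s \<and> max 0 (u y s) powr p * L (x - y) (t - s) \<le> g y s"
        using AE_lborel_singleton[of x]
      proof eventually_elim
        case (elim y)
        have up: "\<bar>u y s\<bar> powr (p - 1) * u y s = max 0 (u y s) powr p"
          using elim p powr_add[of "u y s" "p - 1" 1] by (cases "u y s = 0") auto
        have "0 \<le> L (x - y) (t - s)" "L (x - y) (t - s) \<le> Yk (x - y) (t - s)"
          using Yk[of "x - y" "t - s"] elim True by auto
        then show ?case using True unfolding g_def up by (auto intro!: mult_left_mono)
      qed
      have n0: "0 \<le> (LBINT y. g y s)" by (rule integral_nonneg_AE) (use ae in \<open>auto elim: eventually_mono\<close>)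
      have "(\<integral>\<^sup>+ y. ?l s y \<partial>lborel)
        \<le> (\<integral>\<^sup>+ y. ennreal (g y s) \<partial>lborel)"
      proof (rule nn_integral_mono_AE)
        show "AE y in lborel. ?l s y \<le> ennreal (g y s)"
          using ae by eventually_elim (use True in \<open>auto intro!: ennreal_leI\<close>)
      qed
      also have "\<dots> = ennreal (LBINT y. g y s)"
        by (rule nn_integral_eq_integral) (use elim ae in \<open>auto elim: eventually_mono\<close>)
      finally show ?thesis using n0 by simp
    qed (simp add: g_def)
  qed
  show "0 \<le> ?D"
    unfolding eq by (rule integral_nonneg_AE) (use key in \<open>auto elim: eventually_mono\<close>)
  have "(\<integral>\<^sup>+ s. (\<integral>\<^sup>+ y. ?l s y \<partial>lborel) \<partial>lborel)
     \<le> (\<integral>\<^sup>+ s. ennreal (LBINT y. g y s) \<partial>lborel)"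
    by (rule nn_integral_mono_AE) (use key in \<open>auto elim: eventually_mono\<close>)
  also have "\<dots> = ennreal (LBINT s. LBINT y. g y s)"
    by (rule nn_integral_eq_integral[OF I]) (use key in \<open>auto elim: eventually_mono\<close>)
  finally show "(\<integral>\<^sup>+ s. (\<integral>\<^sup>+ y. ?l s y \<partial>lborel) \<partial>lborel)
       \<le> ennreal ?D"
    unfolding eq .
qed

text \<open>Let \<open>F t\<close> be the mass of \<open>u\<close> in the ball \<open>B\<close> of radius \<open>R\<^sup>\<gamma>\<close>, \<open>\<gamma> = \<alpha> / 2 \<beta>\<close>. For \<open>R/4 < t < R\<close> any two
  points of \<open>B\<close> are within \<open>2 R\<^sup>\<gamma> \<le> 2 4\<^sup>\<gamma> t\<^sup>\<gamma>\<close>, whence the width of the parabolic region, so the datum alone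
  contributes at least \<open>A = c v M\<close>. For a lag \<open>\<tau> < R\<close>, at least the mass \<open>k0\<close> of \<open>Y(\<cdot> - y, \<tau>)\<close> stays in
  \<open>B\<close> when \<open>y \<in> B\<close>. The iteration lemma then makes \<open>F\<close> infinite on \<open>(R/2, R)\<close>, but \<open>F\<close> is finite because
  \<open>u\<close> is locally bounded in \<open>L\<^sup>q\<close>.\<close>

lemma no_global_solution:
  fixes Z u :: "real^'n \<Rightarrow> real \<Rightarrow> real" and u0 :: "real^'n \<Rightarrow> real"
  defines "N \<equiv> CARD('n)"
  assumes \<alpha>: "0 < \<alpha>" "\<alpha> < 1" and \<beta>: "0 < \<beta>" and p: "1 < p" and q: "1 \<le> q" and c: "0 < c"
    and kb: "\<And>x t. x \<noteq> 0 \<Longrightarrow> 0 < t \<Longrightarrow> 0 \<le> Z x t \<and> 0 \<le> Y_kernel \<alpha> Z x t \<and>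
       (norm x \<le> 2 * 4 powr (\<alpha> / (2 * \<beta>)) * t powr (\<alpha> / (2 * \<beta>)) \<longrightarrow>
          c * t powr (- (real N * \<alpha> / (2 * \<beta>))) \<le> Z x t \<and>
          c * t powr (\<alpha> - 1 - real N * \<alpha> / (2 * \<beta>)) \<le> Y_kernel \<alpha> Z x t)"
    and Zi: "\<And>t. 0 < t \<Longrightarrow> integrable lborel (\<lambda>x. Z x t)"
    and sol: "Lq_solution \<alpha> p q Z u0 u \<infinity>" and nonneg: "nonneg_on_time u \<infinity>"
    and R: "0 < R"
    and big: "R powr (\<alpha> / (p - 1) - real N * \<alpha> / (2 * \<beta>)) * (LBINT y:{y. norm y < R powr (\<alpha> / (2 * \<beta>))}. u0 y)
       > (8 * 2 powr (1 / (p - 1)) * 2 ^ N / (c powr p * unit_ball_vol (real N))) powr (1 / (p - 1))"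
  shows False
proof -
  define \<gamma> where "\<gamma> = \<alpha> / (2 * \<beta>)"
  define d where "d = real N * \<alpha> / (2 * \<beta>)"
  define \<rho> where "\<rho> = R powr \<gamma>"
  define B where "B = ball (0::real^'n) \<rho>"
  define v where "v = unit_ball_vol (real N)"
  define b where "b = v * R powr d"
  define M where "M = (LBINT y:B. u0 y)"
  have \<gamma>: "0 < \<gamma>" using \<alpha> \<beta> by (simp add: \<gamma>_def)
  have v: "0 < v" by (simp add: v_def unit_ball_vol_pos)
  have b: "0 < b" using v R by (simp add: b_def)
  have \<rho>: "0 < \<rho>" using R by (simp add: \<rho>_def)
  have powN: "(s powr \<gamma>) ^ N = s powr d" if "0 < s" for s
    using that by (simp add: powr_powr d_def \<gamma>_def mult_ac flip: powr_realpow)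
  have [measurable]: "B \<in> sets borel" by (simp add: B_def)
  have eB: "emeasure lborel B = ennreal b"
    unfolding B_def using \<rho> R by (simp add: emeasure_ball b_def v_def N_def[symmetric] \<rho>_def powN)
  note kb = kb[folded \<gamma>_def d_def]
  have u0m[measurable]: "u0 \<in> borel_measurable borel" and u0q: "in_Lq q u0"
    and um: "set_borel_measurable borel (UNIV \<times> {t. 0 < t \<and> ereal t < \<infinity>}) (\<lambda>(x, t). u x t)"
    and ubd: "bounded_in_Lq q u R"
    and eqn: "AE t in lborel. 0 < t \<longrightarrow> (AE x in lborel.
           set_integrable (lborel \<Otimes>\<^sub>M lborel) (UNIV \<times> {0<..<t})
             (\<lambda>(y, s). \<bar>u y s\<bar> powr (p - 1) * u y s * Y_kernel \<alpha> Z (x - y) (t - s)) \<and>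
           u x t = (LBINT y. u0 y * Z (x - y) t) +
             (LBINT s:{0<..<t}. LBINT y. \<bar>u y s\<bar> powr (p - 1) * u y s * Y_kernel \<alpha> Z (x - y) (t - s)))"
    and lim: "((\<lambda>t. Lq_norm q (\<lambda>x. u x t - u0 x)) \<longlongrightarrow> 0) (ess_at_right 0)"
    using sol R unfolding Lq_solution_def in_Lq_def by auto
  have nn: "AE t in lborel. 0 < t \<longrightarrow> (AE x in lborel. 0 \<le> u x t)"
    using nonneg by (simp add: nonneg_on_time_def)
  have u0nn: "AE x in lborel. 0 \<le> u0 x" by (rule initial_datum_nonneg[OF q u0m nn lim])
  \<comment> \<open>Raised to the power \<open>p - 1\<close>, the size condition becomes the hypothesis of the iteration:
    the powers of \<open>R\<close> in \<open>k0\<close>, \<open>b\<close> and \<open>A\<close> combine to that of the scale-invariant initial mass.\<close>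
  have M: "0 < M" and bigM: "8 * 2 powr (1 / (p - 1)) * 2 ^ N / (c powr p * v) \<le> (R powr (\<alpha> / (p - 1) - d) * M) powr (p - 1)"
  proof -
    let ?C = "8 * 2 powr (1 / (p - 1)) * 2 ^ N / (c powr p * v)"
    have C0: "0 < ?C" using c v by simp
    have "{y. norm y < R powr \<gamma>} = B" by (auto simp: B_def \<rho>_def)
    then have X: "?C powr (1 / (p - 1)) < R powr (\<alpha> / (p - 1) - d) * M"
      using big unfolding M_def v_def d_def \<gamma>_def by simp
    then have "0 < R powr (\<alpha> / (p - 1) - d) * M" using powr_ge_zero[of ?C "1 / (p - 1)"] by linarith
    then show "0 < M" using R by (simp add: zero_less_mult_iff)
    have "(?C powr (1 / (p - 1))) powr (p - 1) \<le> (R powr (\<alpha> / (p - 1) - d) * M) powr (p - 1)"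
      using X p by (intro powr_mono2) auto
    also have "(?C powr (1 / (p - 1))) powr (p - 1) = ?C" using p c v by (simp add: powr_powr abs_mult)
    finally show "?C \<le> (R powr (\<alpha> / (p - 1) - d) * M) powr (p - 1)" .
  qed
  define A where "A = c * v * M"
  define k0 where "k0 = c * v * (1/2) ^ N * R powr (\<alpha> - 1)"
  have A: "0 < A" and k0: "0 < k0" using c v M R by (auto simp: A_def k0_def)
  have bigA: "8 * 2 powr (1 / (p - 1)) \<le> k0 * b powr (1 - p) * R * A powr (p - 1)"
  proof -
    have "k0 * b powr (1 - p) * R * A powr (p - 1) =
       (c * c powr (p - 1)) * (v * v powr (1 - p) * v powr (p - 1)) * (1/2) ^ N * (R powr (\<alpha> - 1) * (R powr d) powr (1 - p) * R) * M powr (p - 1)"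
      using c v M R by (simp add: k0_def b_def A_def powr_mult mult_ac)
    also have "c * c powr (p - 1) = c powr p" using c powr_add[of c 1 "p - 1"] by simp
    also have "v * v powr (1 - p) * v powr (p - 1) = v" using v by (simp add: mult.assoc flip: powr_add)
    also have "R powr (\<alpha> - 1) * (R powr d) powr (1 - p) * R = (R powr (\<alpha> / (p - 1) - d)) powr (p - 1)"
    proof -
      have "R powr (\<alpha> - 1) * (R powr d) powr (1 - p) * R = R powr (\<alpha> - 1) * R powr (d * (1 - p)) * R powr 1"
        using R by (simp add: powr_powr)
      also have "\<dots> = R powr ((\<alpha> / (p - 1) - d) * (p - 1))"
        unfolding powr_add[symmetric] using p by (intro arg_cong[where f = "\<lambda>x. R powr x"]) (simp add: field_simps)
      finally show ?thesis by (simp add: powr_powr)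
    qed
    also have "c powr p * v * (1/2) ^ N * (R powr (\<alpha> / (p - 1) - d)) powr (p - 1) * M powr (p - 1) =
      c powr p * v * (1/2) ^ N * (R powr (\<alpha> / (p - 1) - d) * M) powr (p - 1)"
      using M by (simp add: powr_mult)
    finally have eq: "k0 * b powr (1 - p) * R * A powr (p - 1) = c powr p * v * (1/2) ^ N * (R powr (\<alpha> / (p - 1) - d) * M) powr (p - 1)" .
    have "c powr p * v * (1/2) ^ N * (8 * 2 powr (1 / (p - 1)) * 2 ^ N / (c powr p * v)) \<le> c powr p * v * (1/2) ^ N * (R powr (\<alpha> / (p - 1) - d) * M) powr (p - 1)"
      using c v by (intro mult_left_mono bigM) auto
    moreover have "c powr p * v * (1/2) ^ N * (8 * 2 powr (1 / (p - 1)) * 2 ^ N / (c powr p * v)) = 8 * 2 powr (1 / (p - 1))"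
      using c v by (simp add: field_simps power_divide)
    ultimately show ?thesis using eq by linarith
  qed
  \<comment> \<open>Tonelli needs a jointly measurable nonnegative integrand, whereas \<open>u\<close> is measurable only for
    positive times and nonnegative only almost everywhere.\<close>
  define U where "U x t = max 0 (indicator {0<..} t * u x t)" for x t
  have U0: "0 \<le> U x t" for x t by (simp add: U_def)
  have Ut: "U x t = max 0 (u x t)" if "0 < t" for x t using that by (simp add: U_def)
  have u'm: "(\<lambda>(x, t). indicator {0<..} t * u x t) \<in> borel_measurable (borel \<Otimes>\<^sub>M borel)"
    using um unfolding set_borel_measurable_def borel_prod by (simp add: indicator_times case_prod_beta' greaterThan_def)
  have Um: "(\<lambda>(x, t). U x t) \<in> borel_measurable (borel \<Otimes>\<^sub>M borel)"
    using u'm unfolding U_def by measurable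
  have U_meas[measurable (raw)]: "(\<lambda>w. U (f w) (g w)) \<in> borel_measurable W"
    if "f \<in> measurable W borel" "g \<in> borel_measurable W" for f g and W :: "'w measure"
    using measurable_compose[OF measurable_Pair[OF that] Um] by simp
  have usec: "(\<lambda>x. u x t) \<in> borel_measurable borel" if "0 < t" for t
    using measurable_compose[OF measurable_Pair[of "\<lambda>x. x" borel borel "\<lambda>_. t"] u'm] that by simp
  define F where "F t = (\<integral>\<^sup>+ x. ennreal (U x t) * indicator B x \<partial>lborel)" for t
  define H where "H s = (\<integral>\<^sup>+ y. ennreal (U y s powr p) * indicator B y \<partial>lborel)" for s
  have Hm[measurable]: "H \<in> borel_measurable borel"
    unfolding H_def by measurable
  have J: "ennreal (a powr p * b powr (1 - p)) \<le> H s" if "0 \<le> a" "ennreal a \<le> F s" for s a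
    unfolding H_def
    by (rule nn_integral_powr_ge[OF p]) (use that U0 eB b in \<open>auto simp: F_def\<close>)
  define L where "L z \<tau> = (if norm z \<le> \<tau> powr \<gamma> then c * \<tau> powr (\<alpha> - 1 - d) else 0)" for z :: "real^'n" and \<tau>
  have L0: "0 \<le> L z \<tau>" for z \<tau> using c by (simp add: L_def)
  have [measurable (raw)]: "(\<lambda>w. L (f w) (g w)) \<in> borel_measurable W"
    if [measurable]: "f \<in> measurable W borel" "g \<in> borel_measurable W" for f g and W :: "'w measure"
    unfolding L_def by measurable
  have K1: "1 \<le> 2 * 4 powr \<gamma>" using \<gamma> ge_one_powr_ge_zero[of 4 \<gamma>] by simp
  have LY: "0 \<le> L z \<tau> \<and> L z \<tau> \<le> Y_kernel \<alpha> Z z \<tau>" if "z \<noteq> 0" "0 < \<tau>" for z \<tau>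
  proof (cases "norm z \<le> \<tau> powr \<gamma>")
    case True
    then have "norm z \<le> 2 * 4 powr \<gamma> * \<tau> powr \<gamma>"
      using mult_right_mono[OF K1, of "\<tau> powr \<gamma>"] by simp
    then show ?thesis using kb[OF that] True c by (simp add: L_def)
  next
    case False
    then show ?thesis using kb[OF that] by (simp add: L_def)
  qed
  have Lmass: "ennreal k0 \<le> (\<integral>\<^sup>+ x. ennreal (L (x - y) \<tau>) * indicator B x \<partial>lborel)"
    if y: "y \<in> B" and \<tau>: "0 < \<tau>" "\<tau> < R" for y \<tau>
  proof -
    define \<sigma> where "\<sigma> = \<tau> powr \<gamma>"
    have \<sigma>: "0 < \<sigma>" "\<sigma> \<le> \<rho>" using \<tau> \<gamma> by (auto simp: \<sigma>_def \<rho>_def intro!: powr_mono2)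
    obtain z where z: "ball z (\<sigma> / 2) \<subseteq> ball 0 \<rho> \<inter> cball y \<sigma>"
      using ball_inter_large[of y \<rho> \<sigma>] y \<sigma> by (auto simp: B_def)
    have "R powr (\<alpha> - 1) \<le> \<tau> powr (\<alpha> - 1)" using \<tau> \<alpha> by (intro powr_mono2') auto
    also have "\<tau> powr (\<alpha> - 1) = \<tau> powr (\<alpha> - 1 - d) * \<sigma> ^ N"
      unfolding \<sigma>_def powN[OF \<tau>(1)] by (simp flip: powr_add)
    finally have "c * v * (1/2) ^ N * R powr (\<alpha> - 1) \<le> c * v * (1/2) ^ N * (\<tau> powr (\<alpha> - 1 - d) * \<sigma> ^ N)"
      using c v by (intro mult_left_mono) auto
    also have "\<dots> = c * \<tau> powr (\<alpha> - 1 - d) * (v * (\<sigma> / 2) ^ N)" by (simp add: power_divide)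
    finally have "ennreal k0 \<le> ennreal (c * \<tau> powr (\<alpha> - 1 - d)) * ennreal (v * (\<sigma> / 2) ^ N)"
      unfolding k0_def using c by (subst ennreal_mult'[symmetric]) (auto intro: ennreal_leI)
    also have "ennreal (v * (\<sigma> / 2) ^ N) = emeasure lborel (ball z (\<sigma> / 2))"
      using \<sigma> by (simp add: emeasure_ball v_def N_def)
    also have "ennreal (c * \<tau> powr (\<alpha> - 1 - d)) * emeasure lborel (ball z (\<sigma> / 2)) =
       (\<integral>\<^sup>+ x. ennreal (c * \<tau> powr (\<alpha> - 1 - d)) * indicator (ball z (\<sigma> / 2)) x \<partial>lborel)"
      by (simp add: nn_integral_cmult_indicator)
    also have "\<dots> \<le> (\<integral>\<^sup>+ x. ennreal (L (x - y) \<tau>) * indicator B x \<partial>lborel)"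
    proof (rule nn_integral_mono)
      fix x
      show "ennreal (c * \<tau> powr (\<alpha> - 1 - d)) * indicator (ball z (\<sigma> / 2)) x \<le> ennreal (L (x - y) \<tau>) * indicator B x"
      proof (cases "x \<in> ball z (\<sigma> / 2)")
        case True
        then have "x \<in> ball 0 \<rho> \<inter> cball y \<sigma>" using z by blast
        then have "x \<in> B" "norm (x - y) \<le> \<sigma>" by (auto simp: B_def dist_norm norm_minus_commute)
        then show ?thesis using True by (simp add: L_def \<sigma>_def)
      qed simp
    qed
    finally show ?thesis .
  qed
  have part_a: "AE x in lborel. 0 \<le> (LBINT y. u0 y * Z (x - y) t) \<and>
      (x \<in> B \<and> R / 4 < t \<longrightarrow> c * R powr (- d) * M \<le> (LBINT y. u0 y * Z (x - y) t))"
    if t: "0 < t" "t < R" for t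
    using convolution_integrable_AE[OF q u0q Zi[OF t(1)]]
  proof eventually_elim
    case (elim x)
    have ae: "AE y in lborel. 0 \<le> u0 y \<and> y \<noteq> x" using u0nn AE_lborel_singleton[of x] by eventually_elim auto
    have "0 \<le> (LBINT y. u0 y * Z (x - y) t)"
    proof (rule integral_nonneg_AE)
      show "AE y in lborel. 0 \<le> u0 y * Z (x - y) t"
        using ae by eventually_elim (use kb t in auto)
    qed
    moreover have "c * R powr (- d) * M \<le> (LBINT y. u0 y * Z (x - y) t)" if x: "x \<in> B" and t4: "R / 4 < t"
    proof -
      \<comment> \<open>A Bochner integral different from 0 can only come from an integrable function.\<close>
      have M_int: "integrable lborel (\<lambda>y. indicator B y *\<^sub>R u0 y)"
        using M unfolding M_def set_lebesgue_integral_def by (metis less_irrefl not_integrable_integral_eq)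
      have "c * R powr (- d) * M = (LBINT y. c * R powr (- d) * (indicator B y *\<^sub>R u0 y))"
        unfolding M_def set_lebesgue_integral_def by simp
      also have "\<dots> \<le> (LBINT y. u0 y * Z (x - y) t)"
      proof (rule integral_mono_AE)
        show "integrable lborel (\<lambda>y. c * R powr (- d) * (indicator B y *\<^sub>R u0 y))" using M_int by simp
        show "integrable lborel (\<lambda>y. u0 y * Z (x - y) t)" by (rule elim)
        show "AE y in lborel. c * R powr (- d) * (indicator B y *\<^sub>R u0 y) \<le> u0 y * Z (x - y) t"
          using ae
        proof eventually_elim
          case (elim y)
          then have ne: "x - y \<noteq> 0" by auto
          show ?case
          proof (cases "y \<in> B")
            case True
            have "norm (x - y) \<le> norm x + norm y" by (rule norm_triangle_ineq4)
            also have "\<dots> \<le> 2 * \<rho>" using x True by (simp add: B_def)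
            also have "\<rho> = 4 powr \<gamma> * (R / 4) powr \<gamma>" using R by (simp add: \<rho>_def powr_divide)
            also have "2 * (4 powr \<gamma> * (R / 4) powr \<gamma>) \<le> 2 * 4 powr \<gamma> * t powr \<gamma>"
              using t4 R \<gamma> by (auto intro!: powr_mono2)
            finally have "c * t powr (- d) \<le> Z (x - y) t" using kb[OF ne t(1)] by blast
            moreover have "R powr (- d) \<le> t powr (- d)"
              using t \<alpha> \<beta> by (intro powr_mono2') (auto simp: d_def)
            then have "c * R powr (- d) \<le> c * t powr (- d)" using c by simp
            ultimately have "c * R powr (- d) \<le> Z (x - y) t" by linarith
            then have "c * R powr (- d) * u0 y \<le> Z (x - y) t * u0 y" using elim by (intro mult_right_mono) auto
            then show ?thesis using True by (simp add: mult.commute)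
          next
            case False
            then show ?thesis using elim kb[OF ne t(1)] by simp
          qed
        qed
      qed
      finally show ?thesis .
    qed
    ultimately show ?case by blast
  qed
  let ?HH = "\<lambda>t. \<integral>\<^sup>+ s. ennreal k0 * H s * indicator {0<..<t} s \<partial>lborel"
  have F_bounds: "AE t in lborel. 0 < t \<and> t < R \<longrightarrow>
     (R / 4 < t \<longrightarrow> ennreal A \<le> F t) \<and>
     ?HH t \<le> F t"
    using eqn
  proof eventually_elim
    case (elim t)
    show ?case
    proof (intro impI)
      assume t: "0 < t \<and> t < R"
      define a where "a x = (LBINT y. u0 y * Z (x - y) t)" for x
      define G where "G x s y = ennreal (U y s powr p * L (x - y) (t - s)) * indicator {0<..<t} s" for x s y
      let ?GG = "\<lambda>x. \<integral>\<^sup>+ s. (\<integral>\<^sup>+ y. G x s y \<partial>lborel) \<partial>lborel"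
      have G_meas[measurable (raw)]: "(\<lambda>w. G (f w) (g w) (h w)) \<in> borel_measurable W"
        if [measurable]: "f \<in> measurable W borel" "g \<in> borel_measurable W" "h \<in> measurable W borel" for f g h and W :: "'w measure"
        unfolding G_def by measurable
      have pa: "AE x in lborel. 0 \<le> a x \<and> (x \<in> B \<and> R / 4 < t \<longrightarrow> c * R powr (- d) * M \<le> a x)"
        using part_a[of t] t unfolding a_def by blast
      have "AE x in lborel.
           set_integrable (lborel \<Otimes>\<^sub>M lborel) (UNIV \<times> {0<..<t})
             (\<lambda>(y, s). \<bar>u y s\<bar> powr (p - 1) * u y s * Y_kernel \<alpha> Z (x - y) (t - s)) \<and>
           u x t = a x +
             (LBINT s:{0<..<t}. LBINT y. \<bar>u y s\<bar> powr (p - 1) * u y s * Y_kernel \<alpha> Z (x - y) (t - s))"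
        using elim t by (simp add: a_def)
      then have low: "AE x in lborel. ?GG x \<le> ennreal (U x t) \<and>
          (x \<in> B \<and> R / 4 < t \<longrightarrow> c * R powr (- d) * M \<le> U x t)"
        using pa
      proof eventually_elim
        case (elim x)
        define bb where "bb = (LBINT s:{0<..<t}. LBINT y. \<bar>u y s\<bar> powr (p - 1) * u y s * Y_kernel \<alpha> Z (x - y) (t - s))"
        note si = elim(1)[THEN conjunct1]
        have b0: "0 \<le> bb" unfolding bb_def
          by (rule duhamel_lower_bound(1)[OF p _ nn LY si]) (use t in auto)
        have "(\<integral>\<^sup>+ s. (\<integral>\<^sup>+ y. ennreal (max 0 (u y s) powr p * L (x - y) (t - s)) * indicator {0<..<t} s \<partial>lborel) \<partial>lborel) \<le> ennreal bb"
          unfolding bb_def by (rule duhamel_lower_bound(2)[OF p _ nn LY si]) (use t in auto)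
        also have "(\<lambda>s. \<integral>\<^sup>+ y. ennreal (max 0 (u y s) powr p * L (x - y) (t - s)) * indicator {0<..<t} s \<partial>lborel) = (\<lambda>s. \<integral>\<^sup>+ y. G x s y \<partial>lborel)"
          by (intro ext nn_integral_cong) (auto simp: G_def Ut indicator_def)
        finally have "?GG x \<le> ennreal bb" .
        moreover have "u x t = a x + bb" using elim(1) by (simp add: bb_def)
        moreover have "bb \<le> U x t" "a x \<le> U x t"
          using elim(2) b0 t \<open>u x t = a x + bb\<close> by (auto simp: Ut)
        ultimately show ?case using elim(2) by (auto intro: order_trans ennreal_leI)
      qed
      have "ennreal A \<le> F t" if t4: "R / 4 < t"
      proof -
        have "R powr (- d) * R powr d = 1" using R by (simp flip: powr_add)
        then have "A = (c * R powr (- d) * M) * b" by (simp add: A_def b_def)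
        then have "ennreal A = ennreal (c * R powr (- d) * M) * ennreal b"
          using c M by (simp only: ennreal_mult' mult_nonneg_nonneg less_imp_le powr_ge_zero)
        also have "\<dots> = (\<integral>\<^sup>+ x. ennreal (c * R powr (- d) * M) * indicator B x \<partial>lborel)"
          by (simp add: nn_integral_cmult_indicator eB)
        also have "\<dots> \<le> F t"
          unfolding F_def
        proof (rule nn_integral_mono_AE)
          show "AE x in lborel. ennreal (c * R powr (- d) * M) * indicator B x \<le> ennreal (U x t) * indicator B x"
            using low by eventually_elim (use t4 in \<open>auto simp: indicator_def intro!: ennreal_leI\<close>)
        qed
        finally show ?thesis .
      qed
      moreover have "?HH t \<le> F t"
      proof -
        have "?HH t \<le>
          (\<integral>\<^sup>+ s. (\<integral>\<^sup>+ y. (\<integral>\<^sup>+ x. G x s y * indicator B x \<partial>lborel) \<partial>lborel) \<partial>lborel)"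
        proof (rule nn_integral_mono)
          fix s
          show "ennreal k0 * H s * indicator {0<..<t} s \<le> (\<integral>\<^sup>+ y. (\<integral>\<^sup>+ x. G x s y * indicator B x \<partial>lborel) \<partial>lborel)"
          proof (cases "s \<in> {0<..<t}")
            case True
            have "ennreal k0 * H s = (\<integral>\<^sup>+ y. ennreal k0 * (ennreal (U y s powr p) * indicator B y) \<partial>lborel)"
              unfolding H_def by (rule nn_integral_cmult[symmetric]) measurable
            also have "\<dots> \<le> (\<integral>\<^sup>+ y. (\<integral>\<^sup>+ x. G x s y * indicator B x \<partial>lborel) \<partial>lborel)"
            proof (rule nn_integral_mono)
              fix y
              show "ennreal k0 * (ennreal (U y s powr p) * indicator B y) \<le> (\<integral>\<^sup>+ x. G x s y * indicator B x \<partial>lborel)"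
              proof (cases "y \<in> B")
                case yB: True
                have "ennreal (U y s powr p) * ennreal k0 \<le> ennreal (U y s powr p) * (\<integral>\<^sup>+ x. ennreal (L (x - y) (t - s)) * indicator B x \<partial>lborel)"
                  by (intro mult_left_mono Lmass) (use yB True t in auto)
                also have "\<dots> = (\<integral>\<^sup>+ x. ennreal (U y s powr p) * (ennreal (L (x - y) (t - s)) * indicator B x) \<partial>lborel)"
                  by (rule nn_integral_cmult[symmetric]) measurable
                also have "\<dots> = (\<integral>\<^sup>+ x. G x s y * indicator B x \<partial>lborel)"
                  using True L0 by (intro nn_integral_cong) (simp add: G_def ennreal_mult' mult.assoc)
                finally show ?thesis using yB by (simp add: mult.commute)
              qed simp
            qed
            finally show ?thesis using True by simp
          qed simp
        qed
        also have "\<dots> = (\<integral>\<^sup>+ s. (\<integral>\<^sup>+ x. (\<integral>\<^sup>+ y. G x s y * indicator B x \<partial>lborel) \<partial>lborel) \<partial>lborel)"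
          by (intro nn_integral_cong lborel_pair.Fubini') measurable
        also have "\<dots> = (\<integral>\<^sup>+ x. (\<integral>\<^sup>+ s. (\<integral>\<^sup>+ y. G x s y * indicator B x \<partial>lborel) \<partial>lborel) \<partial>lborel)"
          by (intro lborel_pair.Fubini') measurable
        also have "\<dots> = (\<integral>\<^sup>+ x. ?GG x * indicator B x \<partial>lborel)"
          by (simp add: nn_integral_multc)
        also have "\<dots> \<le> F t"
          unfolding F_def
        proof (rule nn_integral_mono_AE)
          show "AE x in lborel. ?GG x * indicator B x \<le> ennreal (U x t) * indicator B x"
            using low by eventually_elim (auto intro!: mult_right_mono)
        qed
        finally show ?thesis .
      qed
      ultimately show "(R / 4 < t \<longrightarrow> ennreal A \<le> F t) \<and>
         ?HH t \<le> F t" by blast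
    qed
  qed
  have "AE t in lborel. R / 2 < t \<and> t < R \<longrightarrow> F t = \<infinity>"
  proof (rule blowup_iteration[OF R A k0 b p Hm J _ _ bigA])
    show "AE t in lborel. R / 4 < t \<and> t < R \<longrightarrow> ennreal A \<le> F t"
      using F_bounds by eventually_elim (use R in auto)
    show "AE t in lborel. 0 < t \<and> t < R \<longrightarrow> ?HH t \<le> F t"
      using F_bounds by eventually_elim auto
  qed
  moreover have "AE t in lborel. 0 < t \<and> t < R \<longrightarrow> F t \<noteq> \<infinity>"
  proof -
    obtain M' :: real where M': "AE t in lborel. 0 < t \<and> t < R \<longrightarrow> Lq_norm q (\<lambda>x. u x t) \<le> ennreal M'"
      using ubd unfolding bounded_in_Lq_def by blast
    then show ?thesis
    proof eventually_elim
      case (elim t)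
      show ?case
      proof
        assume t: "0 < t \<and> t < R"
        then have "Lq_norm q (\<lambda>x. u x t) < \<infinity>" using elim by (auto simp: less_top[symmetric] top_unique)
        then obtain m g where m: "0 \<le> m" and g0: "\<And>x. 0 \<le> g x" and gi: "integrable lborel g"
          and le: "AE x in lborel. \<bar>u x t\<bar> \<le> m + g x"
          using in_Lq_dominated[OF q usec[of t]] t by blast
        have [measurable]: "g \<in> borel_measurable borel" using gi by auto
        have "F t \<le> (\<integral>\<^sup>+ x. ennreal m * indicator B x + ennreal (g x) \<partial>lborel)"
          unfolding F_def
        proof (rule nn_integral_mono_AE)
          show "AE x in lborel. ennreal (U x t) * indicator B x \<le> ennreal m * indicator B x + ennreal (g x)"
            using le
          proof eventually_elim
            case (elim x)
            then have "U x t \<le> m + g x" using t m g0[of x] by (simp add: Ut)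
            then have "ennreal (U x t) \<le> ennreal m + ennreal (g x)" using m g0[of x] by (simp flip: ennreal_plus)
            then show ?case by (simp add: indicator_def)
          qed
        qed
        also have "\<dots> = ennreal m * ennreal b + (\<integral>\<^sup>+ x. ennreal (g x) \<partial>lborel)"
          by (subst nn_integral_add) (auto simp: nn_integral_cmult_indicator eB)
        also have "\<dots> < \<infinity>"
          using gi g0 by (simp add: integrable_iff_bounded ennreal_mult_less_top)
        finally show "F t \<noteq> \<infinity>" by simp
      qed
    qed
  qed
  ultimately have "AE t in lborel. t \<notin> {R / 2<..<R}"
    by eventually_elim (use R in auto)
  then have "emeasure lborel {t. \<not> t \<notin> {R / 2<..<R}} = 0" by (subst (asm) AE_iff_measurable[OF _ refl]) auto
  then have "emeasure lborel {R / 2<..<R} = 0" by (simp only: not_not Collect_mem_eq)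
  then show False using R by simp
qed

text \<open>A finite upper limit bounds the norm near \<open>T\<close>, and local boundedness covers the rest of \<open>(0, T)\<close>.\<close>

lemma blowup_at_finite_maximal_time:
  fixes u :: "real^'n \<Rightarrow> real \<Rightarrow> real"
  assumes T: "0 < T" and loc: "\<And>\<tau>. 0 < \<tau> \<Longrightarrow> \<tau> < T \<Longrightarrow> bounded_in_Lq q u \<tau>" and nb: "\<not> bounded_in_Lq q u T"
  shows "Limsup (ess_at_left T) (\<lambda>t. Lq_norm q (\<lambda>x. u x t)) = \<infinity>"
proof (rule ccontr)
  assume "Limsup (ess_at_left T) (\<lambda>t. Lq_norm q (\<lambda>x. u x t)) \<noteq> \<infinity>"
  then obtain m where m: "Limsup (ess_at_left T) (\<lambda>t. Lq_norm q (\<lambda>x. u x t)) = ennreal m" "0 \<le> m"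
    by (cases "Limsup (ess_at_left T) (\<lambda>t. Lq_norm q (\<lambda>x. u x t))") auto
  have "Limsup (ess_at_left T) (\<lambda>t. Lq_norm q (\<lambda>x. u x t)) < ennreal (m + 1)" using m by simp
  then have "eventually (\<lambda>t. Lq_norm q (\<lambda>x. u x t) < ennreal (m + 1)) (ess_at_left T)" by (rule Limsup_lessD)
  then obtain P Q where P: "eventually P (at_left T)" and Q: "AE t in lborel. Q t"
    and PQ: "\<And>t. P t \<Longrightarrow> Q t \<Longrightarrow> Lq_norm q (\<lambda>x. u x t) < ennreal (m + 1)"
    unfolding ess_at_left_def eventually_inf by blast
  obtain a where a: "a < T" "\<And>t. a < t \<Longrightarrow> t < T \<Longrightarrow> P t"
    using P unfolding eventually_at_left_field by auto
  define \<tau> where "\<tau> = (max 0 a + T) / 2"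
  have \<tau>: "0 < \<tau>" "\<tau> < T" "a < \<tau>" using T a by (auto simp: \<tau>_def)
  obtain M :: real where M: "AE t in lborel. 0 < t \<and> t < \<tau> \<longrightarrow> Lq_norm q (\<lambda>x. u x t) \<le> ennreal M"
    using loc[OF \<tau>(1,2)] unfolding bounded_in_Lq_def by blast
  have "AE t in lborel. 0 < t \<and> t < T \<longrightarrow> Lq_norm q (\<lambda>x. u x t) \<le> ennreal (max M (m + 1))"
    using M Q
  proof eventually_elim
    case (elim t)
    show ?case
    proof
      assume t: "0 < t \<and> t < T"
      show "Lq_norm q (\<lambda>x. u x t) \<le> ennreal (max M (m + 1))"
      proof (cases "t < \<tau>")
        case True
        then show ?thesis using elim t by (meson ennreal_leI max.cobounded1 order_trans)
      next
        case False
        then have "Lq_norm q (\<lambda>x. u x t) < ennreal (m + 1)" using \<tau> a t elim by (intro PQ) auto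
        then show ?thesis by (meson ennreal_leI less_imp_le max.cobounded2 order_trans)
      qed
    qed
  qed
  then show False using nb unfolding bounded_in_Lq_def by blast
qed

theorem theorem6p1:
  fixes \<alpha> \<beta> p :: real
  assumes "0 < \<alpha>" "\<alpha> < 1" "0 < \<beta>" "\<beta> \<le> 1"
    and "real CARD('n) > 4 * \<beta>"
    and "1 < p"
  shows "\<exists>C::real. \<forall>(Z :: real ^ 'n::finite \<Rightarrow> real \<Rightarrow> real) (q::ereal)
           (u0 :: real ^ 'n \<Rightarrow> real) (u :: real ^ 'n \<Rightarrow> real \<Rightarrow> real) (Tstar::ereal).
           fundamental_solution \<alpha> \<beta> Z \<and>
           1 \<le> q \<and>
           Lq_solution \<alpha> p q Z u0 u Tstar \<and>
           maximal_in_Lq q u Tstar \<and>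
           nonneg_on_time u Tstar \<and>
           \<not> trivial_on_time u Tstar \<and>
           (\<exists>R>0. R powr (\<alpha> / (p - 1) - real CARD('n) * \<alpha> / (2 * \<beta>)) *
                   (LBINT y:{y. norm y < R powr (\<alpha> / (2 * \<beta>))}. u0 y) > C)
           \<longrightarrow> (\<exists>T::real. 0 < T \<and> ereal T \<le> Tstar \<and>
                 Limsup (ess_at_left T) (\<lambda>t. Lq_norm q (\<lambda>x. u x t)) = \<infinity>)"
proof -
  let ?N = "CARD('n)"
  obtain c :: real where c: "0 < c" and kb: "\<And>(Z :: real ^ 'n \<Rightarrow> real \<Rightarrow> real) x t.
     fundamental_solution \<alpha> \<beta> Z \<and> x \<noteq> 0 \<and> 0 < t \<Longrightarrow>
       0 \<le> Z x t \<and> 0 \<le> Y_kernel \<alpha> Z x t \<and>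
       (norm x \<le> 2 * 4 powr (\<alpha> / (2 * \<beta>)) * t powr (\<alpha> / (2 * \<beta>)) \<longrightarrow>
          c * t powr (- (real CARD('n) * \<alpha> / (2 * \<beta>))) \<le> Z x t \<and>
          c * t powr (\<alpha> - 1 - real CARD('n) * \<alpha> / (2 * \<beta>)) \<le> Y_kernel \<alpha> Z x t)"
    using fundamental_solution_lower_bounds[where 'n='n, OF assms(1-4), of "2 * 4 powr (\<alpha> / (2 * \<beta>))"] by auto
  define C where "C = (8 * 2 powr (1 / (p - 1)) * 2 ^ ?N / (c powr p * unit_ball_vol (real ?N))) powr (1 / (p - 1))"
  show ?thesis
  proof (rule exI[of _ C], intro allI impI, elim conjE exE)
    fix Z :: "real ^ 'n \<Rightarrow> real \<Rightarrow> real" and q u0 and u :: "real ^ 'n \<Rightarrow> real \<Rightarrow> real" and Tstar :: ereal and R :: real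
    assume Z: "fundamental_solution \<alpha> \<beta> Z" and q: "1 \<le> q" and sol: "Lq_solution \<alpha> p q Z u0 u Tstar"
      and max: "maximal_in_Lq q u Tstar" and nn: "nonneg_on_time u Tstar"
      and R: "0 < R"
      and big: "C < R powr (\<alpha> / (p - 1) - real ?N * \<alpha> / (2 * \<beta>)) * (LBINT y:{y. norm y < R powr (\<alpha> / (2 * \<beta>))}. u0 y)"
    have "0 < Tstar" using sol by (simp add: Lq_solution_def)
    then consider T where "Tstar = ereal T" "0 < T" | "Tstar = \<infinity>" by (cases Tstar) auto
    then show "\<exists>T::real. 0 < T \<and> ereal T \<le> Tstar \<and> Limsup (ess_at_left T) (\<lambda>t. Lq_norm q (\<lambda>x. u x t)) = \<infinity>"
    proof cases
      case 1
      have "Limsup (ess_at_left T) (\<lambda>t. Lq_norm q (\<lambda>x. u x t)) = \<infinity>"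
      proof (rule blowup_at_finite_maximal_time[OF 1(2)])
        show "bounded_in_Lq q u \<tau>" if "0 < \<tau>" "\<tau> < T" for \<tau>
          using sol that 1 by (simp add: Lq_solution_def)
        show "\<not> bounded_in_Lq q u T"
          using max 1 unfolding maximal_in_Lq_def by auto
      qed
      then show ?thesis using 1 by (intro exI[of _ T]) auto
    next
      case 2
      have False
        by (rule no_global_solution[OF assms(1-3) assms(6) q c])
          (use kb Z sol nn R big 2 in \<open>auto simp: C_def fundamental_solution_def\<close>)
      then show ?thesis ..
    qed
  qed
qed

end
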